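(* Suppose that $(\mathcal V,\Omega)\in\mathscr P(\mathcal T,\mathcal S)$ is irreducible and non-exceptional. Then $mc_0(\mathcal V,\Omega)\sim(\mathcal V,\Omega)$. Furthermore, for any $\beta\in\mathbb C^{\hat q}$ such that $add_{-\beta}\circ\mathcal{ML}(\mathcal V,\Omega)$ is non-exceptional, $mc_\beta(\mathcal V,\Omega)$ is also irreducible and non-exceptional. In this case, $$mc_\gamma\circ mc_\beta(\mathcal V,\Omega)\sim mc_{\beta+\gamma}(\mathcal V,\Omega)$$ holds for any $\gamma\in\mathbb C^{\hat q}$. Here $\sim$ denotes isomorphism in $\mathscr P(\mathcal T,\mathcal S)$. The analogous statements hold for an irreducible and non-exceptional differential equation $\frac{du}{dx}=\big(S+\sum_{i=1}^q\frac{A_i}{x-a_i}\big)u$ with $S$ diagonalizable with eigenvalues in $\mathcal S$ (with $\sim$ meaning equality up to a gauge transformation by a constant invertible matrix), under the corresponding non-exceptionality condition on the equation obtained by $add_{-\beta}\circ\mathcal{ML}$.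
   Context: Let $\mathcal T=\{a_1,\dots,a_q\}$ and $\mathcal S=\{\alpha_1,\dots,\alpha_{\hat q}\}$ be finite subsets of $\mathbb C$ (with $q$ and $\hat q$ elements), and $-\mathcal T=\{-a_1,\dots,-a_q\}$, $-\mathcal S=\{-\alpha_1,\dots,-\alpha_{\hat q}\}$. Category $\mathscr P(\mathcal T,\mathcal S)$: objects are pairs $(\mathcal V,\Omega)$ with $\mathcal V$ a finite dimensional $\mathbb C$-vector space and $\Omega=S\,dx+\sum_{i=1}^qA_i\,d\log(x-a_i)$, where $S,A_i\in\mathrm{End}(\mathcal V)$ and $S$ is diagonalizable with all eigenvalues contained in $\mathcal S$. Morphisms $(\mathcal V,\Omega)\to(\mathcal V',\Omega')$ are linear maps $f$ with $\Omega'f=f\Omega$, i.e. $S'f=fS$, $A_i'f=fA_i$ for all $i$. Choosing a basis, an object corresponds to the equation $du=\Omega u$. For $\mathcal V\ne\{0\}$: $(\mathcal V,\Omega)$ is irreducible if the only subspaces invariant under $S,A_1,\dots,A_q$ are $\{0\}$ and $\mathcal V$; it is exceptional if $\dim\mathcal V=1$ and all $A_i=0$, and non-exceptional otherwise (same terminology for the corresponding equation). Let $E_j$ be the projection onto $\mathrm{Ker}(S-\alpha_j)$ along the other eigenspaces of $S$ (zero if $\alpha_j$ is not an eigenvalue). On $\mathcal V^q$ let $T(v_1,\dots,v_q)=(a_1v_1,\dots,a_qv_q)$ and $B_j(v_1,\dots,v_q)=-(w_j,\dots,w_j)$ with $w_j=E_j\sum_kA_kv_k$. The subspace $\mathcal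 K_{\mathcal V}=\bigoplus_{i=1}^q\mathrm{Ker}A_i\subset\mathcal V^q$ is invariant under $T$ and all $B_j$; write $\bar T,\bar B_j$ for the induced operators on $\mathcal V^q/\mathcal K_{\mathcal V}$. The middle Laplace transform functor $\mathcal{ML}:\mathscr P(\mathcal T,\mathcal S)\to\mathscr P(\mathcal S,-\mathcal T)$ and the inverse middle Laplace transform functor $\mathcal{ML}^{-1}:\mathscr P(\mathcal T,\mathcal S)\to\mathscr P(-\mathcal S,\mathcal T)$ are given (for all $\mathcal T,\mathcal S$) by $$\mathcal{ML}(\mathcal V,\Omega)=\Big(\mathcal V^q/\mathcal K_{\mathcal V},\,-\bar T\,dx+\sum_{j}\bar B_j\,d\log(x-\alpha_j)\Big),\quad \mathcal{ML}^{-1}(\mathcal V,\Omega)=\Big(\mathcal V^q/\mathcal K_{\mathcal V},\,\bar T\,dx+\sum_{j}\bar B_j\,d\log(x+\alpha_j)\Big).$$ Addition: for $\lambda\in\mathbb C^q$, $add_\lambda(\mathcal V,\Omega)=(\mathcal V,\Omega+\sum_{i=1}^q\lambda_i\,\mathrm{id}_{\mathcal V}\,d\log(x-a_i))$, an endofunctor of $\mathscr P(\mathcal T,\mathcal S)$. On $\mathscr P(\mathcal S,-\mathcal T)$ the addition therefore has parameter in $\mathbb C^{\hat q}$, the $j$-th entry being added to the residue at $\alpha_j$. Middle convolution: for $\beta=(\beta_1,\dots,\beta_{\hat q})\in\mathbb C^{\hat q}$, $mc_\beta:=\mathcal{ML}^{-1}\circ add_{-\beta}\circ\mathcal{ML}:\mathscr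 P(\mathcal T,\mathcal S)\to\mathscr P(\mathcal S,-\mathcal T)\to\mathscr P(\mathcal S,-\mathcal T)\to\mathscr P(\mathcal T,\mathcal S)$; on equations it is defined by the same formulas after choosing bases, with $\mathcal T,\mathcal S$ fixed. *)

theory Defs
  imports "HOL-Algebra.AbelCoset" "Jordan_Normal_Form.VS_Connect" "Jordan_Normal_Form.Char_Poly"
begin

text \<open>
  The finite sets \<open>\<T>\<close> and \<open>\<S>\<close> are given by their enumerations, i.e. by distinct lists
  \<open>as = [a\<^sub>1, \<dots>, a\<^sub>q]\<close> and \<open>\<alpha>s = [\<alpha>\<^sub>1, \<dots>]\<close>; indices start at \<open>0\<close>, and \<open>- \<T>\<close> is
  \<open>map uminus as\<close>. Vector spaces are \<^locale>\<open>vectorspace\<close> records over \<open>\<complex>\<close> with an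
  explicit carrier.
\<close>

abbreviation CC :: "complex ring" where
  "CC \<equiv> class_ring"

abbreviation is_linear ::
    "(complex, 'v) module \<Rightarrow> (complex, 'w) module \<Rightarrow> ('v \<Rightarrow> 'w) \<Rightarrow> bool" where
  "is_linear V W f \<equiv> linear_map CC V W f"


section \<open>The category \<open>\<P>(\<T>, \<S>)\<close>\<close>

text \<open>
  A record \<open>X\<close> stands for the pair of \<open>sp X\<close> and
  \<open>\<Omega> = irr X dx + (\<Sum>i<q. res X i dlog (x - a\<^sub>i))\<close>. Only the values of the operators on the
  carrier of \<open>sp X\<close>, and of \<open>res X i\<close> for \<open>i < q\<close>, are relevant.
\<close>

record 'v system =
  sp  :: "(complex, 'v) module"
  irr :: "'v \<Rightarrow> 'v"
  res :: "nat \<Rightarrow> 'v \<Rightarrow> 'v"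

definition diagonalizable_op :: "(complex, 'v) module \<Rightarrow> ('v \<Rightarrow> 'v) \<Rightarrow> bool" where
  "diagonalizable_op V f \<longleftrightarrow>
     (\<exists>B. vectorspace.basis CC V B \<and> (\<forall>b\<in>B. \<exists>\<mu>. f b = \<mu> \<odot>\<^bsub>V\<^esub> b))"

definition eigenvalue_op :: "(complex, 'v) module \<Rightarrow> ('v \<Rightarrow> 'v) \<Rightarrow> complex \<Rightarrow> bool" where
  "eigenvalue_op V f \<mu> \<longleftrightarrow> (\<exists>v\<in>carrier V. v \<noteq> \<zero>\<^bsub>V\<^esub> \<and> f v = \<mu> \<odot>\<^bsub>V\<^esub> v)"

definition in_P :: "complex list \<Rightarrow> complex list \<Rightarrow> 'v system \<Rightarrow> bool" where
  "in_P as \<alpha>s X \<longleftrightarrow>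
     vectorspace CC (sp X) \<and> vectorspace.fin_dim CC (sp X) \<and>
     is_linear (sp X) (sp X) (irr X) \<and>
     (\<forall>i<length as. is_linear (sp X) (sp X) (res X i)) \<and>
     diagonalizable_op (sp X) (irr X) \<and>
     (\<forall>\<mu>. eigenvalue_op (sp X) (irr X) \<mu> \<longrightarrow> \<mu> \<in> set \<alpha>s)"

definition morphism :: "nat \<Rightarrow> 'v system \<Rightarrow> 'w system \<Rightarrow> ('v \<Rightarrow> 'w) \<Rightarrow> bool" where
  "morphism q X Y f \<longleftrightarrow>
     is_linear (sp X) (sp Y) f \<and>
     (\<forall>v\<in>carrier (sp X). irr Y (f v) = f (irr X v)) \<and>
     (\<forall>i<q. \<forall>v\<in>carrier (sp X). res Y i (f v) = f (res X i v))"

definition isomorphic_P ::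
    "complex list \<Rightarrow> complex list \<Rightarrow> 'v system \<Rightarrow> 'w system \<Rightarrow> bool" where
  "isomorphic_P as \<alpha>s X Y \<longleftrightarrow>
     in_P as \<alpha>s X \<and> in_P as \<alpha>s Y \<and>
     (\<exists>f g. morphism (length as) X Y f \<and> morphism (length as) Y X g \<and>
        (\<forall>v\<in>carrier (sp X). g (f v) = v) \<and> (\<forall>w\<in>carrier (sp Y). f (g w) = w))"

definition irreducible_sys :: "nat \<Rightarrow> 'v system \<Rightarrow> bool" where
  "irreducible_sys q X \<longleftrightarrow>
     carrier (sp X) \<noteq> {\<zero>\<^bsub>sp X\<^esub>} \<and>
     (\<forall>W. VectorSpace.subspace CC W (sp X) \<longrightarrow>
        irr X ` W \<subseteq> W \<longrightarrow> (\<forall>i<q. res X i ` W \<subseteq> W) \<longrightarrow>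
        W = {\<zero>\<^bsub>sp X\<^esub>} \<or> W = carrier (sp X))"

definition exceptional :: "nat \<Rightarrow> 'v system \<Rightarrow> bool" where
  "exceptional q X \<longleftrightarrow>
     vectorspace.dim CC (sp X) = 1 \<and>
     (\<forall>i<q. \<forall>v\<in>carrier (sp X). res X i v = \<zero>\<^bsub>sp X\<^esub>)"

definition non_exceptional :: "nat \<Rightarrow> 'v system \<Rightarrow> bool" where
  "non_exceptional q X \<longleftrightarrow> carrier (sp X) \<noteq> {\<zero>\<^bsub>sp X\<^esub>} \<and> \<not> exceptional q X"


section \<open>Powers and quotients of vector spaces\<close>

definition pow_space :: "nat \<Rightarrow> (complex, 'v) module \<Rightarrow> (complex, nat \<Rightarrow> 'v) module" where
  "pow_space q V =
     \<lparr>carrier = {..<q} \<rightarrow>\<^sub>E carrier V,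
      monoid.mult = undefined,
      one = undefined,
      zero = (\<lambda>i\<in>{..<q}. \<zero>\<^bsub>V\<^esub>),
      add = (\<lambda>v w. \<lambda>i\<in>{..<q}. v i \<oplus>\<^bsub>V\<^esub> w i),
      module.smult = (\<lambda>c v. \<lambda>i\<in>{..<q}. c \<odot>\<^bsub>V\<^esub> v i)\<rparr>"

text \<open>
  Elements of the quotient are cosets. If \<open>f\<close> is linear and maps \<open>K\<close> into \<open>K\<close>, then
  \<open>induced V K f\<close> sends the coset of \<open>v\<close> to the coset of \<open>f v\<close>. Adding \<open>K\<close> back is needed because
  the image of a coset under \<open>f\<close> (or under multiplication by the scalar \<open>0\<close>) may be smaller than
  a coset.
\<close>

definition induced :: "(complex, 'v) module \<Rightarrow> 'v set \<Rightarrow> ('v \<Rightarrow> 'v) \<Rightarrow> 'v set \<Rightarrow> 'v set" where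
  "induced V K f C = K <+>\<^bsub>V\<^esub> (f ` C)"

definition quot_space :: "(complex, 'v) module \<Rightarrow> 'v set \<Rightarrow> (complex, 'v set) module" where
  "quot_space V K =
     \<lparr>carrier = a_rcosets\<^bsub>V\<^esub> K,
      monoid.mult = undefined,
      one = undefined,
      zero = K,
      add = (<+>\<^bsub>V\<^esub>),
      module.smult = (\<lambda>c. induced V K (\<lambda>v. c \<odot>\<^bsub>V\<^esub> v))\<rparr>"


section \<open>Middle Laplace transform, addition, middle convolution\<close>

text \<open>
  For an object of \<open>\<P>(\<T>, \<S>)\<close> every vector \<open>v\<close> is uniquely a sum of vectors
  \<open>u k \<in> Ker (S - \<alpha>\<^sub>k)\<close>; the projection \<open>E\<^sub>j\<close> maps \<open>v\<close> to \<open>u j\<close>.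
\<close>

definition eigenproj :: "complex list \<Rightarrow> 'v system \<Rightarrow> nat \<Rightarrow> 'v \<Rightarrow> 'v" where
  "eigenproj \<alpha>s X j v =
     (THE w. \<exists>u. (\<forall>k<length \<alpha>s. u k \<in> carrier (sp X) \<and>
                     irr X (u k) = (\<alpha>s ! k) \<odot>\<^bsub>sp X\<^esub> u k) \<and>
                 v = (\<Oplus>\<^bsub>sp X\<^esub>k\<in>{..<length \<alpha>s}. u k) \<and> w = u j)"

definition T_op :: "complex list \<Rightarrow> 'v system \<Rightarrow> (nat \<Rightarrow> 'v) \<Rightarrow> (nat \<Rightarrow> 'v)" where
  "T_op as X v = (\<lambda>i\<in>{..<length as}. (as ! i) \<odot>\<^bsub>sp X\<^esub> v i)"

definition B_op ::
    "complex list \<Rightarrow> complex list \<Rightarrow> 'v system \<Rightarrow> nat \<Rightarrow> (nat \<Rightarrow> 'v) \<Rightarrow> (nat \<Rightarrow> 'v)" where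
  "B_op as \<alpha>s X j v =
     (\<lambda>i\<in>{..<length as}.
        \<ominus>\<^bsub>sp X\<^esub> eigenproj \<alpha>s X j (\<Oplus>\<^bsub>sp X\<^esub>k\<in>{..<length as}. res X k (v k)))"

definition K_sub :: "complex list \<Rightarrow> 'v system \<Rightarrow> (nat \<Rightarrow> 'v) set" where
  "K_sub as X =
     {v \<in> {..<length as} \<rightarrow>\<^sub>E carrier (sp X). \<forall>i<length as. res X i (v i) = \<zero>\<^bsub>sp X\<^esub>}"

definition laplace_space :: "complex list \<Rightarrow> 'v system \<Rightarrow> (complex, (nat \<Rightarrow> 'v) set) module" where
  "laplace_space as X = quot_space (pow_space (length as) (sp X)) (K_sub as X)"

definition laplace_induced ::
    "complex list \<Rightarrow> 'v system \<Rightarrow> ((nat \<Rightarrow> 'v) \<Rightarrow> (nat \<Rightarrow> 'v)) \<Rightarrow>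
     (nat \<Rightarrow> 'v) set \<Rightarrow> (nat \<Rightarrow> 'v) set" where
  "laplace_induced as X = induced (pow_space (length as) (sp X)) (K_sub as X)"

definition mid_laplace ::
    "complex list \<Rightarrow> complex list \<Rightarrow> 'v system \<Rightarrow> (nat \<Rightarrow> 'v) set system" where
  "mid_laplace as \<alpha>s X =
     \<lparr>sp = laplace_space as X,
      irr = (\<lambda>C. \<ominus>\<^bsub>laplace_space as X\<^esub> laplace_induced as X (T_op as X) C),
      res = (\<lambda>j. laplace_induced as X (B_op as \<alpha>s X j))\<rparr>"

text \<open>
  The poles of the result, \<open>\<alpha>\<^sub>j\<close> for \<open>mid_laplace\<close> and \<open>- \<alpha>\<^sub>j\<close> for \<open>inv_mid_laplace\<close>, are not part of the
  record, so the two functors differ only in the sign of the \<open>dx\<close>-term.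
\<close>

definition inv_mid_laplace ::
    "complex list \<Rightarrow> complex list \<Rightarrow> 'v system \<Rightarrow> (nat \<Rightarrow> 'v) set system" where
  "inv_mid_laplace as \<alpha>s X =
     \<lparr>sp = laplace_space as X,
      irr = laplace_induced as X (T_op as X),
      res = (\<lambda>j. laplace_induced as X (B_op as \<alpha>s X j))\<rparr>"

definition addition :: "complex vec \<Rightarrow> 'v system \<Rightarrow> 'v system" where
  "addition c X =
     X\<lparr>res := (\<lambda>i v. res X i v \<oplus>\<^bsub>sp X\<^esub> (c $ i) \<odot>\<^bsub>sp X\<^esub> v)\<rparr>"

text \<open>\<open>inv_mid_laplace\<close> is applied here to an object of \<open>\<P>(\<S>, - \<T>)\<close>.\<close>

definition mc ::
    "complex list \<Rightarrow> complex list \<Rightarrow> complex vec \<Rightarrow> 'v system \<Rightarrow>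
     (nat \<Rightarrow> (nat \<Rightarrow> 'v) set) set system" where
  "mc as \<alpha>s \<beta> X = inv_mid_laplace \<alpha>s (map uminus as) (addition (- \<beta>) (mid_laplace as \<alpha>s X))"


section \<open>Differential equations\<close>

text \<open>The equation \<open>du/dx = (S + (\<Sum>i<q. A\<^sub>i / (x - a\<^sub>i))) u\<close> of rank \<open>dim_row S\<close>.\<close>

record equation =
  eq_S :: "complex mat"
  eq_A :: "nat \<Rightarrow> complex mat"

abbreviation eq_rank :: "equation \<Rightarrow> nat" where
  "eq_rank E \<equiv> dim_row (eq_S E)"

definition is_equation :: "complex list \<Rightarrow> complex list \<Rightarrow> equation \<Rightarrow> bool" where
  "is_equation as \<alpha>s E \<longleftrightarrow>
     eq_S E \<in> carrier_mat (eq_rank E) (eq_rank E) \<and>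
     (\<forall>i<length as. eq_A E i \<in> carrier_mat (eq_rank E) (eq_rank E)) \<and>
     (\<exists>D. diagonal_mat D \<and> similar_mat (eq_S E) D) \<and>
     (\<forall>\<mu>. eigenvalue (eq_S E) \<mu> \<longrightarrow> \<mu> \<in> set \<alpha>s)"

definition system_of :: "equation \<Rightarrow> complex vec system" where
  "system_of E =
     \<lparr>sp = module_vec TYPE(complex) (eq_rank E),
      irr = (\<lambda>v. eq_S E *\<^sub>v v),
      res = (\<lambda>i v. eq_A E i *\<^sub>v v)\<rparr>"

text \<open>\<open>E'\<close> is obtained from \<open>E\<close> by the constant gauge transformation \<open>u \<mapsto> P u\<close>.\<close>

definition gauge_equiv :: "nat \<Rightarrow> equation \<Rightarrow> equation \<Rightarrow> bool" where
  "gauge_equiv q E' E \<longleftrightarrow>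
     (\<exists>P Q. similar_mat_wit (eq_S E') (eq_S E) P Q \<and>
            (\<forall>i<q. similar_mat_wit (eq_A E' i) (eq_A E i) P Q))"

text \<open>
  \<open>f\<close> has matrix \<open>M\<close> with respect to the ordered basis \<open>b\<close>. Since a basis can be chosen in many
  ways, the transformations of equations below are relations between an equation and all the
  equations obtained from it by some choices of bases.
\<close>

definition has_matrix ::
    "(complex, 'v) module \<Rightarrow> 'v list \<Rightarrow> ('v \<Rightarrow> 'v) \<Rightarrow> complex mat \<Rightarrow> bool" where
  "has_matrix V b f M \<longleftrightarrow>
     M \<in> carrier_mat (length b) (length b) \<and>
     (\<forall>j<length b. f (b ! j) = (\<Oplus>\<^bsub>V\<^esub>i\<in>{..<length b}. M $$ (i, j) \<odot>\<^bsub>V\<^esub> (b ! i)))"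

definition equation_of :: "nat \<Rightarrow> 'v system \<Rightarrow> equation \<Rightarrow> bool" where
  "equation_of q X E \<longleftrightarrow>
     (\<exists>b. distinct b \<and> vectorspace.basis CC (sp X) (set b) \<and>
          has_matrix (sp X) b (irr X) (eq_S E) \<and>
          (\<forall>i<q. has_matrix (sp X) b (res X i) (eq_A E i)))"

abbreviation irreducible_eq :: "nat \<Rightarrow> equation \<Rightarrow> bool" where
  "irreducible_eq q E \<equiv> irreducible_sys q (system_of E)"

abbreviation non_exceptional_eq :: "nat \<Rightarrow> equation \<Rightarrow> bool" where
  "non_exceptional_eq q E \<equiv> non_exceptional q (system_of E)"

definition mid_laplace_eq :: "complex list \<Rightarrow> complex list \<Rightarrow> equation \<Rightarrow> equation \<Rightarrow> bool" where
  "mid_laplace_eq as \<alpha>s E F \<longleftrightarrow> equation_of (length \<alpha>s) (mid_laplace as \<alpha>s (system_of E)) F"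

definition inv_mid_laplace_eq :: "complex list \<Rightarrow> complex list \<Rightarrow> equation \<Rightarrow> equation \<Rightarrow> bool" where
  "inv_mid_laplace_eq as \<alpha>s E F \<longleftrightarrow> equation_of (length \<alpha>s) (inv_mid_laplace as \<alpha>s (system_of E)) F"

definition addition_eq :: "complex vec \<Rightarrow> equation \<Rightarrow> equation" where
  "addition_eq c E = E\<lparr>eq_A := (\<lambda>i. eq_A E i + (c $ i) \<cdot>\<^sub>m 1\<^sub>m (eq_rank E))\<rparr>"

definition mc_eq ::
    "complex list \<Rightarrow> complex list \<Rightarrow> complex vec \<Rightarrow> equation \<Rightarrow> equation \<Rightarrow> bool" where
  "mc_eq as \<alpha>s \<beta> E E' \<longleftrightarrow>
     (\<exists>F. mid_laplace_eq as \<alpha>s E F \<and> inv_mid_laplace_eq \<alpha>s (map uminus as) (addition_eq (- \<beta>) F) E')"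

end

theory Submission
  imports Defs
begin

text \<open>
  Write \<open>E\<^sub>j\<close> for the projections onto the eigenspaces of the \<open>dx\<close>-term and \<open>A\<^sub>i\<close> for the residues of a system
  on \<open>\<V>\<close>. The map \<open>(v\<^sub>i) \<mapsto> (A\<^sub>i v\<^sub>i)\<close> turns the middle Laplace transform into the space of tuples \<open>(w\<^sub>i)\<close>
  with \<open>w\<^sub>i \<in> Im A\<^sub>i\<close>, where the \<open>j\<close>-th residue is \<open>(w\<^sub>i) \<mapsto> (- A\<^sub>i E\<^sub>j (\<Sum>k. w\<^sub>k))\<close>. An irreducible
  non-exceptional system satisfies \<open>(\<Inter>i. Ker A\<^sub>i) \<inter> Im E\<^sub>j = 0\<close> and \<open>E\<^sub>j (\<Sum>i. Im A\<^sub>i) = Im E\<^sub>j\<close>. Hence its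
  transform is irreducible and non-exceptional, and \<open>v \<mapsto> (- A\<^sub>i E\<^sub>j v)\<close> is an isomorphism from \<open>\<V>\<close> onto
  the inverse transform of the transform. The composition law follows because the two transforms
  cancel between the two additions.
\<close>

section \<open>Complex vector spaces with explicit carriers\<close>

text \<open>Two things obstruct a direct computation. A double convolution lives on cosets of
  functions whose values are again cosets of functions, and the transforms of equations depend on
  choices of bases. For this reason a transform enters the main argument only through the
  characterisation \<open>realization\<close>, which determines it up to isomorphism and is stable
  under isomorphisms of its source and of its target. Cosets occur only where the transforms are
  shown to be realizations, and bases of transforms only where equations are compared with systems;
  objects and equations then share one proof of each claim. The two transforms differ only in the
  sign of the \<open>dx\<close>-term, so a realization tells them apart only by the list of
  eigenvalues of that term. Hence one inversion statement covers both orders of composition: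
  transform followed by inverse transform for \<open>mc\<close> with parameter zero, and the
  opposite order for the composition law. Non-exceptionality is used in the form that some residue
  is nonzero, which is equivalent for irreducible systems and needs no dimension. The addition is
  the one step that can destroy it.\<close>

locale cspace =
  fixes V :: "(complex, 'v) module" (structure)
  assumes vectorspace: "vectorspace CC V"

sublocale cspace \<subseteq> abelian_group V
  using vectorspace by (simp add: vectorspace_def Module.module_def)

context cspace
begin

lemma module: "Module.module CC V"
  using vectorspace by (simp add: vectorspace_def)

lemma smult_closed [simp, intro]: "v \<in> carrier V \<Longrightarrow> c \<odot> v \<in> carrier V"
  and smult_add_left: "v \<in> carrier V \<Longrightarrow> (c + d) \<odot> v = c \<odot> v \<oplus> d \<odot> v"
  and smult_add_right: "v \<in> carrier V \<Longrightarrow> w \<in> carrier V \<Longrightarrow> c \<odot> (v \<oplus> w) = c \<odot> v \<oplus> c \<odot> w"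
  and smult_smult [simp]: "v \<in> carrier V \<Longrightarrow> c \<odot> (d \<odot> v) = (c * d) \<odot> v"
  and smult_one [simp]: "v \<in> carrier V \<Longrightarrow> 1 \<odot> v = v"
  and smult_zero_left [simp]: "v \<in> carrier V \<Longrightarrow> 0 \<odot> v = \<zero>"
  and smult_zero_right [simp]: "c \<odot> \<zero> = \<zero>"
  using module.smult_closed[OF module] module.smult_l_distr[OF module]
    module.smult_r_distr[OF module] module.smult_assoc1[OF module] module.smult_one[OF module]
    module.smult_l_null[OF module] module.smult_r_null[OF module] by auto

lemma neg_eq: "v \<in> carrier V \<Longrightarrow> \<ominus> v = (- 1) \<odot> v"
  using module.smult_l_minus[OF module, of 1 v] by (simp add: class_ring_simps)

lemma neg_zero [simp]: "\<ominus> \<zero> = \<zero>"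
  by (simp add: neg_eq)

lemma neg_eq_zero: "v \<in> carrier V \<Longrightarrow> \<ominus> v = \<zero> \<longleftrightarrow> v = \<zero>"
  using minus_minus[of v] by auto

lemma smult_neg: "v \<in> carrier V \<Longrightarrow> c \<odot> (\<ominus> v) = \<ominus> (c \<odot> v)"
  by (simp add: neg_eq)

lemma smult_finsum:
  assumes "finite A" "\<And>i. i \<in> A \<Longrightarrow> f i \<in> carrier V"
  shows "c \<odot> (\<Oplus>i\<in>A. f i) = (\<Oplus>i\<in>A. c \<odot> f i)"
  using module.finsum_smult_ldistr[OF module assms(1), of c f] assms(2) by auto

lemma smult_eq_zero: "v \<in> carrier V \<Longrightarrow> c \<odot> v = \<zero> \<Longrightarrow> c = 0 \<or> v = \<zero>"
  by (metis left_inverse smult_one smult_smult smult_zero_right)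

text \<open>Differences are written with the scalar \<open>- 1\<close>, so that additivity and
  homogeneity suffice to push a linear map through them.\<close>

lemma eq_if_diff_zero: "v \<in> carrier V \<Longrightarrow> w \<in> carrier V \<Longrightarrow> v \<oplus> (- 1) \<odot> w = \<zero> \<Longrightarrow> v = w"
  using minus_equality[of v "(- 1) \<odot> w"] by (simp add: neg_eq)

lemma diff_self [simp]: "v \<in> carrier V \<Longrightarrow> v \<oplus> (- 1) \<odot> v = \<zero>"
  using r_neg by (simp add: neg_eq)

lemma finsum_all_zero: "(\<And>i. i \<in> A \<Longrightarrow> f i = \<zero>) \<Longrightarrow> (\<Oplus>i\<in>A. f i) = \<zero>"
  by (rule add.finprod_one_eqI) auto

lemma finsum_delta:
  assumes "j \<in> A" "finite A" "v \<in> carrier V" "\<And>i. i \<in> A \<Longrightarrow> f i = (if i = j then v else \<zero>)"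
  shows "(\<Oplus>i\<in>A. f i) = v"
proof -
  have "(\<Oplus>i\<in>A. f i) = (\<Oplus>i\<in>A. if j = i then v else \<zero>)"
    using assms by (intro finsum_cong') auto
  also have "\<dots> = v" using finsum_singleton[of j A "\<lambda>_. v"] assms by auto
  finally show ?thesis .
qed

lemma finsum_add:
  assumes "\<And>i. i \<in> A \<Longrightarrow> f i \<in> carrier V" "\<And>i. i \<in> A \<Longrightarrow> g i \<in> carrier V"
  shows "(\<Oplus>i\<in>A. f i \<oplus> g i) = (\<Oplus>i\<in>A. f i) \<oplus> (\<Oplus>i\<in>A. g i)"
  using assms by (intro finsum_addf) auto

lemma finsum_eqI:
  assumes "\<And>i. i \<in> A \<Longrightarrow> f i = g i" "\<And>i. i \<in> A \<Longrightarrow> g i \<in> carrier V"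
  shows "(\<Oplus>i\<in>A. f i) = (\<Oplus>i\<in>A. g i)"
  using assms by (intro finsum_cong') auto

lemma finsum_in [simp, intro]: "(\<And>i. i \<in> A \<Longrightarrow> f i \<in> carrier V) \<Longrightarrow> (\<Oplus>i\<in>A. f i) \<in> carrier V"
  by (intro finsum_closed) auto

lemma subspaceI:
  assumes "W \<subseteq> carrier V" "\<zero> \<in> W" "\<And>v w. v \<in> W \<Longrightarrow> w \<in> W \<Longrightarrow> v \<oplus> w \<in> W"
    "\<And>c v. v \<in> W \<Longrightarrow> c \<odot> v \<in> W"
  shows "VectorSpace.subspace CC W V"
  using assms module vectorspace
  by (auto simp: VectorSpace.subspace_def submodule_def)

lemma subspaceD:
  assumes "VectorSpace.subspace CC W V"
  shows "W \<subseteq> carrier V" "\<zero> \<in> W" "\<And>v w. v \<in> W \<Longrightarrow> w \<in> W \<Longrightarrow> v \<oplus> w \<in> W"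
    "\<And>c v. v \<in> W \<Longrightarrow> c \<odot> v \<in> W"
  using assms by (auto simp: VectorSpace.subspace_def submodule_def)

lemma subspace_finsum:
  assumes W: "VectorSpace.subspace CC W V" and "finite A" "\<And>i. i \<in> A \<Longrightarrow> f i \<in> W"
  shows "(\<Oplus>i\<in>A. f i) \<in> W"
  using assms(2,3)
proof (induction A rule: finite_induct)
  case empty
  show ?case using subspaceD(2)[OF W] by simp
next
  case (insert x F)
  then have "f \<in> F \<rightarrow> carrier V" "f x \<in> carrier V" using subspaceD(1)[OF W] by auto
  with insert show ?case using subspaceD(3)[OF W] by simp
qed

lemma span_subset_subspace:
  assumes "VectorSpace.subspace CC W V" "G \<subseteq> W"
  shows "LinearCombinations.module.span CC V G \<subseteq> W"
  using module.span_is_subset[OF module, of G W] assms by (auto simp: VectorSpace.subspace_def)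

lemma span_subspace:
  assumes "G \<subseteq> carrier V"
  shows "VectorSpace.subspace CC (LinearCombinations.module.span CC V G) V"
  using vectorspace.span_is_subspace[OF vectorspace assms] .

lemma subset_span: "G \<subseteq> carrier V \<Longrightarrow> G \<subseteq> LinearCombinations.module.span CC V G"
  using module.in_own_span[OF module] .

text \<open>Picking the basis among the given generators keeps their properties; in
  \<open>diagonalizable_irr\<close> the generators are eigenvectors.\<close>

lemma finite_basis_of_generators:
  assumes "finite G" "G \<subseteq> carrier V" "LinearCombinations.module.span CC V G = carrier V"
  shows "\<exists>B\<subseteq>G. vectorspace.basis CC V B"
proof -
  from minimal_exists[of G "\<lambda>S. S \<subseteq> carrier V \<and> LinearCombinations.module.span CC V S = carrier V"] assms
  obtain B where "B \<subseteq> G"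
    and "minimal B (\<lambda>S. S \<subseteq> carrier V \<and> LinearCombinations.module.span CC V S = carrier V)"
    by auto
  then show ?thesis using vectorspace.min_gen_is_basis[OF vectorspace] by auto
qed

lemma fin_dim_iff:
  "vectorspace.fin_dim CC V \<longleftrightarrow>
     (\<exists>G. finite G \<and> G \<subseteq> carrier V \<and> LinearCombinations.module.span CC V G = carrier V)"
  using vectorspace.fin_dim_def[OF vectorspace] by auto

lemma dim_one_if_line:
  assumes v: "v \<in> carrier V" "v \<noteq> \<zero>" and line: "\<And>w. w \<in> carrier V \<Longrightarrow> \<exists>c. w = c \<odot> v"
  shows "vectorspace.dim CC V = 1"
proof -
  have "carrier V \<subseteq> LinearCombinations.module.span CC V {v}"
  proof
    fix w assume "w \<in> carrier V"
    then obtain c where "w = c \<odot> v" using line by blast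
    then show "w \<in> LinearCombinations.module.span CC V {v}"
      using subspaceD(4)[OF span_subspace] subset_span[of "{v}"] v by auto
  qed
  then have "LinearCombinations.module.span CC V {v} = carrier V"
    using module.span_is_subset2[OF module, of "{v}"] v by auto
  then show ?thesis using vectorspace.dim1I[OF vectorspace] v by auto
qed

lemma line_subspace:
  assumes "v \<in> carrier V"
  shows "VectorSpace.subspace CC (range (\<lambda>c. c \<odot> v)) V"
proof (rule subspaceI)
  show "range (\<lambda>c. c \<odot> v) \<subseteq> carrier V" using assms by auto
  show "\<zero> \<in> range (\<lambda>c. c \<odot> v)" using assms by (metis rangeI smult_zero_left)
  show "u \<oplus> w \<in> range (\<lambda>c. c \<odot> v)" if "u \<in> range (\<lambda>c. c \<odot> v)" "w \<in> range (\<lambda>c. c \<odot> v)" for u w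
    using that assms by (auto simp: smult_add_left[symmetric])
  show "c \<odot> w \<in> range (\<lambda>c. c \<odot> v)" if "w \<in> range (\<lambda>c. c \<odot> v)" for c w
    using that assms by auto
qed

end

section \<open>Linear maps\<close>

lemma cspace_if_linear:
  assumes "is_linear V W f"
  shows "cspace V" "cspace W"
  using assms by (auto simp: linear_map_def cspace_def)

lemma is_linearI:
  assumes "cspace V" "cspace W" "\<And>v. v \<in> carrier V \<Longrightarrow> f v \<in> carrier W"
    "\<And>v w. v \<in> carrier V \<Longrightarrow> w \<in> carrier V \<Longrightarrow> f (v \<oplus>\<^bsub>V\<^esub> w) = f v \<oplus>\<^bsub>W\<^esub> f w"
    "\<And>c v. v \<in> carrier V \<Longrightarrow> f (c \<odot>\<^bsub>V\<^esub> v) = c \<odot>\<^bsub>W\<^esub> f v"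
  shows "is_linear V W f"
  using assms(3-5) assms(1,2)[THEN cspace.module] assms(1,2)[THEN cspace.vectorspace]
  by (auto simp: linear_map_def mod_hom_def mod_hom_axioms_def LinearCombinations.module_hom_def)

lemma is_linearD:
  assumes "is_linear V W f"
  shows linear_closed: "\<And>v. v \<in> carrier V \<Longrightarrow> f v \<in> carrier W"
    and linear_add: "\<And>v w. v \<in> carrier V \<Longrightarrow> w \<in> carrier V \<Longrightarrow> f (v \<oplus>\<^bsub>V\<^esub> w) = f v \<oplus>\<^bsub>W\<^esub> f w"
    and linear_smult: "\<And>c v. v \<in> carrier V \<Longrightarrow> f (c \<odot>\<^bsub>V\<^esub> v) = c \<odot>\<^bsub>W\<^esub> f v"
    and linear_zero: "f \<zero>\<^bsub>V\<^esub> = \<zero>\<^bsub>W\<^esub>"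
    and linear_neg: "\<And>v. v \<in> carrier V \<Longrightarrow> f (\<ominus>\<^bsub>V\<^esub> v) = \<ominus>\<^bsub>W\<^esub> f v"
proof -
  interpret linear_map CC V W f by fact
  show "\<And>v. v \<in> carrier V \<Longrightarrow> f v \<in> carrier W"
    "\<And>v w. v \<in> carrier V \<Longrightarrow> w \<in> carrier V \<Longrightarrow> f (v \<oplus>\<^bsub>V\<^esub> w) = f v \<oplus>\<^bsub>W\<^esub> f w"
    "\<And>c v. v \<in> carrier V \<Longrightarrow> f (c \<odot>\<^bsub>V\<^esub> v) = c \<odot>\<^bsub>W\<^esub> f v"
    "f \<zero>\<^bsub>V\<^esub> = \<zero>\<^bsub>W\<^esub>"
    "\<And>v. v \<in> carrier V \<Longrightarrow> f (\<ominus>\<^bsub>V\<^esub> v) = \<ominus>\<^bsub>W\<^esub> f v"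
    by simp_all
qed

lemma linear_finsum:
  assumes f: "is_linear V W f" and g: "\<And>i. i \<in> A \<Longrightarrow> g i \<in> carrier V"
  shows "f (\<Oplus>\<^bsub>V\<^esub>i\<in>A. g i) = (\<Oplus>\<^bsub>W\<^esub>i\<in>A. f (g i))"
proof -
  interpret V: cspace V using cspace_if_linear[OF f] by blast
  interpret W: cspace W using cspace_if_linear[OF f] by blast
  show ?thesis
    using g
  proof (induction A rule: infinite_finite_induct)
    case (insert x F)
    then have "g \<in> F \<rightarrow> carrier V" "(\<lambda>i. f (g i)) \<in> F \<rightarrow> carrier W" "g x \<in> carrier V"
      using linear_closed[OF f] by auto
    with insert show ?case using linear_closed[OF f] by (simp add: linear_add[OF f])
  qed (simp_all add: linear_zero[OF f] V.finsum_infinite W.finsum_infinite)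
qed

lemma linear_compose:
  assumes f: "is_linear U V f" and g: "is_linear V W g"
  shows "is_linear U W (\<lambda>v. g (f v))"
  by (rule is_linearI)
    (simp_all add: is_linearD[OF f] is_linearD[OF g] cspace_if_linear[OF f] cspace_if_linear[OF g])

lemma linear_cong:
  assumes f: "is_linear V W f" and "\<And>v. v \<in> carrier V \<Longrightarrow> g v = f v"
  shows "is_linear V W g"
proof -
  interpret V: cspace V using cspace_if_linear[OF f] by blast
  show ?thesis
    by (rule is_linearI) (simp_all add: is_linearD[OF f] cspace_if_linear[OF f] assms(2))
qed

text \<open>The vector space axioms pass to a surjective image. With \<open>p\<close> the coset map
  this yields the quotient space without any argument about sums of sets.\<close>

lemma cspace_image:
  assumes V: "cspace V" and carr: "carrier Q = p ` carrier V"
    and zero: "\<zero>\<^bsub>Q\<^esub> = p \<zero>\<^bsub>V\<^esub>"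
    and add: "\<And>v w. v \<in> carrier V \<Longrightarrow> w \<in> carrier V \<Longrightarrow> p v \<oplus>\<^bsub>Q\<^esub> p w = p (v \<oplus>\<^bsub>V\<^esub> w)"
    and smult: "\<And>c v. v \<in> carrier V \<Longrightarrow> c \<odot>\<^bsub>Q\<^esub> p v = p (c \<odot>\<^bsub>V\<^esub> v)"
  shows "cspace Q"
proof -
  interpret V: cspace V by fact
  have neg: "\<exists>w\<in>carrier V. v \<oplus>\<^bsub>V\<^esub> w = \<zero>\<^bsub>V\<^esub>" if "v \<in> carrier V" for v
    using that V.r_neg by (intro bexI[of _ "\<ominus>\<^bsub>V\<^esub> v"]) auto
  have "vectorspace CC Q"
  proof (rule vs_criteria)
    show "field CC" by (rule class_field)
    show "\<forall>v\<in>carrier Q. \<exists>neg_v\<in>carrier Q. v \<oplus>\<^bsub>Q\<^esub> neg_v = \<zero>\<^bsub>Q\<^esub>"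
    proof
      fix y assume "y \<in> carrier Q"
      then obtain v where v: "v \<in> carrier V" "y = p v" unfolding carr by blast
      then obtain w where "w \<in> carrier V" "v \<oplus>\<^bsub>V\<^esub> w = \<zero>\<^bsub>V\<^esub>" using neg by blast
      with v show "\<exists>neg_v\<in>carrier Q. y \<oplus>\<^bsub>Q\<^esub> neg_v = \<zero>\<^bsub>Q\<^esub>"
        unfolding carr zero by (intro bexI[of _ "p w"]) (simp_all add: add)
    qed
    show "\<forall>v w. v \<in> carrier Q \<and> w \<in> carrier Q \<longrightarrow> v \<oplus>\<^bsub>Q\<^esub> w = w \<oplus>\<^bsub>Q\<^esub> v"
      unfolding carr using V.a_comm by (auto simp: add)
  qed (auto simp: carr zero add smult V.a_assoc V.smult_add_left V.smult_add_right)
  then show ?thesis by (simp add: cspace_def)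
qed

section \<open>Eigenspace decompositions\<close>

text \<open>The condition under the description operator in \<open>eigenproj\<close>. Existence of
  \<open>u\<close> expresses diagonalizability; uniqueness will come from the distinctness of
  \<open>es\<close>.\<close>

definition eigen_family ::
    "complex list \<Rightarrow> 'v system \<Rightarrow> (nat \<Rightarrow> 'v) \<Rightarrow> 'v \<Rightarrow> bool" where
  "eigen_family es X u v \<longleftrightarrow>
     (\<forall>k<length es. u k \<in> carrier (sp X) \<and> irr X (u k) = (es ! k) \<odot>\<^bsub>sp X\<^esub> u k) \<and>
     v = (\<Oplus>\<^bsub>sp X\<^esub>k\<in>{..<length es}. u k)"

text \<open>Diagonalizability with eigenvalues from \<open>es\<close>, stated without bases or
  dimension. In this form it passes through isomorphisms and is visible on a transform, where the
  components of a tuple are its eigenvectors; finite dimension enters only when an eigenbasis has to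
  be recovered.\<close>

locale eigen_system =
  fixes es :: "complex list" and X :: "'v system"
  assumes distinct_es: "distinct es"
    and linear_irr: "is_linear (sp X) (sp X) (irr X)"
    and decompose: "\<And>v. v \<in> carrier (sp X) \<Longrightarrow> \<exists>u. eigen_family es X u v"

sublocale eigen_system \<subseteq> cspace "sp X"
  using cspace_if_linear[OF linear_irr] by blast

lemma eigen_vectors_independent:
  assumes lin: "is_linear (sp X) (sp X) (irr X)" and "distinct es"
    and "n \<le> length es"
    and "\<And>k. k < n \<Longrightarrow> u k \<in> carrier (sp X)"
    and "\<And>k. k < n \<Longrightarrow> irr X (u k) = (es ! k) \<odot>\<^bsub>sp X\<^esub> u k"
    and "(\<Oplus>\<^bsub>sp X\<^esub>k\<in>{..<n}. u k) = \<zero>\<^bsub>sp X\<^esub>" and "k < n"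
  shows "u k = \<zero>\<^bsub>sp X\<^esub>"
  using assms(3-)
proof (induction n arbitrary: u k)
  case (Suc n)
  interpret cspace "sp X" using cspace_if_linear[OF lin] by blast
  \<comment> \<open>Subtracting the last eigenvalue kills the last summand and multiplies the
    \<open>k\<close>-th one by \<open>es ! k - es ! n\<close>, which is nonzero for
    \<open>k < n\<close>. The remaining shorter relation falls to the induction hypothesis.\<close>
  define f where "f = (\<lambda>v. irr X v \<oplus>\<^bsub>sp X\<^esub> (- (es ! n)) \<odot>\<^bsub>sp X\<^esub> v)"
  have f: "is_linear (sp X) (sp X) f"
    by (rule is_linearI)
      (auto simp: f_def is_linearD[OF lin] cspace_axioms smult_add_right a_ac mult.commute)
  have fu: "f (u k) = (es ! k - es ! n) \<odot>\<^bsub>sp X\<^esub> u k" if "k < Suc n" for k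
    using Suc.prems(2,3)[OF that] by (simp add: f_def smult_add_left[symmetric])
  have "\<zero>\<^bsub>sp X\<^esub> = (\<Oplus>\<^bsub>sp X\<^esub>k\<in>{..<Suc n}. f (u k))"
    using linear_finsum[OF f, of "{..<Suc n}" u] Suc.prems(2,4) linear_zero[OF f] by simp
  also have "\<dots> = (\<Oplus>\<^bsub>sp X\<^esub>k\<in>{..<Suc n}. (es ! k - es ! n) \<odot>\<^bsub>sp X\<^esub> u k)"
    using fu Suc.prems(2) by (intro finsum_eqI) auto
  also have "\<dots> = (\<Oplus>\<^bsub>sp X\<^esub>k\<in>{..<n}. (es ! k - es ! n) \<odot>\<^bsub>sp X\<^esub> u k)"
    using Suc.prems(2) by (simp add: lessThan_Suc Pi_def)
  finally have sum: "(\<Oplus>\<^bsub>sp X\<^esub>k\<in>{..<n}. (es ! k - es ! n) \<odot>\<^bsub>sp X\<^esub> u k) = \<zero>\<^bsub>sp X\<^esub>" by simp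
  have zero: "u k = \<zero>\<^bsub>sp X\<^esub>" if k: "k < n" for k
  proof -
    have "(es ! k - es ! n) \<odot>\<^bsub>sp X\<^esub> u k = \<zero>\<^bsub>sp X\<^esub>"
      using k Suc.prems(1-3) sum
      by (intro Suc.IH[of "\<lambda>k. (es ! k - es ! n) \<odot>\<^bsub>sp X\<^esub> u k"])
        (auto simp: linear_smult[OF lin] mult.commute)
    moreover have "es ! k \<noteq> es ! n"
      using k Suc.prems(1) \<open>distinct es\<close> by (simp add: nth_eq_iff_index_eq)
    ultimately show ?thesis using smult_eq_zero[of "u k" "es ! k - es ! n"] Suc.prems(2) k by auto
  qed
  then have "(\<Oplus>\<^bsub>sp X\<^esub>k\<in>{..<n}. u k) = \<zero>\<^bsub>sp X\<^esub>" by (intro finsum_all_zero) simp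
  then have "u n = \<zero>\<^bsub>sp X\<^esub>" using Suc.prems(2,4) by (simp add: lessThan_Suc Pi_def)
  then show ?case using zero Suc.prems(5) by (cases "k = n") auto
qed simp

context eigen_system
begin

lemma eigen_family_unique:
  assumes "eigen_family es X u v" "eigen_family es X u' v" "k < length es"
  shows "u k = u' k"
proof -
  let ?d = "\<lambda>k. u k \<oplus>\<^bsub>sp X\<^esub> (- 1) \<odot>\<^bsub>sp X\<^esub> u' k"
  note u = assms(1,2)[unfolded eigen_family_def]
  have "(\<Oplus>\<^bsub>sp X\<^esub>k\<in>{..<length es}. ?d k) =
      (\<Oplus>\<^bsub>sp X\<^esub>k\<in>{..<length es}. u k) \<oplus>\<^bsub>sp X\<^esub> (- 1) \<odot>\<^bsub>sp X\<^esub> (\<Oplus>\<^bsub>sp X\<^esub>k\<in>{..<length es}. u' k)"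
    using u by (subst smult_finsum) (auto intro!: finsum_add)
  also have "\<dots> = v \<oplus>\<^bsub>sp X\<^esub> (- 1) \<odot>\<^bsub>sp X\<^esub> v" using u by metis
  also have "\<dots> = \<zero>\<^bsub>sp X\<^esub>" using u by (intro diff_self) auto
  finally have "?d k = \<zero>\<^bsub>sp X\<^esub>"
    using u assms(3)
    by (intro eigen_vectors_independent[OF linear_irr distinct_es order.refl, of ?d])
      (auto simp: is_linearD[OF linear_irr] smult_add_right mult.commute)
  then show ?thesis using eq_if_diff_zero u assms(3) by auto
qed

lemma eigenproj_eq:
  assumes "eigen_family es X u v" "k < length es"
  shows "eigenproj es X k v = u k"
  unfolding eigenproj_def
proof (rule the_equality)
  show "\<exists>u'. (\<forall>k<length es. u' k \<in> carrier (sp X) \<and> irr X (u' k) = (es ! k) \<odot>\<^bsub>sp X\<^esub> u' k) \<and>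
      v = (\<Oplus>\<^bsub>sp X\<^esub>k\<in>{..<length es}. u' k) \<and> u k = u' k"
    using assms by (auto simp: eigen_family_def)
next
  fix w
  assume "\<exists>u'. (\<forall>k<length es. u' k \<in> carrier (sp X) \<and> irr X (u' k) = (es ! k) \<odot>\<^bsub>sp X\<^esub> u' k) \<and>
      v = (\<Oplus>\<^bsub>sp X\<^esub>k\<in>{..<length es}. u' k) \<and> w = u' k"
  then obtain u' where "eigen_family es X u' v" "w = u' k" by (auto simp: eigen_family_def)
  then show "w = u k" using eigen_family_unique assms by blast
qed

lemma eigen_family_eigenproj:
  assumes "v \<in> carrier (sp X)"
  shows "eigen_family es X (\<lambda>k. eigenproj es X k v) v"
proof -
  obtain u where u: "eigen_family es X u v" using decompose assms by blast
  have "(\<Oplus>\<^bsub>sp X\<^esub>k\<in>{..<length es}. u k) = (\<Oplus>\<^bsub>sp X\<^esub>k\<in>{..<length es}. eigenproj es X k v)"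
    using u eigenproj_eq[OF u] by (intro finsum_eqI) (auto simp: eigen_family_def)
  then show ?thesis using u eigenproj_eq[OF u] by (simp add: eigen_family_def)
qed

lemma eigenproj_closed [simp, intro]:
  "v \<in> carrier (sp X) \<Longrightarrow> k < length es \<Longrightarrow> eigenproj es X k v \<in> carrier (sp X)"
  and irr_eigenproj:
  "v \<in> carrier (sp X) \<Longrightarrow> k < length es \<Longrightarrow>
     irr X (eigenproj es X k v) = (es ! k) \<odot>\<^bsub>sp X\<^esub> eigenproj es X k v"
  and sum_eigenproj:
  "v \<in> carrier (sp X) \<Longrightarrow> (\<Oplus>\<^bsub>sp X\<^esub>k\<in>{..<length es}. eigenproj es X k v) = v"
  using eigen_family_eigenproj[of v] by (auto simp: eigen_family_def)

text \<open>Sums and multiples of eigenvector decompositions are again such decompositions, so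
  uniqueness gives linearity.\<close>

lemma linear_eigenproj:
  assumes "k < length es"
  shows "is_linear (sp X) (sp X) (eigenproj es X k)"
proof (rule is_linearI)
  fix v w assume vw: "v \<in> carrier (sp X)" "w \<in> carrier (sp X)"
  have "eigen_family es X (\<lambda>k. eigenproj es X k v \<oplus>\<^bsub>sp X\<^esub> eigenproj es X k w) (v \<oplus>\<^bsub>sp X\<^esub> w)"
    using vw by (auto simp: eigen_family_def is_linearD[OF linear_irr] irr_eigenproj smult_add_right
        finsum_add sum_eigenproj)
  then show "eigenproj es X k (v \<oplus>\<^bsub>sp X\<^esub> w) = eigenproj es X k v \<oplus>\<^bsub>sp X\<^esub> eigenproj es X k w"
    using eigenproj_eq assms by blast
next
  fix c v assume v: "v \<in> carrier (sp X)"
  have "eigen_family es X (\<lambda>k. c \<odot>\<^bsub>sp X\<^esub> eigenproj es X k v) (c \<odot>\<^bsub>sp X\<^esub> v)"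
    using v smult_finsum[of "{..<length es}" "\<lambda>k. eigenproj es X k v" c]
    by (auto simp: eigen_family_def is_linearD[OF linear_irr] irr_eigenproj mult.commute sum_eigenproj)
  then show "eigenproj es X k (c \<odot>\<^bsub>sp X\<^esub> v) = c \<odot>\<^bsub>sp X\<^esub> eigenproj es X k v"
    using eigenproj_eq assms by blast
qed (use assms cspace_axioms in auto)

lemma eigenproj_irr:
  assumes "v \<in> carrier (sp X)" "k < length es"
  shows "eigenproj es X k (irr X v) = (es ! k) \<odot>\<^bsub>sp X\<^esub> eigenproj es X k v"
proof -
  have "irr X v = irr X (\<Oplus>\<^bsub>sp X\<^esub>k\<in>{..<length es}. eigenproj es X k v)"
    using sum_eigenproj[OF assms(1)] by simp
  also have "\<dots> = (\<Oplus>\<^bsub>sp X\<^esub>k\<in>{..<length es}. irr X (eigenproj es X k v))"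
    using assms by (intro linear_finsum[OF linear_irr]) auto
  also have "\<dots> = (\<Oplus>\<^bsub>sp X\<^esub>k\<in>{..<length es}. (es ! k) \<odot>\<^bsub>sp X\<^esub> eigenproj es X k v)"
    using assms by (intro finsum_eqI) (auto simp: irr_eigenproj)
  finally have "eigen_family es X (\<lambda>k. (es ! k) \<odot>\<^bsub>sp X\<^esub> eigenproj es X k v) (irr X v)"
    using assms by (simp add: eigen_family_def is_linearD[OF linear_irr] irr_eigenproj)
  then show ?thesis using eigenproj_eq assms by blast
qed

lemma eq_zero_if_eigenproj_zero:
  assumes "v \<in> carrier (sp X)" "\<And>k. k < length es \<Longrightarrow> eigenproj es X k v = \<zero>\<^bsub>sp X\<^esub>"
  shows "v = \<zero>\<^bsub>sp X\<^esub>"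
proof -
  have "(\<Oplus>\<^bsub>sp X\<^esub>k\<in>{..<length es}. eigenproj es X k v) = \<zero>\<^bsub>sp X\<^esub>"
    using assms(2) by (intro finsum_all_zero) simp
  then show ?thesis using sum_eigenproj[OF assms(1)] by simp
qed

text \<open>Each component of an eigenvector \<open>v\<close> for \<open>\<mu>\<close> satisfies
  \<open>(es ! k - \<mu>) E_k v = 0\<close>. If \<open>\<mu>\<close> were not in the list, all
  components and hence \<open>v\<close> would vanish.\<close>

lemma eigenvalue_in_es:
  assumes "eigenvalue_op (sp X) (irr X) \<mu>"
  shows "\<mu> \<in> set es"
proof (rule ccontr)
  assume "\<mu> \<notin> set es"
  obtain v where v: "v \<in> carrier (sp X)" "v \<noteq> \<zero>\<^bsub>sp X\<^esub>" "irr X v = \<mu> \<odot>\<^bsub>sp X\<^esub> v"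
    using assms by (auto simp: eigenvalue_op_def)
  have "eigenproj es X k v = \<zero>\<^bsub>sp X\<^esub>" if k: "k < length es" for k
  proof -
    have "(es ! k) \<odot>\<^bsub>sp X\<^esub> eigenproj es X k v = \<mu> \<odot>\<^bsub>sp X\<^esub> eigenproj es X k v"
      using eigenproj_irr[of v k] v k linear_smult[OF linear_eigenproj[OF k]] by simp
    then have "(es ! k - \<mu>) \<odot>\<^bsub>sp X\<^esub> eigenproj es X k v = \<zero>\<^bsub>sp X\<^esub>"
      using v k smult_add_left[of "eigenproj es X k v" "es ! k" "- \<mu>"]
        smult_add_left[of "eigenproj es X k v" \<mu> "- \<mu>"] by simp
    moreover have "es ! k \<noteq> \<mu>" using \<open>\<mu> \<notin> set es\<close> k by auto
    ultimately show ?thesis using smult_eq_zero[of "eigenproj es X k v" "es ! k - \<mu>"] v k by simp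
  qed
  then show False using eq_zero_if_eigenproj_zero v by blast
qed

text \<open>The components of a finite generating set still generate, and each of them is killed by
  \<open>S - es ! k\<close> for some \<open>k\<close>. A basis chosen among them is an
  eigenbasis.\<close>

lemma diagonalizable_irr:
  assumes "vectorspace.fin_dim CC (sp X)"
  shows "diagonalizable_op (sp X) (irr X)"
proof -
  let ?span = "LinearCombinations.module.span CC (sp X)"
  obtain G where G: "finite G" "G \<subseteq> carrier (sp X)" "?span G = carrier (sp X)"
    using assms fin_dim_iff by blast
  define H where "H = (\<lambda>(k, g). eigenproj es X k g) ` ({..<length es} \<times> G)"
  have H: "finite H" "H \<subseteq> carrier (sp X)" using G(1,2) by (auto simp: H_def)
  have "g \<in> ?span H" if g: "g \<in> G" for g
  proof -
    have "eigenproj es X k g \<in> ?span H" if "k < length es" for k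
      using subset_span[OF H(2)] that g by (force simp: H_def)
    then have "(\<Oplus>\<^bsub>sp X\<^esub>k\<in>{..<length es}. eigenproj es X k g) \<in> ?span H"
      by (intro subspace_finsum[OF span_subspace[OF H(2)]]) auto
    then show ?thesis using sum_eigenproj G(2) g by auto
  qed
  then have "carrier (sp X) \<subseteq> ?span H"
    using span_subset_subspace[OF span_subspace[OF H(2)], of G] G(3) by auto
  then have "?span H = carrier (sp X)" using subspaceD(1)[OF span_subspace[OF H(2)]] by auto
  from finite_basis_of_generators[OF H this] obtain B
    where "B \<subseteq> H" "vectorspace.basis CC (sp X) B" by blast
  moreover have "\<exists>\<mu>. irr X b = \<mu> \<odot>\<^bsub>sp X\<^esub> b" if b: "b \<in> H" for b
  proof -
    obtain k g where "k < length es" "g \<in> G" "b = eigenproj es X k g"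
      using b by (auto simp: H_def)
    then have "irr X b = (es ! k) \<odot>\<^bsub>sp X\<^esub> b" using irr_eigenproj[of g k] G(2) by auto
    then show ?thesis by blast
  qed
  ultimately show ?thesis unfolding diagonalizable_op_def by blast
qed

lemma in_PI:
  assumes "vectorspace.fin_dim CC (sp X)" "\<And>i. i < length as \<Longrightarrow> is_linear (sp X) (sp X) (res X i)"
  shows "in_P as es X"
  unfolding in_P_def
  using assms vectorspace linear_irr diagonalizable_irr eigenvalue_in_es by blast

lemma ex_eigenvector:
  assumes "carrier (sp X) \<noteq> {\<zero>\<^bsub>sp X\<^esub>}"
  shows "\<exists>v k. v \<in> carrier (sp X) \<and> v \<noteq> \<zero>\<^bsub>sp X\<^esub> \<and> k < length es \<and> irr X v = (es ! k) \<odot>\<^bsub>sp X\<^esub> v"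
proof -
  have "\<zero>\<^bsub>sp X\<^esub> \<in> carrier (sp X)" by simp
  then obtain v where v: "v \<in> carrier (sp X)" "v \<noteq> \<zero>\<^bsub>sp X\<^esub>" using assms by blast
  then obtain k where "k < length es" "eigenproj es X k v \<noteq> \<zero>\<^bsub>sp X\<^esub>"
    using eq_zero_if_eigenproj_zero by blast
  then show ?thesis using v irr_eigenproj by blast
qed

end

text \<open>The vectors that possess a decomposition form a subspace, so it is enough to decompose
  generators. The generators are an eigenbasis for an abstract object and the columns of a
  diagonalizing matrix for an equation.\<close>

lemma eigen_system_of_generators:
  assumes "distinct es" and lin: "is_linear (sp X) (sp X) (irr X)"
    and G: "G \<subseteq> carrier (sp X)" "LinearCombinations.module.span CC (sp X) G = carrier (sp X)"
    and eig: "\<And>g. g \<in> G \<Longrightarrow> \<exists>k<length es. irr X g = (es ! k) \<odot>\<^bsub>sp X\<^esub> g"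
  shows "eigen_system es X"
proof (rule eigen_system.intro)
  show "distinct es" "is_linear (sp X) (sp X) (irr X)" by fact+
  interpret cspace "sp X" using cspace_if_linear[OF lin] by blast
  define W where "W = {v \<in> carrier (sp X). \<exists>u. eigen_family es X u v}"
  have W: "VectorSpace.subspace CC W (sp X)"
  proof (rule subspaceI)
    show "W \<subseteq> carrier (sp X)" by (auto simp: W_def)
    have "eigen_family es X (\<lambda>_. \<zero>\<^bsub>sp X\<^esub>) \<zero>\<^bsub>sp X\<^esub>"
      by (simp add: eigen_family_def linear_zero[OF lin])
    then show "\<zero>\<^bsub>sp X\<^esub> \<in> W" by (auto simp: W_def)
  next
    fix v w assume "v \<in> W" "w \<in> W"
    then obtain u u' where "eigen_family es X u v" "eigen_family es X u' w" by (auto simp: W_def)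
    then have "eigen_family es X (\<lambda>k. u k \<oplus>\<^bsub>sp X\<^esub> u' k) (v \<oplus>\<^bsub>sp X\<^esub> w)"
      by (auto simp: eigen_family_def is_linearD[OF lin] smult_add_right finsum_add)
    then show "v \<oplus>\<^bsub>sp X\<^esub> w \<in> W" using \<open>v \<in> W\<close> \<open>w \<in> W\<close> by (auto simp: W_def)
  next
    fix c v assume "v \<in> W"
    then obtain u where "eigen_family es X u v" by (auto simp: W_def)
    then have "eigen_family es X (\<lambda>k. c \<odot>\<^bsub>sp X\<^esub> u k) (c \<odot>\<^bsub>sp X\<^esub> v)"
      using smult_finsum[of "{..<length es}" u c]
      by (auto simp: eigen_family_def is_linearD[OF lin] mult.commute)
    then show "c \<odot>\<^bsub>sp X\<^esub> v \<in> W" using \<open>v \<in> W\<close> by (auto simp: W_def)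
  qed
  have "G \<subseteq> W"
  proof
    fix g assume g: "g \<in> G"
    then obtain j where j: "j < length es" "irr X g = (es ! j) \<odot>\<^bsub>sp X\<^esub> g" using eig by blast
    have "(\<Oplus>\<^bsub>sp X\<^esub>i\<in>{..<length es}. if i = j then g else \<zero>\<^bsub>sp X\<^esub>) = g"
      using j g G(1) by (intro finsum_delta[of j]) auto
    then have "eigen_family es X (\<lambda>i. if i = j then g else \<zero>\<^bsub>sp X\<^esub>) g"
      using j g G(1) by (auto simp: eigen_family_def linear_zero[OF lin])
    then show "g \<in> W" using g G(1) by (auto simp: W_def)
  qed
  then have "carrier (sp X) \<subseteq> W" using span_subset_subspace[OF W, of G] G(2) by simp
  then show "\<exists>u. eigen_family es X u v" if "v \<in> carrier (sp X)" for v
    using that by (auto simp: W_def)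
qed

lemma eigen_system_if_in_P:
  assumes "in_P as es X" "distinct es"
  shows "eigen_system es X"
proof -
  have lin: "is_linear (sp X) (sp X) (irr X)" using assms by (simp add: in_P_def)
  interpret cspace "sp X" using cspace_if_linear[OF lin] by blast
  obtain B where B: "vectorspace.basis CC (sp X) B" and eig: "\<And>b. b \<in> B \<Longrightarrow> \<exists>\<mu>. irr X b = \<mu> \<odot>\<^bsub>sp X\<^esub> b"
    using assms by (auto simp: in_P_def diagonalizable_op_def)
  have B': "B \<subseteq> carrier (sp X)" "LinearCombinations.module.span CC (sp X) B = carrier (sp X)"
    and indep: "LinearCombinations.module.lin_indpt CC (sp X) B"
    using B vectorspace.basis_def[OF vectorspace] by auto
  show ?thesis
  proof (rule eigen_system_of_generators[OF \<open>distinct es\<close> lin B'])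
    fix b assume b: "b \<in> B"
    obtain \<mu> where \<mu>: "irr X b = \<mu> \<odot>\<^bsub>sp X\<^esub> b" using eig b by blast
    \<comment> \<open>\<open>eigenvalue_op\<close> asks for a nonzero eigenvector. Basis vectors are
      nonzero, so the bound on eigenvalues in \<open>in_P\<close> applies to
      \<open>\<mu>\<close>.\<close>
    have "b \<noteq> \<zero>\<^bsub>sp X\<^esub>"
      using vectorspace.vs_zero_lin_dep[OF vectorspace B'(1) indep] b by blast
    then have "eigenvalue_op (sp X) (irr X) \<mu>"
      using \<mu> b B'(1) unfolding eigenvalue_op_def by blast
    then have "\<mu> \<in> set es" using assms(1) by (simp add: in_P_def)
    then show "\<exists>k<length es. irr X b = (es ! k) \<odot>\<^bsub>sp X\<^esub> b"
      using \<mu> by (auto simp: in_set_conv_nth)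
  qed
qed

section \<open>Isomorphic and irreducible systems\<close>

text \<open>The part of \<open>in_P\<close> on which isomorphism arguments rest. It depends only on
  the number of residues, so it serves both categories between which the transforms pass.\<close>

definition linear_system :: "nat \<Rightarrow> 'v system \<Rightarrow> bool" where
  "linear_system q X \<longleftrightarrow>
     is_linear (sp X) (sp X) (irr X) \<and> (\<forall>i<q. is_linear (sp X) (sp X) (res X i))"

lemma linear_systemD:
  assumes "linear_system q X"
  shows "cspace (sp X)" "is_linear (sp X) (sp X) (irr X)"
    "\<And>i. i < q \<Longrightarrow> is_linear (sp X) (sp X) (res X i)"
  using assms cspace_if_linear by (auto simp: linear_system_def)

lemma linear_system_if_in_P: "in_P as es X \<Longrightarrow> linear_system (length as) X"
  by (simp add: in_P_def linear_system_def)

definition iso_systems :: "nat \<Rightarrow> 'v system \<Rightarrow> 'w system \<Rightarrow> bool" where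
  "iso_systems q X Y \<longleftrightarrow>
     (\<exists>f g. morphism q X Y f \<and> morphism q Y X g \<and>
        (\<forall>v\<in>carrier (sp X). g (f v) = v) \<and> (\<forall>w\<in>carrier (sp Y). f (g w) = w))"

lemma isomorphic_P_iff:
  "isomorphic_P as es X Y \<longleftrightarrow> in_P as es X \<and> in_P as es Y \<and> iso_systems (length as) X Y"
  by (simp add: isomorphic_P_def iso_systems_def)

lemma morphismD:
  assumes "morphism q X Y f"
  shows "is_linear (sp X) (sp Y) f"
    "\<And>v. v \<in> carrier (sp X) \<Longrightarrow> irr Y (f v) = f (irr X v)"
    "\<And>i v. i < q \<Longrightarrow> v \<in> carrier (sp X) \<Longrightarrow> res Y i (f v) = f (res X i v)"
  using assms by (auto simp: morphism_def)

lemma iso_systems_sym: "iso_systems q X Y \<Longrightarrow> iso_systems q Y X"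
  unfolding iso_systems_def by blast

lemma morphism_compose:
  assumes f: "morphism q X Y f" and g: "morphism q Y Z g"
  shows "morphism q X Z (\<lambda>v. g (f v))"
  using linear_compose[OF morphismD(1)[OF f] morphismD(1)[OF g]]
    linear_closed[OF morphismD(1)[OF f]] morphismD(2,3)[OF f] morphismD(2,3)[OF g]
  unfolding morphism_def by simp

lemma iso_systems_trans [trans]:
  assumes "iso_systems q X Y" "iso_systems q Y Z"
  shows "iso_systems q X Z"
proof -
  obtain f g where fg: "morphism q X Y f" "morphism q Y X g"
    "\<And>v. v \<in> carrier (sp X) \<Longrightarrow> g (f v) = v" "\<And>w. w \<in> carrier (sp Y) \<Longrightarrow> f (g w) = w"
    using assms(1) unfolding iso_systems_def by blast
  obtain f' g' where fg': "morphism q Y Z f'" "morphism q Z Y g'"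
    "\<And>v. v \<in> carrier (sp Y) \<Longrightarrow> g' (f' v) = v" "\<And>w. w \<in> carrier (sp Z) \<Longrightarrow> f' (g' w) = w"
    using assms(2) unfolding iso_systems_def by blast
  have "\<forall>v\<in>carrier (sp X). g (g' (f' (f v))) = v" "\<forall>w\<in>carrier (sp Z). f' (f (g (g' w))) = w"
    using fg fg' linear_closed[OF morphismD(1)[OF fg(1)]] linear_closed[OF morphismD(1)[OF fg'(2)]]
    by auto
  then show ?thesis
    unfolding iso_systems_def
    using morphism_compose[OF fg(1) fg'(1)] morphism_compose[OF fg'(2) fg(2)] by blast
qed

text \<open>Operators are unconstrained outside the carrier, so systems with the same content may
  differ as records. Agreement on the carrier is therefore turned into an isomorphism.\<close>

lemma iso_systems_cong:
  assumes X: "linear_system q X" and "sp Y = sp X"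
    and "\<And>v. v \<in> carrier (sp X) \<Longrightarrow> irr Y v = irr X v"
    and "\<And>i v. i < q \<Longrightarrow> v \<in> carrier (sp X) \<Longrightarrow> res Y i v = res X i v"
  shows "iso_systems q X Y"
proof -
  interpret cspace "sp X" using linear_systemD(1)[OF X] .
  have "is_linear (sp X) (sp X) (\<lambda>v. v)"
    by (rule is_linearI) (auto simp: cspace_axioms)
  then have "morphism q X Y (\<lambda>v. v)" "morphism q Y X (\<lambda>v. v)"
    using assms by (auto simp: morphism_def)
  then show ?thesis
    unfolding iso_systems_def by (intro exI[of _ "\<lambda>v. v"]) simp
qed

text \<open>A total linear relation that relates zero only to zero is the graph of a linear map. The
  maps needed later are determined by equations between components of tuples; as relations they
  require no choice of lifts and no check that the result is independent of one.\<close>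

lemma morphism_of_relation:
  assumes X: "linear_system q X" and Y: "linear_system q Y"
    and total: "\<And>v. v \<in> carrier (sp X) \<Longrightarrow> \<exists>y\<in>carrier (sp Y). R v y"
    and functional: "\<And>y. y \<in> carrier (sp Y) \<Longrightarrow> R \<zero>\<^bsub>sp X\<^esub> y \<Longrightarrow> y = \<zero>\<^bsub>sp Y\<^esub>"
    and add: "\<And>v w y z. v \<in> carrier (sp X) \<Longrightarrow> w \<in> carrier (sp X) \<Longrightarrow> y \<in> carrier (sp Y) \<Longrightarrow>
      z \<in> carrier (sp Y) \<Longrightarrow> R v y \<Longrightarrow> R w z \<Longrightarrow> R (v \<oplus>\<^bsub>sp X\<^esub> w) (y \<oplus>\<^bsub>sp Y\<^esub> z)"
    and smult: "\<And>c v y. v \<in> carrier (sp X) \<Longrightarrow> y \<in> carrier (sp Y) \<Longrightarrow> R v y \<Longrightarrow>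
      R (c \<odot>\<^bsub>sp X\<^esub> v) (c \<odot>\<^bsub>sp Y\<^esub> y)"
    and irr: "\<And>v y. v \<in> carrier (sp X) \<Longrightarrow> y \<in> carrier (sp Y) \<Longrightarrow> R v y \<Longrightarrow>
      R (irr X v) (irr Y y)"
    and res: "\<And>i v y. i < q \<Longrightarrow> v \<in> carrier (sp X) \<Longrightarrow> y \<in> carrier (sp Y) \<Longrightarrow> R v y \<Longrightarrow>
      R (res X i v) (res Y i y)"
  shows "\<exists>f. morphism q X Y f \<and> (\<forall>v\<in>carrier (sp X). R v (f v)) \<and>
    (\<forall>v\<in>carrier (sp X). \<forall>y\<in>carrier (sp Y). R v y \<longrightarrow> f v = y)"
proof -
  interpret X: cspace "sp X" using linear_systemD(1)[OF X] .
  interpret Y: cspace "sp Y" using linear_systemD(1)[OF Y] .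
  define f where "f v = (SOME y. y \<in> carrier (sp Y) \<and> R v y)" for v
  have f: "f v \<in> carrier (sp Y)" "R v (f v)" if "v \<in> carrier (sp X)" for v
    using someI_ex[of "\<lambda>y. y \<in> carrier (sp Y) \<and> R v y"] total[OF that] by (auto simp: f_def)
  have unique: "y = z" if "v \<in> carrier (sp X)" "y \<in> carrier (sp Y)" "z \<in> carrier (sp Y)" "R v y" "R v z"
    for v y z
  proof -
    have "R (v \<oplus>\<^bsub>sp X\<^esub> (- 1) \<odot>\<^bsub>sp X\<^esub> v) (y \<oplus>\<^bsub>sp Y\<^esub> (- 1) \<odot>\<^bsub>sp Y\<^esub> z)"
      using that by (intro add smult) auto
    then have "y \<oplus>\<^bsub>sp Y\<^esub> (- 1) \<odot>\<^bsub>sp Y\<^esub> z = \<zero>\<^bsub>sp Y\<^esub>"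
      using that by (intro functional) auto
    then show ?thesis using Y.eq_if_diff_zero that by blast
  qed
  have f_eq: "f v = y" if "v \<in> carrier (sp X)" "y \<in> carrier (sp Y)" "R v y" for v y
    using unique[of v] that f by blast
  have "is_linear (sp X) (sp Y) f"
    by (rule is_linearI) (auto intro!: f f_eq add smult simp: X.cspace_axioms Y.cspace_axioms)
  moreover have "irr Y (f v) = f (irr X v)" if "v \<in> carrier (sp X)" for v
    using f[OF that] irr that linear_closed[OF linear_systemD(2)[OF X]]
      linear_closed[OF linear_systemD(2)[OF Y]] by (metis f_eq)
  moreover have "res Y i (f v) = f (res X i v)" if "i < q" "v \<in> carrier (sp X)" for i v
    using f[OF that(2)] res that linear_closed[OF linear_systemD(3)[OF X]]
      linear_closed[OF linear_systemD(3)[OF Y]] by (metis f_eq)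
  ultimately have "morphism q X Y f" by (simp add: morphism_def)
  then show ?thesis using f(2) f_eq by blast
qed

text \<open>The hypotheses are symmetric in the two sides, so \<open>R\<close> and its converse both
  define morphisms. These are mutually inverse because each value is determined by
  \<open>R\<close>.\<close>

lemma iso_systems_of_relation:
  assumes X: "linear_system q X" and Y: "linear_system q Y"
    and total: "\<And>v. v \<in> carrier (sp X) \<Longrightarrow> \<exists>y\<in>carrier (sp Y). R v y"
    and surj: "\<And>y. y \<in> carrier (sp Y) \<Longrightarrow> \<exists>v\<in>carrier (sp X). R v y"
    and functional: "\<And>y. y \<in> carrier (sp Y) \<Longrightarrow> R \<zero>\<^bsub>sp X\<^esub> y \<Longrightarrow> y = \<zero>\<^bsub>sp Y\<^esub>"
    and inj: "\<And>v. v \<in> carrier (sp X) \<Longrightarrow> R v \<zero>\<^bsub>sp Y\<^esub> \<Longrightarrow> v = \<zero>\<^bsub>sp X\<^esub>"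
    and add: "\<And>v w y z. v \<in> carrier (sp X) \<Longrightarrow> w \<in> carrier (sp X) \<Longrightarrow> y \<in> carrier (sp Y) \<Longrightarrow>
      z \<in> carrier (sp Y) \<Longrightarrow> R v y \<Longrightarrow> R w z \<Longrightarrow> R (v \<oplus>\<^bsub>sp X\<^esub> w) (y \<oplus>\<^bsub>sp Y\<^esub> z)"
    and smult: "\<And>c v y. v \<in> carrier (sp X) \<Longrightarrow> y \<in> carrier (sp Y) \<Longrightarrow> R v y \<Longrightarrow>
      R (c \<odot>\<^bsub>sp X\<^esub> v) (c \<odot>\<^bsub>sp Y\<^esub> y)"
    and irr: "\<And>v y. v \<in> carrier (sp X) \<Longrightarrow> y \<in> carrier (sp Y) \<Longrightarrow> R v y \<Longrightarrow>
      R (irr X v) (irr Y y)"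
    and res: "\<And>i v y. i < q \<Longrightarrow> v \<in> carrier (sp X) \<Longrightarrow> y \<in> carrier (sp Y) \<Longrightarrow> R v y \<Longrightarrow>
      R (res X i v) (res Y i y)"
  shows "iso_systems q X Y"
proof -
  have "\<exists>f. morphism q X Y f \<and> (\<forall>v\<in>carrier (sp X). R v (f v)) \<and>
      (\<forall>v\<in>carrier (sp X). \<forall>y\<in>carrier (sp Y). R v y \<longrightarrow> f v = y)"
    by (rule morphism_of_relation[where R = R, OF X Y total functional add smult irr res])
  then obtain f where f: "morphism q X Y f" "\<forall>v\<in>carrier (sp X). R v (f v)"
    "\<forall>v\<in>carrier (sp X). \<forall>y\<in>carrier (sp Y). R v y \<longrightarrow> f v = y" by blast
  have "\<exists>g. morphism q Y X g \<and> (\<forall>y\<in>carrier (sp Y). R (g y) y) \<and>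
      (\<forall>y\<in>carrier (sp Y). \<forall>v\<in>carrier (sp X). R v y \<longrightarrow> g y = v)"
    by (rule morphism_of_relation[where R = "\<lambda>y v. R v y", OF Y X surj inj add smult irr res])
  then obtain g where g: "morphism q Y X g" "\<forall>y\<in>carrier (sp Y). R (g y) y"
    "\<forall>y\<in>carrier (sp Y). \<forall>v\<in>carrier (sp X). R v y \<longrightarrow> g y = v" by blast
  have "\<forall>v\<in>carrier (sp X). g (f v) = v" "\<forall>y\<in>carrier (sp Y). f (g y) = y"
    using f g linear_closed[OF morphismD(1)[OF f(1)]] linear_closed[OF morphismD(1)[OF g(1)]] by auto
  with f(1) g(1) show ?thesis unfolding iso_systems_def by blast
qed

text \<open>The operators of \<open>Y\<close> are conjugates such as \<open>f S g\<close> of those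
  of \<open>X\<close>, so linearity is transported along with the isomorphism.\<close>

lemma linear_system_iso:
  assumes "iso_systems q X Y" "linear_system q X"
  shows "linear_system q Y"
proof -
  obtain f g where fg: "morphism q X Y f" "morphism q Y X g"
    "\<And>v. v \<in> carrier (sp X) \<Longrightarrow> g (f v) = v" "\<And>w. w \<in> carrier (sp Y) \<Longrightarrow> f (g w) = w"
    using assms(1) unfolding iso_systems_def by blast
  note lin = linear_closed[OF morphismD(1)[OF fg(1)]] linear_closed[OF morphismD(1)[OF fg(2)]]
  have "is_linear (sp Y) (sp Y) (\<lambda>y. f (irr X (g y)))"
    using linear_compose[OF linear_compose[OF morphismD(1)[OF fg(2)] linear_systemD(2)[OF assms(2)]]
        morphismD(1)[OF fg(1)]] .
  then have "is_linear (sp Y) (sp Y) (irr Y)"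
    by (rule linear_cong) (use lin fg(4) morphismD(2)[OF fg(1)] in metis)
  moreover have "is_linear (sp Y) (sp Y) (res Y i)" if "i < q" for i
  proof -
    have "is_linear (sp Y) (sp Y) (\<lambda>y. f (res X i (g y)))"
      using linear_compose[OF linear_compose[OF morphismD(1)[OF fg(2)]
            linear_systemD(3)[OF assms(2) that]] morphismD(1)[OF fg(1)]] .
    then show ?thesis
      by (rule linear_cong) (use that lin fg(4) morphismD(3)[OF fg(1)] in metis)
  qed
  ultimately show ?thesis by (simp add: linear_system_def)
qed

lemma fin_dim_surj:
  assumes f: "is_linear V W f" and "vectorspace.fin_dim CC V" "f ` carrier V = carrier W"
  shows "vectorspace.fin_dim CC W"
  using linear_map.surj_fin_dim assms by blast

lemma iso_systems_surj:
  assumes "morphism q X Y f" "morphism q Y X g" "\<And>w. w \<in> carrier (sp Y) \<Longrightarrow> f (g w) = w"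
  shows "f ` carrier (sp X) = carrier (sp Y)"
  using linear_closed[OF morphismD(1)[OF assms(1)]] linear_closed[OF morphismD(1)[OF assms(2)]] assms(3)
  by force

lemma eigen_system_iso:
  assumes iso: "iso_systems q X Y" and X: "eigen_system es X" and lin: "linear_system q X"
  shows "eigen_system es Y"
proof (rule eigen_system.intro)
  interpret eigen_system es X by fact
  obtain f g where fg: "morphism q X Y f" "morphism q Y X g"
    "\<And>v. v \<in> carrier (sp X) \<Longrightarrow> g (f v) = v" "\<And>w. w \<in> carrier (sp Y) \<Longrightarrow> f (g w) = w"
    using iso unfolding iso_systems_def by blast
  show "distinct es" by (rule distinct_es)
  show "is_linear (sp Y) (sp Y) (irr Y)"
    using linear_system_iso[OF iso lin] by (simp add: linear_system_def)
  fix y assume y: "y \<in> carrier (sp Y)"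
  note f = is_linearD[OF morphismD(1)[OF fg(1)]] and g = is_linearD[OF morphismD(1)[OF fg(2)]]
  have "(\<Oplus>\<^bsub>sp Y\<^esub>k\<in>{..<length es}. f (eigenproj es X k (g y))) = f (g y)"
    using y g(1) linear_finsum[OF morphismD(1)[OF fg(1)], of "{..<length es}" "\<lambda>k. eigenproj es X k (g y)"]
    by (simp add: sum_eigenproj)
  then have "eigen_family es Y (\<lambda>k. f (eigenproj es X k (g y))) y"
    using y f(1) g(1) fg(4) morphismD(2)[OF fg(1)] f(3)
    by (simp add: eigen_family_def irr_eigenproj)
  then show "\<exists>u. eigen_family es Y u y" by blast
qed

lemma in_P_iso:
  assumes iso: "iso_systems (length as) X Y" and X: "in_P as es X" and "distinct es"
  shows "in_P as es Y"
proof -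
  note lin = linear_system_if_in_P[OF X]
  obtain f g where fg: "morphism (length as) X Y f" "morphism (length as) Y X g"
    "\<And>v. v \<in> carrier (sp X) \<Longrightarrow> g (f v) = v" "\<And>w. w \<in> carrier (sp Y) \<Longrightarrow> f (g w) = w"
    using iso unfolding iso_systems_def by blast
  have "vectorspace.fin_dim CC (sp Y)"
    using fin_dim_surj[OF morphismD(1)[OF fg(1)]] X iso_systems_surj[OF fg(1,2,4)]
    by (simp add: in_P_def)
  then show ?thesis
    using eigen_system.in_PI[OF eigen_system_iso[OF iso eigen_system_if_in_P[OF X \<open>distinct es\<close>] lin]]
      linear_systemD(3)[OF linear_system_iso[OF iso lin]] by blast
qed

lemma irreducible_iso:
  assumes iso: "iso_systems q X Y" and lin: "linear_system q X" and irred: "irreducible_sys q X"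
  shows "irreducible_sys q Y"
proof -
  interpret X: cspace "sp X" using linear_systemD(1)[OF lin] .
  interpret Y: cspace "sp Y" using linear_systemD(1)[OF linear_system_iso[OF iso lin]] .
  obtain f g where fg: "morphism q X Y f" "morphism q Y X g"
    "\<And>v. v \<in> carrier (sp X) \<Longrightarrow> g (f v) = v" "\<And>w. w \<in> carrier (sp Y) \<Longrightarrow> f (g w) = w"
    using iso unfolding iso_systems_def by blast
  note f = is_linearD[OF morphismD(1)[OF fg(1)]] and g = is_linearD[OF morphismD(1)[OF fg(2)]]
  show ?thesis unfolding irreducible_sys_def
  proof (intro conjI allI impI)
    obtain v where "v \<in> carrier (sp X)" "v \<noteq> \<zero>\<^bsub>sp X\<^esub>"
      using irred X.zero_closed unfolding irreducible_sys_def by blast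
    then have "f v \<in> carrier (sp Y)" "f v \<noteq> \<zero>\<^bsub>sp Y\<^esub>" using f(1) g(4) fg(3)[of v] by auto
    then show "carrier (sp Y) \<noteq> {\<zero>\<^bsub>sp Y\<^esub>}" by blast
  next
    fix W assume W: "VectorSpace.subspace CC W (sp Y)" and irrW: "irr Y ` W \<subseteq> W"
      and resW: "\<forall>i<q. res Y i ` W \<subseteq> W"
    define U where "U = {v \<in> carrier (sp X). f v \<in> W}"
    have "VectorSpace.subspace CC U (sp X)"
      using Y.subspaceD[OF W] by (intro X.subspaceI) (auto simp: U_def f)
    moreover have "irr X ` U \<subseteq> U"
      using irrW morphismD(2)[OF fg(1), symmetric] linear_closed[OF linear_systemD(2)[OF lin]]
      by (auto simp: U_def)
    moreover have "\<forall>i<q. res X i ` U \<subseteq> U"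
      using resW morphismD(3)[OF fg(1), symmetric] linear_closed[OF linear_systemD(3)[OF lin]]
      by (fastforce simp: U_def)
    ultimately consider "U = {\<zero>\<^bsub>sp X\<^esub>}" | "U = carrier (sp X)"
      using irred unfolding irreducible_sys_def by blast
    then show "W = {\<zero>\<^bsub>sp Y\<^esub>} \<or> W = carrier (sp Y)"
    proof cases
      case 1
      have "w = \<zero>\<^bsub>sp Y\<^esub>" if "w \<in> W" for w
      proof -
        have "w \<in> carrier (sp Y)" using that Y.subspaceD(1)[OF W] by blast
        moreover from this have "g w \<in> U" using that g(1) fg(4) by (simp add: U_def)
        ultimately show ?thesis using 1 f(4) fg(4)[of w] by auto
      qed
      then show ?thesis using Y.subspaceD(2)[OF W] by blast
    next
      case 2
      have "w \<in> W" if "w \<in> carrier (sp Y)" for w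
      proof -
        have "g w \<in> U" using 2 g(1) that by simp
        then show ?thesis using fg(4)[OF that] by (simp add: U_def)
      qed
      then show ?thesis using Y.subspaceD(1)[OF W] by blast
    qed
  qed
qed

text \<open>For irreducible systems this is non-exceptionality, see
  \<open>non_exceptional_iff\<close>. Freed from the dimension, it is carried over by morphisms at
  once.\<close>

definition nontrivial_residue :: "nat \<Rightarrow> 'v system \<Rightarrow> bool" where
  "nontrivial_residue q X \<longleftrightarrow> (\<exists>i<q. \<exists>v\<in>carrier (sp X). res X i v \<noteq> \<zero>\<^bsub>sp X\<^esub>)"

lemma nontrivial_residue_iso:
  assumes iso: "iso_systems q X Y" and X: "nontrivial_residue q X" and lin: "linear_system q X"
  shows "nontrivial_residue q Y"
proof -
  obtain f g where fg: "morphism q X Y f" "morphism q Y X g"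
    "\<And>v. v \<in> carrier (sp X) \<Longrightarrow> g (f v) = v" "\<And>w. w \<in> carrier (sp Y) \<Longrightarrow> f (g w) = w"
    using iso unfolding iso_systems_def by blast
  obtain i v where iv: "i < q" "v \<in> carrier (sp X)" "res X i v \<noteq> \<zero>\<^bsub>sp X\<^esub>"
    using X by (auto simp: nontrivial_residue_def)
  have "res X i v \<in> carrier (sp X)" using linear_closed[OF linear_systemD(3)[OF lin iv(1)] iv(2)] .
  then have "res Y i (f v) \<noteq> \<zero>\<^bsub>sp Y\<^esub>"
    using iv morphismD(3)[OF fg(1) iv(1,2)] fg(3)[of "res X i v"] linear_zero[OF morphismD(1)[OF fg(2)]]
    by auto
  then show ?thesis
    using iv linear_closed[OF morphismD(1)[OF fg(1)] iv(2)] unfolding nontrivial_residue_def by blast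
qed

text \<open>If all residues vanish, an eigenvector of the \<open>dx\<close>-term spans an invariant line.\<close>

lemma non_exceptional_iff:
  assumes "eigen_system es X" and lin: "linear_system q X" and irred: "irreducible_sys q X"
  shows "non_exceptional q X \<longleftrightarrow> nontrivial_residue q X"
proof
  interpret eigen_system es X by fact
  assume ne: "non_exceptional q X"
  show "nontrivial_residue q X"
  proof (rule ccontr)
    assume "\<not> nontrivial_residue q X"
    then have triv: "res X i v = \<zero>\<^bsub>sp X\<^esub>" if "i < q" "v \<in> carrier (sp X)" for i v
      using that by (auto simp: nontrivial_residue_def)
    obtain v k where v: "v \<in> carrier (sp X)" "v \<noteq> \<zero>\<^bsub>sp X\<^esub>" "irr X v = (es ! k) \<odot>\<^bsub>sp X\<^esub> v"
      using ex_eigenvector irred by (auto simp: irreducible_sys_def)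
    define L where "L = range (\<lambda>c. c \<odot>\<^bsub>sp X\<^esub> v)"
    have L: "VectorSpace.subspace CC L (sp X)" unfolding L_def by (rule line_subspace[OF v(1)])
    have "irr X ` L \<subseteq> L" using v by (auto simp: L_def linear_smult[OF linear_irr])
    moreover have "\<forall>i<q. res X i ` L \<subseteq> L"
      using triv subspaceD(1,2)[OF L] by auto
    ultimately have "L = {\<zero>\<^bsub>sp X\<^esub>} \<or> L = carrier (sp X)"
      using irred L unfolding irreducible_sys_def by blast
    moreover have "v \<in> L" using v(1) unfolding L_def by (metis rangeI smult_one)
    ultimately have "L = carrier (sp X)" using v(2) by auto
    then have "vectorspace.dim CC (sp X) = 1"
      using v by (intro dim_one_if_line[of v]) (auto simp: L_def)
    then show False using ne triv by (auto simp: non_exceptional_def exceptional_def)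
  qed
qed (use irred in \<open>auto simp: non_exceptional_def exceptional_def irreducible_sys_def nontrivial_residue_def\<close>)

section \<open>Consequences of irreducibility and non-exceptionality\<close>

locale irreducible_system = eigen_system es X
  for es :: "complex list" and X :: "'v system" +
  fixes q :: nat
  assumes linear_res: "\<And>i. i < q \<Longrightarrow> is_linear (sp X) (sp X) (res X i)"
    and irreducible: "irreducible_sys q X"
    and nontrivial: "nontrivial_residue q X"
begin

lemma linear_system: "linear_system q X"
  using linear_irr linear_res by (simp add: linear_system_def)

lemma invariant_subspace:
  assumes "VectorSpace.subspace CC W (sp X)" "\<And>w. w \<in> W \<Longrightarrow> irr X w \<in> W"
    "\<And>i w. i < q \<Longrightarrow> w \<in> W \<Longrightarrow> res X i w \<in> W"
  shows "W = {\<zero>\<^bsub>sp X\<^esub>} \<or> W = carrier (sp X)"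
  using irreducible assms unfolding irreducible_sys_def by blast

text \<open>Otherwise \<open>v\<close> spans a line that is invariant under all operators. By
  irreducibility this line is the whole space, and all residues vanish on it, contrary to
  \<open>nontrivial\<close>. This is what makes the inversion map injective.\<close>

lemma common_kernel:
  assumes v: "v \<in> carrier (sp X)" "irr X v = c \<odot>\<^bsub>sp X\<^esub> v"
    and ker: "\<And>i. i < q \<Longrightarrow> res X i v = \<zero>\<^bsub>sp X\<^esub>"
  shows "v = \<zero>\<^bsub>sp X\<^esub>"
proof (rule ccontr)
  assume "v \<noteq> \<zero>\<^bsub>sp X\<^esub>"
  define L where "L = range (\<lambda>c. c \<odot>\<^bsub>sp X\<^esub> v)"
  have L: "VectorSpace.subspace CC L (sp X)" unfolding L_def by (rule line_subspace[OF v(1)])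
  have res: "res X i w = \<zero>\<^bsub>sp X\<^esub>" if "i < q" "w \<in> L" for i w
    using that v(1) ker by (auto simp: L_def linear_smult[OF linear_res])
  have "irr X w \<in> L" if "w \<in> L" for w
    using that v by (auto simp: L_def linear_smult[OF linear_irr])
  then have "L = {\<zero>\<^bsub>sp X\<^esub>} \<or> L = carrier (sp X)"
    using subspaceD(2)[OF L] res by (intro invariant_subspace[OF L]) simp_all
  moreover have "v \<in> L" using v(1) unfolding L_def by (metis rangeI smult_one)
  ultimately have "L = carrier (sp X)" using \<open>v \<noteq> \<zero>\<^bsub>sp X\<^esub>\<close> by auto
  then show False using nontrivial res by (auto simp: nontrivial_residue_def)
qed

text \<open>The vectors \<open>v\<close> with \<open>E\<^sub>k v \<in> E\<^sub>k (\<Sum>i. Im A\<^sub>i)\<close> form a nonzero invariant subspace.\<close>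

lemma eigenproj_image:
  assumes v: "v \<in> carrier (sp X)" and k: "k < length es"
  shows "\<exists>x. (\<forall>i<q. x i \<in> carrier (sp X)) \<and>
     eigenproj es X k v = eigenproj es X k (\<Oplus>\<^bsub>sp X\<^esub>i\<in>{..<q}. res X i (x i))"
proof -
  note E = is_linearD[OF linear_eigenproj[OF k]]
  define W where "W = {v \<in> carrier (sp X). \<exists>x. (\<forall>i<q. x i \<in> carrier (sp X)) \<and>
     eigenproj es X k v = eigenproj es X k (\<Oplus>\<^bsub>sp X\<^esub>i\<in>{..<q}. res X i (x i))}"
  have W: "VectorSpace.subspace CC W (sp X)"
  proof (rule subspaceI)
    show "W \<subseteq> carrier (sp X)" by (auto simp: W_def)
    have "(\<Oplus>\<^bsub>sp X\<^esub>i\<in>{..<q}. res X i \<zero>\<^bsub>sp X\<^esub>) = \<zero>\<^bsub>sp X\<^esub>"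
      by (intro finsum_all_zero) (simp add: linear_zero[OF linear_res])
    then show "\<zero>\<^bsub>sp X\<^esub> \<in> W" unfolding W_def by (auto intro!: exI[of _ "\<lambda>_. \<zero>\<^bsub>sp X\<^esub>"])
  next
    fix v w assume "v \<in> W" "w \<in> W"
    then obtain x y where x: "v \<in> carrier (sp X)" "\<forall>i<q. x i \<in> carrier (sp X)"
      "eigenproj es X k v = eigenproj es X k (\<Oplus>\<^bsub>sp X\<^esub>i\<in>{..<q}. res X i (x i))"
      and y: "w \<in> carrier (sp X)" "\<forall>i<q. y i \<in> carrier (sp X)"
      "eigenproj es X k w = eigenproj es X k (\<Oplus>\<^bsub>sp X\<^esub>i\<in>{..<q}. res X i (y i))"
      by (auto simp: W_def)
    have "(\<Oplus>\<^bsub>sp X\<^esub>i\<in>{..<q}. res X i (x i \<oplus>\<^bsub>sp X\<^esub> y i)) =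
        (\<Oplus>\<^bsub>sp X\<^esub>i\<in>{..<q}. res X i (x i) \<oplus>\<^bsub>sp X\<^esub> res X i (y i))"
      using x y by (intro finsum_eqI) (auto simp: linear_add[OF linear_res] linear_closed[OF linear_res])
    also have "\<dots> = (\<Oplus>\<^bsub>sp X\<^esub>i\<in>{..<q}. res X i (x i)) \<oplus>\<^bsub>sp X\<^esub> (\<Oplus>\<^bsub>sp X\<^esub>i\<in>{..<q}. res X i (y i))"
      using x y by (intro finsum_add) (auto simp: linear_closed[OF linear_res])
    finally show "v \<oplus>\<^bsub>sp X\<^esub> w \<in> W"
      unfolding W_def using x y
      by (auto intro!: exI[of _ "\<lambda>i. x i \<oplus>\<^bsub>sp X\<^esub> y i"] simp: E linear_closed[OF linear_res])
  next
    fix c v assume "v \<in> W"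
    then obtain x where x: "v \<in> carrier (sp X)" "\<forall>i<q. x i \<in> carrier (sp X)"
      "eigenproj es X k v = eigenproj es X k (\<Oplus>\<^bsub>sp X\<^esub>i\<in>{..<q}. res X i (x i))"
      by (auto simp: W_def)
    have "(\<Oplus>\<^bsub>sp X\<^esub>i\<in>{..<q}. res X i (c \<odot>\<^bsub>sp X\<^esub> x i)) = (\<Oplus>\<^bsub>sp X\<^esub>i\<in>{..<q}. c \<odot>\<^bsub>sp X\<^esub> res X i (x i))"
      using x by (intro finsum_eqI) (auto simp: linear_smult[OF linear_res] linear_closed[OF linear_res])
    also have "\<dots> = c \<odot>\<^bsub>sp X\<^esub> (\<Oplus>\<^bsub>sp X\<^esub>i\<in>{..<q}. res X i (x i))"
      using x by (intro smult_finsum[symmetric]) (auto simp: linear_closed[OF linear_res])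
    finally show "c \<odot>\<^bsub>sp X\<^esub> v \<in> W"
      unfolding W_def using x
      by (auto intro!: exI[of _ "\<lambda>i. c \<odot>\<^bsub>sp X\<^esub> x i"] simp: E linear_closed[OF linear_res])
  qed
  have irrW: "irr X v \<in> W" if "v \<in> W" for v
  proof -
    have v: "v \<in> carrier (sp X)" using that by (simp add: W_def)
    have "(es ! k) \<odot>\<^bsub>sp X\<^esub> v \<in> W" using subspaceD(4)[OF W that] .
    then show ?thesis
      using v by (simp add: W_def E(3) eigenproj_irr k linear_closed[OF linear_irr])
  qed
  \<comment> \<open>\<open>W\<close> contains the whole image of each residue, not only the image of
    \<open>W\<close>: the sum can be made to consist of the single term \<open>res X i v\<close>.
    This gives invariance and, since some residue is nonzero, also
    \<open>W \<noteq> 0\<close>.\<close>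
  have resW: "res X i v \<in> W" if "i < q" "v \<in> carrier (sp X)" for i v
  proof -
    have "(\<Oplus>\<^bsub>sp X\<^esub>j\<in>{..<q}. res X j (if j = i then v else \<zero>\<^bsub>sp X\<^esub>)) = res X i v"
      using that by (intro finsum_delta[of i])
        (auto simp: linear_zero[OF linear_res] linear_closed[OF linear_res])
    then show ?thesis
      unfolding W_def using that
      by (auto intro!: exI[of _ "\<lambda>j. if j = i then v else \<zero>\<^bsub>sp X\<^esub>"] simp: linear_closed[OF linear_res])
  qed
  have "W \<noteq> {\<zero>\<^bsub>sp X\<^esub>}" using nontrivial resW by (auto simp: nontrivial_residue_def)
  then have "W = carrier (sp X)"
    using invariant_subspace[OF W irrW] resW subspaceD(1)[OF W] by blast
  then show ?thesis using v by (auto simp: W_def)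
qed

end

section \<open>Realizations of the middle Laplace transform\<close>

text \<open>
  \<open>Y\<close> models the space of tuples \<open>(A\<^sub>i v\<^sub>i)\<close>, with components \<open>\<pi> i\<close>. The list \<open>cs\<close> contains the
  eigenvalues of its \<open>dx\<close>-term: \<open>cs = - as\<close> for \<open>mid_laplace\<close> and \<open>cs = as\<close> for
  \<open>inv_mid_laplace\<close>.
\<close>

locale realization = X: eigen_system es X
  for es :: "complex list" and X :: "'v system" +
  fixes cs :: "complex list" and Y :: "'w system" and \<pi> :: "nat \<Rightarrow> 'w \<Rightarrow> 'v"
  assumes distinct_cs: "distinct cs"
    and linear_res: "\<And>i. i < length cs \<Longrightarrow> is_linear (sp X) (sp X) (res X i)"
    and cspace_Y: "cspace (sp Y)"
    and linear_proj: "\<And>i. i < length cs \<Longrightarrow> is_linear (sp Y) (sp X) (\<pi> i)"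
    and joint_inj: "\<And>y. y \<in> carrier (sp Y) \<Longrightarrow> (\<And>i. i < length cs \<Longrightarrow> \<pi> i y = \<zero>\<^bsub>sp X\<^esub>) \<Longrightarrow>
      y = \<zero>\<^bsub>sp Y\<^esub>"
    and proj_image: "\<And>i y. i < length cs \<Longrightarrow> y \<in> carrier (sp Y) \<Longrightarrow>
      \<exists>x\<in>carrier (sp X). \<pi> i y = res X i x"
    and lift: "\<And>x. (\<And>i. i < length cs \<Longrightarrow> x i \<in> carrier (sp X)) \<Longrightarrow>
      \<exists>y\<in>carrier (sp Y). \<forall>i<length cs. \<pi> i y = res X i (x i)"
    and irr_closed: "\<And>y. y \<in> carrier (sp Y) \<Longrightarrow> irr Y y \<in> carrier (sp Y)"
    and proj_irr: "\<And>i y. i < length cs \<Longrightarrow> y \<in> carrier (sp Y) \<Longrightarrow>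
      \<pi> i (irr Y y) = (cs ! i) \<odot>\<^bsub>sp X\<^esub> \<pi> i y"
    and res_closed: "\<And>j y. j < length es \<Longrightarrow> y \<in> carrier (sp Y) \<Longrightarrow> res Y j y \<in> carrier (sp Y)"
    and proj_res: "\<And>i j y. i < length cs \<Longrightarrow> j < length es \<Longrightarrow> y \<in> carrier (sp Y) \<Longrightarrow>
      \<pi> i (res Y j y) =
        \<ominus>\<^bsub>sp X\<^esub> res X i (eigenproj es X j (\<Oplus>\<^bsub>sp X\<^esub>k\<in>{..<length cs}. \<pi> k y))"
begin

sublocale Y: cspace "sp Y" by (rule cspace_Y)

lemmas proj = is_linearD[OF linear_proj]
  and resX = is_linearD[OF linear_res]

lemma joint_eq:
  assumes y: "y \<in> carrier (sp Y)" and z: "z \<in> carrier (sp Y)"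
    and eq: "\<And>i. i < length cs \<Longrightarrow> \<pi> i y = \<pi> i z"
  shows "y = z"
proof -
  have "\<pi> i (y \<oplus>\<^bsub>sp Y\<^esub> (- 1) \<odot>\<^bsub>sp Y\<^esub> z) = \<zero>\<^bsub>sp X\<^esub>" if "i < length cs" for i
    using that y z eq by (simp add: proj)
  then have "y \<oplus>\<^bsub>sp Y\<^esub> (- 1) \<odot>\<^bsub>sp Y\<^esub> z = \<zero>\<^bsub>sp Y\<^esub>" using y z by (intro joint_inj) auto
  then show ?thesis using Y.eq_if_diff_zero y z by blast
qed

text \<open>On the tuple \<open>(A_k v_k)\<close> this is the vector \<open>\<Sum>k. A_k v_k\<close>
  to which \<open>B_op\<close> applies the eigenprojection; every residue of \<open>Y\<close>
  factors through it.\<close>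

definition total :: "'w \<Rightarrow> 'v" where
  "total y = (\<Oplus>\<^bsub>sp X\<^esub>k\<in>{..<length cs}. \<pi> k y)"

lemma linear_total: "is_linear (sp Y) (sp X) total"
proof (rule is_linearI)
  fix c y assume y: "y \<in> carrier (sp Y)"
  have "total (c \<odot>\<^bsub>sp Y\<^esub> y) = (\<Oplus>\<^bsub>sp X\<^esub>k\<in>{..<length cs}. c \<odot>\<^bsub>sp X\<^esub> \<pi> k y)"
    unfolding total_def using y by (intro X.finsum_eqI) (auto simp: proj)
  also have "\<dots> = c \<odot>\<^bsub>sp X\<^esub> total y"
    unfolding total_def using y by (intro X.smult_finsum[symmetric]) (auto simp: proj)
  finally show "total (c \<odot>\<^bsub>sp Y\<^esub> y) = c \<odot>\<^bsub>sp X\<^esub> total y" .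
next
  fix y z assume yz: "y \<in> carrier (sp Y)" "z \<in> carrier (sp Y)"
  have "total (y \<oplus>\<^bsub>sp Y\<^esub> z) = (\<Oplus>\<^bsub>sp X\<^esub>k\<in>{..<length cs}. \<pi> k y \<oplus>\<^bsub>sp X\<^esub> \<pi> k z)"
    unfolding total_def using yz by (intro X.finsum_eqI) (auto simp: proj)
  also have "\<dots> = total y \<oplus>\<^bsub>sp X\<^esub> total z"
    unfolding total_def using yz by (intro X.finsum_add) (auto simp: proj)
  finally show "total (y \<oplus>\<^bsub>sp Y\<^esub> z) = total y \<oplus>\<^bsub>sp X\<^esub> total z" .
qed (auto simp: total_def proj X.cspace_axioms Y.cspace_axioms)

lemmas tot = is_linearD[OF linear_total]

lemma proj_res_total:
  "i < length cs \<Longrightarrow> j < length es \<Longrightarrow> y \<in> carrier (sp Y) \<Longrightarrow>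
     \<pi> i (res Y j y) = \<ominus>\<^bsub>sp X\<^esub> res X i (eigenproj es X j (total y))"
  by (simp add: proj_res total_def)

lemma linear_irr_Y: "is_linear (sp Y) (sp Y) (irr Y)"
  by (rule is_linearI)
    (auto intro!: joint_eq simp: Y.cspace_axioms irr_closed proj proj_irr X.smult_add_right mult.commute)

lemma linear_res_Y:
  assumes j: "j < length es"
  shows "is_linear (sp Y) (sp Y) (res Y j)"
proof (rule is_linearI)
  note E = is_linearD[OF X.linear_eigenproj[OF j]]
  show "res Y j (y \<oplus>\<^bsub>sp Y\<^esub> z) = res Y j y \<oplus>\<^bsub>sp Y\<^esub> res Y j z"
    if "y \<in> carrier (sp Y)" "z \<in> carrier (sp Y)" for y z
    using that j
    by (intro joint_eq) (auto simp: res_closed proj proj_res_total tot E resX X.minus_add)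
  show "res Y j (c \<odot>\<^bsub>sp Y\<^esub> y) = c \<odot>\<^bsub>sp Y\<^esub> res Y j y" if "y \<in> carrier (sp Y)" for c y
    using that j
    by (intro joint_eq) (auto simp: res_closed proj proj_res_total tot E resX X.smult_neg)
qed (use j in \<open>auto simp: Y.cspace_axioms res_closed\<close>)

lemma linear_system_Y: "linear_system (length es) Y"
  using linear_irr_Y linear_res_Y by (simp add: linear_system_def)

lemma ex_component:
  assumes y: "y \<in> carrier (sp Y)" and i: "i < length cs"
  shows "\<exists>z\<in>carrier (sp Y). \<forall>m<length cs. \<pi> m z = (if m = i then \<pi> i y else \<zero>\<^bsub>sp X\<^esub>)"
proof -
  obtain x where "x \<in> carrier (sp X)" "\<pi> i y = res X i x" using proj_image[OF i y] by blast
  then show ?thesis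
    using lift[of "\<lambda>m. if m = i then x else \<zero>\<^bsub>sp X\<^esub>"] by (fastforce simp: resX)
qed

text \<open>The tuple that keeps only entry \<open>i\<close> of \<open>y\<close>. Since the
  \<open>dx\<close>-term of \<open>Y\<close> acts on entry \<open>i\<close> as
  \<open>cs ! i\<close>, these tuples are the eigenvector decomposition of \<open>y\<close>.\<close>

definition component :: "nat \<Rightarrow> 'w \<Rightarrow> 'w" where
  "component i y = (SOME z. z \<in> carrier (sp Y) \<and>
     (\<forall>m<length cs. \<pi> m z = (if m = i then \<pi> i y else \<zero>\<^bsub>sp X\<^esub>)))"

lemma component:
  assumes "y \<in> carrier (sp Y)" "i < length cs"
  shows "component i y \<in> carrier (sp Y)"
    and "m < length cs \<Longrightarrow> \<pi> m (component i y) = (if m = i then \<pi> i y else \<zero>\<^bsub>sp X\<^esub>)"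
  using someI_ex[of "\<lambda>z. z \<in> carrier (sp Y) \<and> (\<forall>m<length cs. \<pi> m z = (if m = i then \<pi> i y else \<zero>\<^bsub>sp X\<^esub>))"]
    ex_component[OF assms] unfolding component_def by blast+

lemma eigen_family_component:
  assumes y: "y \<in> carrier (sp Y)"
  shows "eigen_family cs Y (\<lambda>i. component i y) y"
proof -
  have "irr Y (component i y) = (cs ! i) \<odot>\<^bsub>sp Y\<^esub> component i y" if i: "i < length cs" for i
    by (rule joint_eq) (use component[OF y i] in \<open>simp_all add: irr_closed proj_irr proj\<close>)
  moreover have "(\<Oplus>\<^bsub>sp Y\<^esub>i\<in>{..<length cs}. component i y) = y"
  proof (rule joint_eq)
    fix m assume m: "m < length cs"
    have "\<pi> m (\<Oplus>\<^bsub>sp Y\<^esub>i\<in>{..<length cs}. component i y) =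
        (\<Oplus>\<^bsub>sp X\<^esub>i\<in>{..<length cs}. \<pi> m (component i y))"
      using component(1)[OF y] by (intro linear_finsum[OF linear_proj[OF m]]) auto
    also have "\<dots> = \<pi> m y"
      using component(2)[OF y] m y by (intro X.finsum_delta[of m]) (auto simp: proj)
    finally show "\<pi> m (\<Oplus>\<^bsub>sp Y\<^esub>i\<in>{..<length cs}. component i y) = \<pi> m y" .
  qed (use component(1)[OF y] y in auto)
  ultimately show ?thesis using component(1)[OF y] by (simp add: eigen_family_def)
qed

lemma eigen_system_Y: "eigen_system cs Y"
  using distinct_cs linear_irr_Y eigen_family_component by (intro eigen_system.intro) auto

lemma proj_eigenproj:
  assumes "y \<in> carrier (sp Y)" "i < length cs" "m < length cs"
  shows "\<pi> m (eigenproj cs Y i y) = (if m = i then \<pi> i y else \<zero>\<^bsub>sp X\<^esub>)"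
  using eigen_system.eigenproj_eq[OF eigen_system_Y eigen_family_component] component(2) assms by simp

text \<open>Generators of \<open>Y\<close> are the tuples with \<open>A_i g\<close> in entry
  \<open>i\<close> and zero elsewhere, for \<open>g\<close> in a finite generating set of
  \<open>X\<close>. Since \<open>lift\<close> only asserts existence, the dependence on
  \<open>g\<close> is handled by the relation \<open>lifts\<close>: the \<open>x\<close> whose lift
  lies in the span form a subspace containing all \<open>g\<close>.\<close>

lemma fin_dim_Y:
  assumes "vectorspace.fin_dim CC (sp X)"
  shows "vectorspace.fin_dim CC (sp Y)"
proof -
  let ?span = "LinearCombinations.module.span CC (sp Y)"
  obtain G where G: "finite G" "G \<subseteq> carrier (sp X)"
    "LinearCombinations.module.span CC (sp X) G = carrier (sp X)"
    using assms X.fin_dim_iff by blast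
  define lifts where "lifts i x y \<longleftrightarrow> y \<in> carrier (sp Y) \<and>
    (\<forall>m<length cs. \<pi> m y = (if m = i then res X i x else \<zero>\<^bsub>sp X\<^esub>))" for i x y
  have ex: "\<exists>y. lifts i x y" if "x \<in> carrier (sp X)" "i < length cs" for i x
    using lift[of "\<lambda>m. if m = i then x else \<zero>\<^bsub>sp X\<^esub>"] that by (fastforce simp: resX lifts_def)
  have unique: "y = z" if "lifts i x y" "lifts i x z" for i x y z
    using that by (intro joint_eq) (auto simp: lifts_def)
  define \<tau> where "\<tau> = (\<lambda>(i, x). SOME y. lifts i x y)"
  have \<tau>: "lifts i x (\<tau> (i, x))" if "x \<in> carrier (sp X)" "i < length cs" for i x
    using someI_ex[OF ex[OF that]] by (simp add: \<tau>_def)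
  define H where "H = \<tau> ` ({..<length cs} \<times> G)"
  have H: "finite H" "H \<subseteq> carrier (sp Y)" using G(1,2) \<tau> by (auto simp: H_def lifts_def)
  note spanH = Y.subspaceD[OF Y.span_subspace[OF H(2)]]
  have in_span: "y \<in> ?span H" if i: "i < length cs" and xy: "x \<in> carrier (sp X)" "lifts i x y" for i x y
  proof -
    define W where "W = {x \<in> carrier (sp X). \<exists>y\<in>?span H. lifts i x y}"
    have "VectorSpace.subspace CC W (sp X)"
    proof (rule X.subspaceI)
      show "W \<subseteq> carrier (sp X)" by (auto simp: W_def)
      have "lifts i \<zero>\<^bsub>sp X\<^esub> \<zero>\<^bsub>sp Y\<^esub>" using i by (simp add: lifts_def proj resX)
      then show "\<zero>\<^bsub>sp X\<^esub> \<in> W" using spanH(2) by (auto simp: W_def)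
    next
      fix v w assume "v \<in> W" "w \<in> W"
      then obtain y z where yz: "v \<in> carrier (sp X)" "y \<in> ?span H" "lifts i v y"
        "w \<in> carrier (sp X)" "z \<in> ?span H" "lifts i w z" by (auto simp: W_def)
      then have "lifts i (v \<oplus>\<^bsub>sp X\<^esub> w) (y \<oplus>\<^bsub>sp Y\<^esub> z)"
        using i by (auto simp: lifts_def proj resX)
      then show "v \<oplus>\<^bsub>sp X\<^esub> w \<in> W" using yz spanH(3) by (auto simp: W_def)
    next
      fix c v assume "v \<in> W"
      then obtain y where yz: "v \<in> carrier (sp X)" "y \<in> ?span H" "lifts i v y" by (auto simp: W_def)
      then have "lifts i (c \<odot>\<^bsub>sp X\<^esub> v) (c \<odot>\<^bsub>sp Y\<^esub> y)"
        using i by (auto simp: lifts_def proj resX)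
      then show "c \<odot>\<^bsub>sp X\<^esub> v \<in> W" using yz spanH(4) by (auto simp: W_def)
    qed
    moreover have "G \<subseteq> W"
    proof
      fix g assume g: "g \<in> G"
      then have "\<tau> (i, g) \<in> ?span H" using Y.subset_span[OF H(2)] i by (auto simp: H_def)
      then show "g \<in> W" using \<tau>[of g i] g G(2) i by (auto simp: W_def)
    qed
    ultimately have "carrier (sp X) \<subseteq> W" using X.span_subset_subspace G(3) by metis
    then obtain z where "z \<in> ?span H" "lifts i x z" using xy(1) by (auto simp: W_def)
    then show ?thesis using unique xy(2) by blast
  qed
  have "y \<in> ?span H" if y: "y \<in> carrier (sp Y)" for y
  proof -
    have "component i y \<in> ?span H" if i: "i < length cs" for i
    proof -
      obtain x where "x \<in> carrier (sp X)" "\<pi> i y = res X i x" using proj_image[OF i y] by blast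
      then show ?thesis
        using component[OF y i] by (intro in_span[OF i, of x]) (auto simp: lifts_def)
    qed
    then have "(\<Oplus>\<^bsub>sp Y\<^esub>i\<in>{..<length cs}. component i y) \<in> ?span H"
      by (intro Y.subspace_finsum[OF Y.span_subspace[OF H(2)]]) auto
    then show ?thesis using eigen_family_component[OF y] by (simp add: eigen_family_def)
  qed
  then have "?span H = carrier (sp Y)" using spanH(1) by blast
  then show ?thesis using H Y.fin_dim_iff by blast
qed

lemma in_P_Y:
  assumes "vectorspace.fin_dim CC (sp X)" "length as = length es"
  shows "in_P as cs Y"
  using eigen_system.in_PI[OF eigen_system_Y fin_dim_Y] linear_res_Y assms by simp

text \<open>This absorbs the choice of a basis: an equation obtained from a transform is isomorphic
  to it and so realizes the same source.\<close>

lemma realization_iso_target: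
  assumes iso: "iso_systems (length es) Y Z"
  shows "\<exists>\<rho>. realization es X cs Z \<rho>"
proof -
  obtain f g where fg: "morphism (length es) Y Z f" "morphism (length es) Z Y g"
    "\<And>v. v \<in> carrier (sp Y) \<Longrightarrow> g (f v) = v" "\<And>w. w \<in> carrier (sp Z) \<Longrightarrow> f (g w) = w"
    using iso unfolding iso_systems_def by blast
  note linZ = linear_systemD[OF linear_system_iso[OF iso linear_system_Y]]
  note f = is_linearD[OF morphismD(1)[OF fg(1)]] and g = is_linearD[OF morphismD(1)[OF fg(2)]]
  have "realization es X cs Z (\<lambda>i z. \<pi> i (g z))"
  proof (intro realization.intro realization_axioms.intro)
    show "eigen_system es X" by (rule X.eigen_system_axioms)
    show "is_linear (sp Z) (sp X) (\<lambda>z. \<pi> i (g z))" if "i < length cs" for i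
      using linear_compose[OF morphismD(1)[OF fg(2)] linear_proj[OF that]] .
    show "z = \<zero>\<^bsub>sp Z\<^esub>" if "z \<in> carrier (sp Z)" "\<And>i. i < length cs \<Longrightarrow> \<pi> i (g z) = \<zero>\<^bsub>sp X\<^esub>" for z
      using joint_inj[of "g z"] that g(1) fg(4)[of z] f(4) by simp
    show "\<exists>x\<in>carrier (sp X). \<pi> i (g z) = res X i x" if "i < length cs" "z \<in> carrier (sp Z)" for i z
      using proj_image that g(1) by blast
    show "\<exists>z\<in>carrier (sp Z). \<forall>i<length cs. \<pi> i (g z) = res X i (x i)"
      if x: "\<And>i. i < length cs \<Longrightarrow> x i \<in> carrier (sp X)" for x
    proof -
      obtain y where "y \<in> carrier (sp Y)" "\<forall>i<length cs. \<pi> i y = res X i (x i)"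
        using lift[of x] x by blast
      then show ?thesis using f(1)[of y] fg(3)[of y] by (intro bexI[of _ "f y"]) simp_all
    qed
    show "\<pi> i (g (irr Z z)) = (cs ! i) \<odot>\<^bsub>sp X\<^esub> \<pi> i (g z)"
      if "i < length cs" "z \<in> carrier (sp Z)" for i z
      using morphismD(2)[OF fg(2) that(2), symmetric] proj_irr that g(1) by simp
    show "\<pi> i (g (res Z j z)) =
        \<ominus>\<^bsub>sp X\<^esub> res X i (eigenproj es X j (\<Oplus>\<^bsub>sp X\<^esub>k\<in>{..<length cs}. \<pi> k (g z)))"
      if "i < length cs" "j < length es" "z \<in> carrier (sp Z)" for i j z
      using morphismD(3)[OF fg(2) that(2,3), symmetric] proj_res that g(1) by simp
    show "distinct cs" by (rule distinct_cs)
    show "is_linear (sp X) (sp X) (res X i)" if "i < length cs" for i using linear_res[OF that] .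
    show "cspace (sp Z)" by (rule linZ(1))
    show "irr Z z \<in> carrier (sp Z)" if "z \<in> carrier (sp Z)" for z
      using linear_closed[OF linZ(2) that] .
    show "res Z j z \<in> carrier (sp Z)" if "j < length es" "z \<in> carrier (sp Z)" for j z
      using linear_closed[OF linZ(3)[OF that(1)] that(2)] .
  qed
  then show ?thesis by blast
qed

text \<open>Two convolutions are compared by replacing the middle system of one by an isomorphic
  one, after which both realize the same system and \<open>realization_unique\<close>
  applies.\<close>

lemma realization_iso_source:
  assumes iso: "iso_systems (length cs) X X'"
  shows "\<exists>\<rho>. realization es X' cs Y \<rho>"
proof -
  obtain f g where fg: "morphism (length cs) X X' f" "morphism (length cs) X' X g"
    "\<And>v. v \<in> carrier (sp X) \<Longrightarrow> g (f v) = v" "\<And>w. w \<in> carrier (sp X') \<Longrightarrow> f (g w) = w"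
    using iso unfolding iso_systems_def by blast
  have linX: "linear_system (length cs) X"
    using X.linear_irr linear_res by (simp add: linear_system_def)
  note linX' = linear_systemD[OF linear_system_iso[OF iso linX]]
  note f = is_linearD[OF morphismD(1)[OF fg(1)]] and g = is_linearD[OF morphismD(1)[OF fg(2)]]
  interpret X': eigen_system es X' by (rule eigen_system_iso[OF iso X.eigen_system_axioms linX])
  \<comment> \<open>An isomorphism carries the eigenvector decomposition of \<open>v\<close> to one
    of \<open>f v\<close>; uniqueness of decompositions does the rest.\<close>
  have E: "eigenproj es X' j (f v) = f (eigenproj es X j v)" if "j < length es" "v \<in> carrier (sp X)" for j v
  proof -
    have "f v = f (\<Oplus>\<^bsub>sp X\<^esub>k\<in>{..<length es}. eigenproj es X k v)"
      using that by (simp add: X.sum_eigenproj)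
    also have "\<dots> = (\<Oplus>\<^bsub>sp X'\<^esub>k\<in>{..<length es}. f (eigenproj es X k v))"
      using that by (intro linear_finsum[OF morphismD(1)[OF fg(1)]]) auto
    finally have "eigen_family es X' (\<lambda>k. f (eigenproj es X k v)) (f v)"
      using that f morphismD(2)[OF fg(1)] by (auto simp: eigen_family_def X.irr_eigenproj)
    then show ?thesis using X'.eigenproj_eq that(1) by blast
  qed
  have "realization es X' cs Y (\<lambda>i y. f (\<pi> i y))"
  proof (intro realization.intro realization_axioms.intro)
    show "eigen_system es X'" by (rule X'.eigen_system_axioms)
    show "is_linear (sp Y) (sp X') (\<lambda>y. f (\<pi> i y))" if "i < length cs" for i
      using linear_compose[OF linear_proj[OF that] morphismD(1)[OF fg(1)]] .
    show "y = \<zero>\<^bsub>sp Y\<^esub>" if "y \<in> carrier (sp Y)" "\<And>i. i < length cs \<Longrightarrow> f (\<pi> i y) = \<zero>\<^bsub>sp X'\<^esub>" for y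
      using that fg(3) g(4) by (intro joint_inj) (metis proj(1))+
    show "\<exists>x\<in>carrier (sp X'). f (\<pi> i y) = res X' i x" if "i < length cs" "y \<in> carrier (sp Y)" for i y
      using proj_image[OF that] f(1) morphismD(3)[OF fg(1) that(1)] by metis
    show "\<exists>y\<in>carrier (sp Y). \<forall>i<length cs. f (\<pi> i y) = res X' i (x i)"
      if x: "\<And>i. i < length cs \<Longrightarrow> x i \<in> carrier (sp X')" for x
    proof -
      obtain y where "y \<in> carrier (sp Y)" "\<forall>i<length cs. \<pi> i y = res X i (g (x i))"
        using lift[of "\<lambda>i. g (x i)"] x g(1) by blast
      then show ?thesis using morphismD(3)[OF fg(1)] x g(1) fg(4) by (metis (full_types))
    qed
    show "f (\<pi> i (irr Y y)) = (cs ! i) \<odot>\<^bsub>sp X'\<^esub> f (\<pi> i y)"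
      if "i < length cs" "y \<in> carrier (sp Y)" for i y
      using proj_irr that proj f by simp
    show "f (\<pi> i (res Y j y)) =
        \<ominus>\<^bsub>sp X'\<^esub> res X' i (eigenproj es X' j (\<Oplus>\<^bsub>sp X'\<^esub>k\<in>{..<length cs}. f (\<pi> k y)))"
      if "i < length cs" "j < length es" "y \<in> carrier (sp Y)" for i j y
    proof -
      have "(\<Oplus>\<^bsub>sp X'\<^esub>k\<in>{..<length cs}. f (\<pi> k y)) = f (total y)"
        unfolding total_def using that
        by (intro linear_finsum[OF morphismD(1)[OF fg(1)], symmetric]) (auto simp: proj)
      then show ?thesis
        using that morphismD(3)[OF fg(1)] by (simp add: proj_res_total E f tot resX)
    qed
    show "distinct cs" by (rule distinct_cs)
    show "is_linear (sp X') (sp X') (res X' i)" if "i < length cs" for i using linX'(3)[OF that] .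
    show "cspace (sp Y)" by (rule cspace_Y)
    show "irr Y y \<in> carrier (sp Y)" if "y \<in> carrier (sp Y)" for y by (rule irr_closed[OF that])
    show "res Y j y \<in> carrier (sp Y)" if "j < length es" "y \<in> carrier (sp Y)" for j y
      by (rule res_closed[OF that])
  qed
  then show ?thesis by blast
qed

text \<open>Vectors with equal components correspond. In both spaces the component tuples are
  exactly the tuples with entry \<open>i\<close> in the image of \<open>A_i\<close>, and the
  components determine the vector and the action of all operators.\<close>

lemma realization_unique:
  assumes "realization es X cs Z \<rho>"
  shows "iso_systems (length es) Y Z"
proof -
  interpret Z: realization es X cs Z \<rho> by fact
  have sums: "Z.total z = total y" if "y \<in> carrier (sp Y)" "\<forall>i<length cs. \<pi> i y = \<rho> i z" for y z
    unfolding Z.total_def total_def using that by (intro X.finsum_eqI) (metis lessThan_iff proj(1))+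
  show ?thesis
  proof (rule iso_systems_of_relation[where R = "\<lambda>y z. \<forall>i<length cs. \<pi> i y = \<rho> i z",
        OF linear_system_Y Z.linear_system_Y])
    fix y assume y: "y \<in> carrier (sp Y)"
    obtain x where x: "\<And>i. i < length cs \<Longrightarrow> x i \<in> carrier (sp X) \<and> \<pi> i y = res X i (x i)"
      using proj_image[OF _ y] by metis
    then obtain z where "z \<in> carrier (sp Z)" "\<forall>i<length cs. \<rho> i z = res X i (x i)"
      using Z.lift[of x] by blast
    then show "\<exists>z\<in>carrier (sp Z). \<forall>i<length cs. \<pi> i y = \<rho> i z"
      using x by (intro bexI[of _ z]) simp_all
  next
    fix z assume z: "z \<in> carrier (sp Z)"
    obtain x where x: "\<And>i. i < length cs \<Longrightarrow> x i \<in> carrier (sp X) \<and> \<rho> i z = res X i (x i)"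
      using Z.proj_image[OF _ z] by metis
    then obtain y where "y \<in> carrier (sp Y)" "\<forall>i<length cs. \<pi> i y = res X i (x i)"
      using lift[of x] by blast
    then show "\<exists>y\<in>carrier (sp Y). \<forall>i<length cs. \<pi> i y = \<rho> i z"
      using x by (intro bexI[of _ y]) simp_all
  qed (auto simp: proj Z.proj proj_irr Z.proj_irr proj_res_total Z.proj_res_total sums
      intro: joint_inj Z.joint_inj)
qed

end

section \<open>Irreducibility and inversion\<close>

text \<open>Lagrange interpolation in the \<open>dx\<close>-term, one eigenvalue at a time.\<close>

lemma (in eigen_system) invariant_eigenproj:
  assumes W: "VectorSpace.subspace CC W (sp X)" and inv: "\<And>w. w \<in> W \<Longrightarrow> irr X w \<in> W"
    and w: "w \<in> W" and k: "k < length es"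
  shows "eigenproj es X k w \<in> W"
proof -
  note sub = subspaceD[OF W]
  have "\<exists>w'\<in>W. eigenproj es X k w' = eigenproj es X k w \<and>
      (\<forall>m\<in>J. eigenproj es X m w' = \<zero>\<^bsub>sp X\<^esub>)" if "finite J" "J \<subseteq> {..<length es} - {k}" for J
    using that
  proof (induction J rule: finite_induct)
    case empty
    then show ?case using w by blast
  next
    case (insert m J)
    then obtain u where u: "u \<in> W" "eigenproj es X k u = eigenproj es X k w"
      "\<forall>m\<in>J. eigenproj es X m u = \<zero>\<^bsub>sp X\<^esub>" by auto
    have m: "m < length es" "es ! k - es ! m \<noteq> 0"
      using insert.prems k distinct_es by (auto simp: nth_eq_iff_index_eq)
    \<comment> \<open>One Lagrange factor, normalised to keep component \<open>k\<close>. It kills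
      component \<open>m\<close> and preserves the components that already vanish.\<close>
    define u' where "u' = inverse (es ! k - es ! m) \<odot>\<^bsub>sp X\<^esub> (irr X u \<oplus>\<^bsub>sp X\<^esub> (- (es ! m)) \<odot>\<^bsub>sp X\<^esub> u)"
    have carr: "u \<in> carrier (sp X)" "irr X u \<in> carrier (sp X)" using u(1) inv sub(1) by auto
    have "u' \<in> W" unfolding u'_def using u(1) inv sub(3,4) by blast
    moreover have E: "eigenproj es X l u' =
        (inverse (es ! k - es ! m) * (es ! l - es ! m)) \<odot>\<^bsub>sp X\<^esub> eigenproj es X l u"
      if "l < length es" for l
    proof -
      note lin = is_linearD[OF linear_eigenproj[OF that]]
      have "eigenproj es X l u' = inverse (es ! k - es ! m) \<odot>\<^bsub>sp X\<^esub>
          ((es ! l) \<odot>\<^bsub>sp X\<^esub> eigenproj es X l u \<oplus>\<^bsub>sp X\<^esub> (- (es ! m)) \<odot>\<^bsub>sp X\<^esub> eigenproj es X l u)"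
        unfolding u'_def using carr that by (simp add: lin eigenproj_irr)
      also have "\<dots> = (inverse (es ! k - es ! m) * (es ! l - es ! m)) \<odot>\<^bsub>sp X\<^esub> eigenproj es X l u"
        using carr that by (simp add: smult_add_left[symmetric])
      finally show ?thesis .
    qed
    moreover have "eigenproj es X k u' = eigenproj es X k w"
      using E[OF k] m(2) eigenproj_closed[OF carr(1) k] u(2) by simp
    moreover have "eigenproj es X l u' = \<zero>\<^bsub>sp X\<^esub>" if "l \<in> insert m J" for l
    proof -
      have "l < length es" using that insert.prems by auto
      then show ?thesis using E[of l] u(3) that carr(1) by auto
    qed
    ultimately show ?case by blast
  qed
  from this[of "{..<length es} - {k}"] obtain u where u: "u \<in> W"
    "eigenproj es X k u = eigenproj es X k w"
    "\<forall>m\<in>{..<length es} - {k}. eigenproj es X m u = \<zero>\<^bsub>sp X\<^esub>" by auto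
  have "u \<in> carrier (sp X)" using u(1) sub(1) by auto
  then have "(\<Oplus>\<^bsub>sp X\<^esub>m\<in>{..<length es}. eigenproj es X m u) = eigenproj es X k u"
    using u(3) k by (intro finsum_delta[of k]) auto
  then show ?thesis using u(1,2) sum_eigenproj[OF \<open>u \<in> carrier (sp X)\<close>] by simp
qed

context realization
begin

lemma total_eigenproj:
  assumes y: "y \<in> carrier (sp Y)" and i: "i < length cs"
  shows "total (eigenproj cs Y i y) = \<pi> i y"
  unfolding total_def
  using assms by (intro X.finsum_delta[of i]) (auto simp: proj_eigenproj proj)

text \<open>The tuples \<open>y j\<close> can be chosen independently for different \<open>j\<close>
  and still be recovered, up to the projections, from one vector of \<open>X\<close>. This vector is
  the preimage in the proof that the inversion map is surjective.\<close>

lemma sum_E_total: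
  assumes "\<And>j. j < length es \<Longrightarrow> y j \<in> carrier (sp Y)" "j < length es"
  shows "eigenproj es X j (\<Oplus>\<^bsub>sp X\<^esub>k\<in>{..<length es}. eigenproj es X k (total (y k))) =
    eigenproj es X j (total (y j))"
proof -
  have "eigen_family es X (\<lambda>k. eigenproj es X k (total (y k)))
      (\<Oplus>\<^bsub>sp X\<^esub>k\<in>{..<length es}. eigenproj es X k (total (y k)))"
    using assms(1) tot by (auto simp: eigen_family_def X.irr_eigenproj)
  then show ?thesis using X.eigenproj_eq assms(2) by blast
qed

end

locale irreducible_realization =
  irreducible_system es X "length cs" + realization es X cs Y \<pi>
  for es :: "complex list" and X :: "'v system" and cs :: "complex list"
    and Y :: "'w system" and \<pi> :: "nat \<Rightarrow> 'w \<Rightarrow> 'v"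
begin

text \<open>The sums \<open>\<Sum>i. A_i x_i\<close> in \<open>eigenproj_image\<close> are exactly
  the totals of elements of \<open>Y\<close>.\<close>

lemma ex_eigenproj_total:
  assumes v: "v \<in> carrier (sp X)" and k: "k < length es"
  shows "\<exists>y\<in>carrier (sp Y). eigenproj es X k (total y) = eigenproj es X k v"
proof -
  obtain x where x: "\<forall>i<length cs. x i \<in> carrier (sp X)"
    "eigenproj es X k v = eigenproj es X k (\<Oplus>\<^bsub>sp X\<^esub>i\<in>{..<length cs}. res X i (x i))"
    using eigenproj_image[OF assms] by blast
  obtain y where y: "y \<in> carrier (sp Y)" "\<forall>i<length cs. \<pi> i y = res X i (x i)"
    using lift[of x] x(1) by blast
  have "total y = (\<Oplus>\<^bsub>sp X\<^esub>i\<in>{..<length cs}. res X i (x i))"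
    unfolding total_def using x y by (intro finsum_eqI) (auto simp: resX)
  then show ?thesis using x(2) y(1) by (intro bexI[of _ y]) simp_all
qed

text \<open>An invariant subspace \<open>N\<close> of \<open>Y\<close> gives the subspace
  \<open>W = \<Oplus>j. E_j (total N)\<close> of \<open>X\<close>. For \<open>v\<close> in
  \<open>W\<close>, the tuple with \<open>A_i v\<close> in entry \<open>i\<close> and zero elsewhere
  lies in \<open>N\<close>, and its total is \<open>A_i v\<close>; hence \<open>W\<close> is
  invariant. If \<open>W = 0\<close>, every component of an element of \<open>N\<close> vanishes; if
  \<open>W\<close> is everything, \<open>N\<close> contains all tuples with a single nonzero entry
  and so is everything.\<close>

lemma irreducible_Y: "irreducible_sys (length es) Y"
  unfolding irreducible_sys_def
proof (intro conjI allI impI)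
  obtain i v where iv: "i < length cs" "v \<in> carrier (sp X)" "res X i v \<noteq> \<zero>\<^bsub>sp X\<^esub>"
    using nontrivial by (auto simp: nontrivial_residue_def)
  obtain y where "y \<in> carrier (sp Y)" "\<forall>i<length cs. \<pi> i y = res X i v"
    using lift[of "\<lambda>_. v"] iv by blast
  then show "carrier (sp Y) \<noteq> {\<zero>\<^bsub>sp Y\<^esub>}" using iv proj(4) by force
next
  fix N assume N: "VectorSpace.subspace CC N (sp Y)" and irrN: "irr Y ` N \<subseteq> N"
    and resN: "\<forall>j<length es. res Y j ` N \<subseteq> N"
  note sub = Y.subspaceD[OF N]
  have NY: "y \<in> carrier (sp Y)" if "y \<in> N" for y using sub(1) that by auto
  have comp: "eigenproj cs Y i y \<in> N" if "y \<in> N" "i < length cs" for i y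
    using eigen_system.invariant_eigenproj[OF eigen_system_Y N] irrN that by blast
  \<comment> \<open>The totals alone need not be stable under the \<open>dx\<close>-term of
    \<open>X\<close>; projecting them to each eigenspace separately repairs this.\<close>
  define W where "W = {v \<in> carrier (sp X). \<forall>j<length es. \<exists>y\<in>N. eigenproj es X j v = eigenproj es X j (total y)}"
  have W: "VectorSpace.subspace CC W (sp X)"
  proof (rule subspaceI)
    show "W \<subseteq> carrier (sp X)" by (auto simp: W_def)
    show "\<zero>\<^bsub>sp X\<^esub> \<in> W" using sub(2) tot(4) unfolding W_def by force
  next
    fix v w assume vw: "v \<in> W" "w \<in> W"
    show "v \<oplus>\<^bsub>sp X\<^esub> w \<in> W"
      unfolding W_def
    proof (intro CollectI conjI allI impI)
      fix j assume j: "j < length es"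
      obtain y z where yz: "y \<in> N" "eigenproj es X j v = eigenproj es X j (total y)"
        "z \<in> N" "eigenproj es X j w = eigenproj es X j (total z)"
        using vw j unfolding W_def by blast
      then have "eigenproj es X j (v \<oplus>\<^bsub>sp X\<^esub> w) = eigenproj es X j (total (y \<oplus>\<^bsub>sp Y\<^esub> z))"
        using vw NY by (simp add: W_def tot is_linearD[OF linear_eigenproj[OF j]])
      then show "\<exists>y\<in>N. eigenproj es X j (v \<oplus>\<^bsub>sp X\<^esub> w) = eigenproj es X j (total y)"
        using sub(3) yz by blast
    qed (use vw in \<open>auto simp: W_def\<close>)
  next
    fix c v assume v: "v \<in> W"
    show "c \<odot>\<^bsub>sp X\<^esub> v \<in> W"
      unfolding W_def
    proof (intro CollectI conjI allI impI)
      fix j assume j: "j < length es"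
      obtain y where y: "y \<in> N" "eigenproj es X j v = eigenproj es X j (total y)"
        using v j unfolding W_def by blast
      then have "eigenproj es X j (c \<odot>\<^bsub>sp X\<^esub> v) = eigenproj es X j (total (c \<odot>\<^bsub>sp Y\<^esub> y))"
        using v NY by (simp add: W_def tot is_linearD[OF linear_eigenproj[OF j]])
      then show "\<exists>y\<in>N. eigenproj es X j (c \<odot>\<^bsub>sp X\<^esub> v) = eigenproj es X j (total y)"
        using sub(4) y by blast
    qed (use v in \<open>auto simp: W_def\<close>)
  qed
  have irrW: "irr X v \<in> W" if v: "v \<in> W" for v
    unfolding W_def
  proof (intro CollectI conjI allI impI)
    have vX: "v \<in> carrier (sp X)" using v by (simp add: W_def)
    then show "irr X v \<in> carrier (sp X)" using linear_closed[OF linear_irr] by blast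
    fix j assume j: "j < length es"
    then obtain y where y: "y \<in> N" "eigenproj es X j v = eigenproj es X j (total y)"
      using v unfolding W_def by blast
    then have "eigenproj es X j (irr X v) = eigenproj es X j (total ((es ! j) \<odot>\<^bsub>sp Y\<^esub> y))"
      using vX NY j by (simp add: eigenproj_irr tot is_linearD[OF linear_eigenproj[OF j]])
    then show "\<exists>y\<in>N. eigenproj es X j (irr X v) = eigenproj es X j (total y)"
      using sub(4) y by blast
  qed
  have totalW: "total y \<in> W" if "y \<in> N" for y
    using that NY tot(1) by (auto simp: W_def)
  have ex_N: "\<exists>y\<in>N. \<forall>m<length cs. \<pi> m y = (if m = i then res X i v else \<zero>\<^bsub>sp X\<^esub>)"
    if v: "v \<in> W" and i: "i < length cs" for i v
  proof -
    have vX: "v \<in> carrier (sp X)" using v by (simp add: W_def)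
    have "\<forall>j. \<exists>y. j < length es \<longrightarrow> y \<in> N \<and> eigenproj es X j v = eigenproj es X j (total y)"
      using v unfolding W_def by blast
    then obtain y where y: "\<And>j. j < length es \<Longrightarrow> y j \<in> N"
      "\<And>j. j < length es \<Longrightarrow> eigenproj es X j v = eigenproj es X j (total (y j))"
      by metis
    \<comment> \<open>Entry \<open>i\<close> of \<open>res Y j (y j)\<close> is
      \<open>- A_i E_j v\<close>. Negating and summing over \<open>j\<close> leaves
      \<open>A_i v\<close>, and the eigenprojection of \<open>Y\<close> then isolates entry
      \<open>i\<close> without leaving \<open>N\<close>.\<close>
    define n where "n = (\<Oplus>\<^bsub>sp Y\<^esub>j\<in>{..<length es}. (- 1) \<odot>\<^bsub>sp Y\<^esub> res Y j (y j))"
    have n: "n \<in> N"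
      unfolding n_def using y(1) resN by (intro Y.subspace_finsum[OF N]) (auto intro!: sub(4))
    have "\<pi> i n = (\<Oplus>\<^bsub>sp X\<^esub>j\<in>{..<length es}. \<pi> i ((- 1) \<odot>\<^bsub>sp Y\<^esub> res Y j (y j)))"
      unfolding n_def using y(1) NY res_closed by (intro linear_finsum[OF linear_proj[OF i]]) auto
    also have "\<dots> = (\<Oplus>\<^bsub>sp X\<^esub>j\<in>{..<length es}. res X i (eigenproj es X j v))"
      using y NY res_closed i vX
      by (intro finsum_eqI) (auto simp: proj proj_res_total resX neg_eq tot)
    also have "\<dots> = res X i (\<Oplus>\<^bsub>sp X\<^esub>j\<in>{..<length es}. eigenproj es X j v)"
      using vX by (intro linear_finsum[OF linear_res[OF i], symmetric]) auto
    also have "\<dots> = res X i v" using vX by (simp add: sum_eigenproj)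
    finally have "\<pi> i n = res X i v" .
    then show ?thesis
      using comp[OF n i] proj_eigenproj[OF NY[OF n] i] by (intro bexI[of _ "eigenproj cs Y i n"]) auto
  qed
  have resW: "res X i v \<in> W" if v: "v \<in> W" and i: "i < length cs" for i v
  proof -
    obtain y where y: "y \<in> N" "\<forall>m<length cs. \<pi> m y = (if m = i then res X i v else \<zero>\<^bsub>sp X\<^esub>)"
      using ex_N[OF v i] by blast
    have "v \<in> carrier (sp X)" using v by (simp add: W_def)
    then have "total y = res X i v"
      unfolding total_def using y i by (intro finsum_delta[of i]) (auto simp: resX)
    then show ?thesis using totalW[OF y(1)] by simp
  qed
  consider "W = {\<zero>\<^bsub>sp X\<^esub>}" | "W = carrier (sp X)"
    using invariant_subspace[OF W irrW resW] by blast
  then show "N = {\<zero>\<^bsub>sp Y\<^esub>} \<or> N = carrier (sp Y)"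
  proof cases
    case 1
    have "y = \<zero>\<^bsub>sp Y\<^esub>" if y: "y \<in> N" for y
    proof (rule joint_inj[OF NY[OF y]])
      fix i assume i: "i < length cs"
      have "total (eigenproj cs Y i y) \<in> W" using totalW comp[OF y i] by blast
      then show "\<pi> i y = \<zero>\<^bsub>sp X\<^esub>" using 1 total_eigenproj[OF NY[OF y] i] by simp
    qed
    then show ?thesis using sub(2) by blast
  next
    case 2
    have "y \<in> N" if y: "y \<in> carrier (sp Y)" for y
    proof -
      have "component i y \<in> N" if i: "i < length cs" for i
      proof -
        obtain x where x: "x \<in> carrier (sp X)" "\<pi> i y = res X i x" using proj_image[OF i y] by blast
        then obtain z where z: "z \<in> N" "\<forall>m<length cs. \<pi> m z = (if m = i then res X i x else \<zero>\<^bsub>sp X\<^esub>)"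
          using ex_N[of x i] i 2 by blast
        have "component i y = z"
          using component[OF y i] z NY x by (intro joint_eq) auto
        then show ?thesis using z by simp
      qed
      then have "(\<Oplus>\<^bsub>sp Y\<^esub>i\<in>{..<length cs}. component i y) \<in> N"
        by (intro Y.subspace_finsum[OF N]) auto
      then show ?thesis using eigen_family_component[OF y] by (simp add: eigen_family_def)
    qed
    then show ?thesis using sub(1) by blast
  qed
qed

text \<open>If \<open>A_i v\<close> is nonzero, so is some \<open>A_i E_k v\<close>. As
  \<open>E_k v\<close> is also \<open>E_k\<close> of a total, residue \<open>k\<close> of
  \<open>Y\<close> takes a nonzero value.\<close>

lemma nontrivial_Y: "nontrivial_residue (length es) Y"
proof -
  obtain i v where iv: "i < length cs" "v \<in> carrier (sp X)" "res X i v \<noteq> \<zero>\<^bsub>sp X\<^esub>"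
    using nontrivial by (auto simp: nontrivial_residue_def)
  have "res X i v = res X i (\<Oplus>\<^bsub>sp X\<^esub>k\<in>{..<length es}. eigenproj es X k v)"
    using iv by (simp add: sum_eigenproj)
  also have "\<dots> = (\<Oplus>\<^bsub>sp X\<^esub>k\<in>{..<length es}. res X i (eigenproj es X k v))"
    using iv by (intro linear_finsum[OF linear_res[OF iv(1)]]) auto
  finally obtain k where k: "k < length es" "res X i (eigenproj es X k v) \<noteq> \<zero>\<^bsub>sp X\<^esub>"
    using iv(3) finsum_all_zero[of "{..<length es}" "\<lambda>k. res X i (eigenproj es X k v)"] by auto
  obtain y where y: "y \<in> carrier (sp Y)" "eigenproj es X k (total y) = eigenproj es X k v"
    using ex_eigenproj_total iv(2) k(1) by blast
  have rX: "res X i (eigenproj es X k v) \<in> carrier (sp X)"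
    using iv k(1) by (auto simp: resX)
  have "\<pi> i (res Y k y) = \<ominus>\<^bsub>sp X\<^esub> res X i (eigenproj es X k v)"
    using y iv(1) k(1) by (simp add: proj_res_total)
  then have "\<pi> i (res Y k y) \<noteq> \<zero>\<^bsub>sp X\<^esub>"
    using k(2) neg_eq_zero[OF rX] by simp
  then have "res Y k y \<noteq> \<zero>\<^bsub>sp Y\<^esub>" using proj(4)[OF iv(1)] by metis
  then show ?thesis using y(1) k(1) by (auto simp: nontrivial_residue_def)
qed

lemma irreducible_system_Y: "irreducible_system cs Y (length es)"
  using eigen_system_Y irreducible_Y nontrivial_Y linear_res_Y
  by (intro irreducible_system.intro irreducible_system_axioms.intro)

text \<open>
  The isomorphism \<open>v \<mapsto> (- A\<^sub>i E\<^sub>j v)\<^sub>i\<^sub>j\<close> onto a realization \<open>Z\<close> of a realization \<open>Y\<close>: it is injective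
  because no eigenvector of the \<open>dx\<close>-term is killed by all residues, and surjective because
  \<open>E\<^sub>j\<close> maps the sum of the images of the residues onto its range.
\<close>

lemma realization_realization:
  assumes "realization cs Y es Z \<rho>"
  shows "iso_systems (length cs) X Z"
proof -
  interpret Z: realization cs Y es Z \<rho> by fact
  define R where "R v z \<longleftrightarrow>
    (\<forall>j<length es. \<forall>i<length cs. \<pi> i (\<rho> j z) = \<ominus>\<^bsub>sp X\<^esub> res X i (eigenproj es X j v))" for v z
  note E = is_linearD[OF linear_eigenproj]
  show ?thesis
  proof (rule iso_systems_of_relation[where R = R, OF linear_system Z.linear_system_Y])
    fix v assume v: "v \<in> carrier (sp X)"
    have "\<forall>j. \<exists>y. j < length es \<longrightarrow> y \<in> carrier (sp Y) \<and> eigenproj es X j (total y) = eigenproj es X j v"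
      using ex_eigenproj_total[OF v] by blast
    then obtain y where y: "\<And>j. j < length es \<Longrightarrow> y j \<in> carrier (sp Y)"
      "\<And>j. j < length es \<Longrightarrow> eigenproj es X j (total (y j)) = eigenproj es X j v" by metis
    obtain z where "z \<in> carrier (sp Z)" "\<forall>j<length es. \<rho> j z = res Y j (y j)"
      using Z.lift[of y] y(1) by blast
    then show "\<exists>z\<in>carrier (sp Z). R v z"
      using y by (intro bexI[of _ z]) (simp_all add: R_def proj_res_total)
  next
    fix z assume z: "z \<in> carrier (sp Z)"
    have "\<forall>j. \<exists>y. j < length es \<longrightarrow> y \<in> carrier (sp Y) \<and> \<rho> j z = res Y j y"
      using Z.proj_image[OF _ z] by blast
    then obtain y where y: "\<And>j. j < length es \<Longrightarrow> y j \<in> carrier (sp Y)"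
      "\<And>j. j < length es \<Longrightarrow> \<rho> j z = res Y j (y j)" by metis
    \<comment> \<open>By \<open>sum_E_total\<close> its projection \<open>E_j\<close> agrees with
      \<open>E_j (total (y j))\<close>, so \<open>- A_i E_j ?v\<close> is entry \<open>i\<close> of
      \<open>res Y j (y j)\<close>, that is, of \<open>\<rho> j z\<close>.\<close>
    let ?v = "\<Oplus>\<^bsub>sp X\<^esub>k\<in>{..<length es}. eigenproj es X k (total (y k))"
    have "?v \<in> carrier (sp X)" using y(1) tot(1) by auto
    moreover have "R ?v z"
      unfolding R_def
    proof (intro allI impI)
      fix j i assume "j < length es" "i < length cs"
      then show "\<pi> i (\<rho> j z) = \<ominus>\<^bsub>sp X\<^esub> res X i (eigenproj es X j ?v)"
        using y by (simp add: proj_res_total sum_E_total)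
    qed
    ultimately show "\<exists>v\<in>carrier (sp X). R v z" by blast
  next
    fix z assume z: "z \<in> carrier (sp Z)" and R: "R \<zero>\<^bsub>sp X\<^esub> z"
    show "z = \<zero>\<^bsub>sp Z\<^esub>"
    proof (rule Z.joint_inj[OF z])
      fix j assume j: "j < length es"
      show "\<rho> j z = \<zero>\<^bsub>sp Y\<^esub>"
        using R j z by (intro joint_inj) (auto simp: R_def E resX Z.proj)
    qed
  next
    fix v assume v: "v \<in> carrier (sp X)" and R: "R v \<zero>\<^bsub>sp Z\<^esub>"
    show "v = \<zero>\<^bsub>sp X\<^esub>"
    proof (rule eq_zero_if_eigenproj_zero[OF v])
      fix j assume j: "j < length es"
      have "res X i (eigenproj es X j v) = \<zero>\<^bsub>sp X\<^esub>" if i: "i < length cs" for i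
      proof -
        have rX: "res X i (eigenproj es X j v) \<in> carrier (sp X)" using v i j by (auto simp: resX)
        have "\<ominus>\<^bsub>sp X\<^esub> res X i (eigenproj es X j v) = \<zero>\<^bsub>sp X\<^esub>"
          using R i j unfolding R_def by (metis Z.proj(4) proj(4))
        then show ?thesis using neg_eq_zero[OF rX] by simp
      qed
      then show "eigenproj es X j v = \<zero>\<^bsub>sp X\<^esub>"
        using common_kernel[of "eigenproj es X j v" "es ! j"] irr_eigenproj[OF v j] v j by simp
    qed
  next
    show "R (v \<oplus>\<^bsub>sp X\<^esub> w) (y \<oplus>\<^bsub>sp Z\<^esub> z)"
      if "v \<in> carrier (sp X)" "w \<in> carrier (sp X)" "y \<in> carrier (sp Z)" "z \<in> carrier (sp Z)"
        "R v y" "R w z" for v w y z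
      using that by (simp add: R_def Z.proj proj E resX minus_add)
    show "R (c \<odot>\<^bsub>sp X\<^esub> v) (c \<odot>\<^bsub>sp Z\<^esub> y)"
      if "v \<in> carrier (sp X)" "y \<in> carrier (sp Z)" "R v y" for c v y
      using that by (simp add: R_def Z.proj proj E resX smult_neg)
    show "R (irr X v) (irr Z z)"
      if "v \<in> carrier (sp X)" "z \<in> carrier (sp Z)" "R v z" for v z
      using that by (simp add: R_def Z.proj Z.proj_irr proj eigenproj_irr resX smult_neg)
  next
    fix i v z assume i: "i < length cs" and v: "v \<in> carrier (sp X)" and z: "z \<in> carrier (sp Z)"
      and R: "R v z"
    \<comment> \<open>Summing the defining equations of \<open>R\<close> over \<open>j\<close>
      removes the eigenprojections and leaves \<open>- A_i v\<close>.\<close>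
    have "\<pi> i (Z.total z) = (\<Oplus>\<^bsub>sp X\<^esub>k\<in>{..<length es}. \<pi> i (\<rho> k z))"
      unfolding Z.total_def using z by (intro linear_finsum[OF linear_proj[OF i]]) (auto simp: Z.proj)
    also have "\<dots> = (\<Oplus>\<^bsub>sp X\<^esub>k\<in>{..<length es}. (- 1) \<odot>\<^bsub>sp X\<^esub> res X i (eigenproj es X k v))"
      using R i v by (intro finsum_eqI) (auto simp: R_def resX neg_eq)
    also have "\<dots> = (- 1) \<odot>\<^bsub>sp X\<^esub> (\<Oplus>\<^bsub>sp X\<^esub>k\<in>{..<length es}. res X i (eigenproj es X k v))"
      using i v by (intro smult_finsum[symmetric]) (auto simp: resX)
    also have "(\<Oplus>\<^bsub>sp X\<^esub>k\<in>{..<length es}. res X i (eigenproj es X k v)) =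
        res X i (\<Oplus>\<^bsub>sp X\<^esub>k\<in>{..<length es}. eigenproj es X k v)"
      using v by (intro linear_finsum[OF linear_res[OF i], symmetric]) auto
    also have "\<dots> = res X i v" using v by (simp add: sum_eigenproj)
    finally have pi_total: "\<pi> i (Z.total z) = (- 1) \<odot>\<^bsub>sp X\<^esub> res X i v" .
    show "R (res X i v) (res Z i z)"
      unfolding R_def
    proof (intro allI impI)
      fix j l assume j: "j < length es" and l: "l < length cs"
      have zY: "Z.total z \<in> carrier (sp Y)" using z Z.tot(1) by blast
      have e: "eigenproj cs Y i (Z.total z) \<in> carrier (sp Y)"
        using eigen_system.eigenproj_closed[OF eigen_system_Y zY i] .
      have A: "res X l (eigenproj es X j (res X i v)) \<in> carrier (sp X)"
        using v i j l by (auto simp: resX)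
      \<comment> \<open>Three signs meet: from the residue of \<open>Z\<close>, from the residue of
        \<open>Y\<close>, and from \<open>pi_total\<close>. Their product is the single sign in
        \<open>R\<close>.\<close>
      have "\<pi> l (\<rho> j (res Z i z)) = \<ominus>\<^bsub>sp X\<^esub> \<pi> l (res Y j (eigenproj cs Y i (Z.total z)))"
        using z i j l e by (simp add: Z.proj_res_total proj res_closed)
      also have "\<dots> = \<ominus>\<^bsub>sp X\<^esub> (\<ominus>\<^bsub>sp X\<^esub> res X l (eigenproj es X j (\<pi> i (Z.total z))))"
        using e j l zY i by (simp add: proj_res_total total_eigenproj)
      also have "\<dots> = res X l (eigenproj es X j ((- 1) \<odot>\<^bsub>sp X\<^esub> res X i v))"
        unfolding pi_total using v i j l by (simp add: E resX)
      also have "\<dots> = \<ominus>\<^bsub>sp X\<^esub> res X l (eigenproj es X j (res X i v))"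
        using v i j l A by (simp add: E resX neg_eq)
      finally show "\<pi> l (\<rho> j (res Z i z)) = \<ominus>\<^bsub>sp X\<^esub> res X l (eigenproj es X j (res X i v))" .
    qed
  qed
qed

end

section \<open>The middle Laplace transforms are realizations\<close>

lemma pow_space_simps:
  "carrier (pow_space q V) = {..<q} \<rightarrow>\<^sub>E carrier V"
  "\<zero>\<^bsub>pow_space q V\<^esub> = (\<lambda>i\<in>{..<q}. \<zero>\<^bsub>V\<^esub>)"
  "v \<oplus>\<^bsub>pow_space q V\<^esub> w = (\<lambda>i\<in>{..<q}. v i \<oplus>\<^bsub>V\<^esub> w i)"
  "c \<odot>\<^bsub>pow_space q V\<^esub> v = (\<lambda>i\<in>{..<q}. c \<odot>\<^bsub>V\<^esub> v i)"
  by (simp_all add: pow_space_def)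

lemma cspace_pow_space:
  assumes "cspace V"
  shows "cspace (pow_space q V)"
proof -
  interpret cspace V by fact
  have "vectorspace CC (pow_space q V)"
  proof (rule vs_criteria)
    show "\<forall>v\<in>carrier (pow_space q V). \<exists>w\<in>carrier (pow_space q V).
        v \<oplus>\<^bsub>pow_space q V\<^esub> w = \<zero>\<^bsub>pow_space q V\<^esub>"
    proof
      fix v assume "v \<in> carrier (pow_space q V)"
      then show "\<exists>w\<in>carrier (pow_space q V). v \<oplus>\<^bsub>pow_space q V\<^esub> w = \<zero>\<^bsub>pow_space q V\<^esub>"
        by (intro bexI[of _ "\<lambda>i\<in>{..<q}. (- 1) \<odot>\<^bsub>V\<^esub> v i"])
          (auto simp: pow_space_simps PiE_iff intro!: restrict_ext)
    qed
  qed (auto simp: class_field pow_space_simps PiE_iff restrict_def fun_eq_iff extensional_def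
      smult_add_left smult_add_right a_assoc intro: a_comm)
  then show ?thesis by (simp add: cspace_def)
qed

locale subspace_quotient = cspace V
  for V :: "(complex, 'v) module" (structure) +
  fixes K :: "'v set"
  assumes subspace_K: "VectorSpace.subspace CC K V"
begin

lemmas K = subspaceD[OF subspace_K]

lemma abelian_subgroup_K: "abelian_subgroup K V"
proof (rule abelian_subgroupI3)
  show "additive_subgroup K V"
  proof (rule additive_subgroup.intro, rule group.subgroupI)
    show "group (add_monoid V)" by (rule a_group)
    show "K \<noteq> {}" using K(2) by blast
    show "inv\<^bsub>add_monoid V\<^esub> a \<in> K" if "a \<in> K" for a
      using that K(1) K(4)[of a "- 1"] neg_eq[of a] by (auto simp: a_inv_def)
  qed (use K in auto)
qed (rule abelian_group_axioms)

lemma coset_add: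
  "v \<in> carrier V \<Longrightarrow> w \<in> carrier V \<Longrightarrow> (K +> v) <+> (K +> w) = K +> (v \<oplus> w)"
  using abelian_subgroup.a_rcos_sum[OF abelian_subgroup_K] .

lemma coset_zero: "K +> \<zero> = K"
  using a_coset_add_zero K(1) by blast

lemma coset_eq_iff:
  assumes "v \<in> carrier V" "w \<in> carrier V"
  shows "K +> v = K +> w \<longleftrightarrow> v \<oplus> (- 1) \<odot> w \<in> K"
proof -
  have "v \<oplus> (- 1) \<odot> w \<in> K \<longleftrightarrow> v \<in> K +> w"
    using abelian_subgroup.a_rcos_module[OF abelian_subgroup_K, of w v] assms
    by (simp add: neg_eq)
  moreover have "v \<in> K +> w \<longleftrightarrow> K +> v = K +> w"
    using a_repr_independence[of v K w] abelian_subgroup.a_rcos_self[OF abelian_subgroup_K, of v]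
      assms additive_subgroup.a_subgroup[OF abelian_subgroup.axioms(1)[OF abelian_subgroup_K]]
    by auto
  ultimately show ?thesis by blast
qed

text \<open>An element \<open>k'\<close> of \<open>K\<close> in the coset contributes
  \<open>f k'\<close>, which \<open>K\<close> absorbs. Scalar multiplication of the quotient is an
  induced map too, so this also gives \<open>quot_smult\<close>.\<close>

lemma induced_coset:
  assumes f: "is_linear V V f" and inv: "\<And>v. v \<in> K \<Longrightarrow> f v \<in> K" and v: "v \<in> carrier V"
  shows "induced V K f (K +> v) = K +> f v"
proof
  note lin = is_linearD[OF f]
  show "induced V K f (K +> v) \<subseteq> K +> f v"
  proof
    fix x assume "x \<in> induced V K f (K +> v)"
    then obtain k k' where k: "k \<in> K" "k' \<in> K" "x = k \<oplus> f (k' \<oplus> v)"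
      by (auto simp: induced_def set_add_def' a_r_coset_def')
    then have "k \<in> carrier V" "k' \<in> carrier V" using K(1) by auto
    then have "x = (k \<oplus> f k') \<oplus> f v" using k(3) v by (simp add: lin a_assoc)
    then show "x \<in> K +> f v" using k inv K(3) by (auto simp: a_r_coset_def')
  qed
  show "K +> f v \<subseteq> induced V K f (K +> v)"
  proof
    fix x assume "x \<in> K +> f v"
    then obtain k where k: "k \<in> K" "x = k \<oplus> f v" by (auto simp: a_r_coset_def')
    then have "x = k \<oplus> f (\<zero> \<oplus> v)" using v by simp
    moreover have "\<zero> \<oplus> v \<in> K +> v" using K(2) by (auto simp: a_r_coset_def')
    ultimately show "x \<in> induced V K f (K +> v)"
      using k(1) unfolding induced_def set_add_def' by blast
  qed
qed

lemma quot_smult: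
  assumes "v \<in> carrier V"
  shows "c \<odot>\<^bsub>quot_space V K\<^esub> (K +> v) = K +> (c \<odot> v)"
proof -
  have "is_linear V V (\<lambda>v. c \<odot> v)"
    by (rule is_linearI) (auto simp: cspace_axioms smult_add_right mult.commute)
  from induced_coset[OF this] show ?thesis using assms K(4) by (simp add: quot_space_def)
qed

lemma carrier_quot: "carrier (quot_space V K) = (\<lambda>v. K +> v) ` carrier V"
  by (auto simp: quot_space_def A_RCOSETS_def')

lemma quot_add:
  "v \<in> carrier V \<Longrightarrow> w \<in> carrier V \<Longrightarrow> (K +> v) \<oplus>\<^bsub>quot_space V K\<^esub> (K +> w) = K +> (v \<oplus> w)"
  by (simp add: quot_space_def coset_add)

lemma quot_zero: "\<zero>\<^bsub>quot_space V K\<^esub> = K +> \<zero>"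
  by (simp add: quot_space_def coset_zero)

lemma cspace_quot: "cspace (quot_space V K)"
  using cspace_axioms carrier_quot quot_zero quot_add quot_smult by (rule cspace_image)

end

section \<open>Operators on the quotient by the kernels of the residues\<close>

locale pole_system = X: eigen_system es X
  for es :: "complex list" and X :: "'v system" +
  fixes as :: "complex list"
  assumes distinct: "distinct as"
    and linres: "\<And>i. i < length as \<Longrightarrow> is_linear (sp X) (sp X) (res X i)"
begin

abbreviation (input) "n \<equiv> length as"
abbreviation (input) "PX \<equiv> pow_space (length as) (sp X)"
abbreviation (input) "KX \<equiv> K_sub as X"

interpretation P: cspace PX by (rule cspace_pow_space[OF X.cspace_axioms])

lemma add_nth: "i < n \<Longrightarrow> (v \<oplus>\<^bsub>PX\<^esub> w) i = v i \<oplus>\<^bsub>sp X\<^esub> w i"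
  and smult_nth: "i < n \<Longrightarrow> (c \<odot>\<^bsub>PX\<^esub> v) i = c \<odot>\<^bsub>sp X\<^esub> v i"
  by (simp_all add: pow_space_simps)

lemma K_sub_iff: "v \<in> KX \<longleftrightarrow> v \<in> carrier PX \<and> (\<forall>i<n. res X i (v i) = \<zero>\<^bsub>sp X\<^esub>)"
  by (auto simp: K_sub_def pow_space_simps)

lemma pow_nth: "v \<in> carrier PX \<Longrightarrow> i < n \<Longrightarrow> v i \<in> carrier (sp X)"
  by (auto simp: pow_space_simps)

interpretation quot: subspace_quotient PX KX
proof (intro subspace_quotient.intro subspace_quotient_axioms.intro P.subspaceI P.cspace_axioms)
  note lin = is_linearD[OF linres]
  show "KX \<subseteq> carrier PX" by (auto simp: K_sub_iff)
  show "\<zero>\<^bsub>PX\<^esub> \<in> KX" using P.zero_closed by (simp add: K_sub_iff) (simp add: pow_space_simps lin)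
  show "v \<oplus>\<^bsub>PX\<^esub> w \<in> KX" if "v \<in> KX" "w \<in> KX" for v w
  proof -
    have "v \<oplus>\<^bsub>PX\<^esub> w \<in> carrier PX" using that by (intro P.a_closed) (auto simp: K_sub_iff)
    moreover have "res X i ((v \<oplus>\<^bsub>PX\<^esub> w) i) = \<zero>\<^bsub>sp X\<^esub>" if i: "i < n" for i
      using i \<open>v \<in> KX\<close> \<open>w \<in> KX\<close> pow_nth by (simp add: K_sub_iff add_nth lin)
    ultimately show ?thesis by (simp add: K_sub_iff)
  qed
  show "c \<odot>\<^bsub>PX\<^esub> v \<in> KX" if "v \<in> KX" for c v
  proof -
    have "c \<odot>\<^bsub>PX\<^esub> v \<in> carrier PX" using that by (intro P.smult_closed) (auto simp: K_sub_iff)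
    moreover have "res X i ((c \<odot>\<^bsub>PX\<^esub> v) i) = \<zero>\<^bsub>sp X\<^esub>" if i: "i < n" for i
      using i \<open>v \<in> KX\<close> pow_nth by (simp add: K_sub_iff smult_nth lin)
    ultimately show ?thesis by (simp add: K_sub_iff)
  qed
qed

lemma pow_ext:
  assumes "v \<in> carrier PX" "w \<in> carrier PX" "\<And>i. i < n \<Longrightarrow> v i = w i"
  shows "v = w"
  using assms by (auto simp: pow_space_simps intro: PiE_ext)

lemma linear_powI:
  assumes "\<And>v. v \<in> carrier PX \<Longrightarrow> f v \<in> carrier PX"
    "\<And>v w i. v \<in> carrier PX \<Longrightarrow> w \<in> carrier PX \<Longrightarrow> i < n \<Longrightarrow>
      f (v \<oplus>\<^bsub>PX\<^esub> w) i = f v i \<oplus>\<^bsub>sp X\<^esub> f w i"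
    "\<And>c v i. v \<in> carrier PX \<Longrightarrow> i < n \<Longrightarrow> f (c \<odot>\<^bsub>PX\<^esub> v) i = c \<odot>\<^bsub>sp X\<^esub> f v i"
  shows "is_linear PX PX f"
proof (rule is_linearI[OF P.cspace_axioms P.cspace_axioms assms(1)])
  show "f (v \<oplus>\<^bsub>PX\<^esub> w) = f v \<oplus>\<^bsub>PX\<^esub> f w" if "v \<in> carrier PX" "w \<in> carrier PX" for v w
    by (rule pow_ext) (use that assms in \<open>simp_all add: add_nth\<close>)
  show "f (c \<odot>\<^bsub>PX\<^esub> v) = c \<odot>\<^bsub>PX\<^esub> f v" if "v \<in> carrier PX" for c v
    by (rule pow_ext) (use that assms in \<open>simp_all add: smult_nth\<close>)
qed

lemma T_op_nth: "i < n \<Longrightarrow> T_op as X v i = (as ! i) \<odot>\<^bsub>sp X\<^esub> v i"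
  by (simp add: T_op_def)

lemma T_op_closed: "v \<in> carrier PX \<Longrightarrow> T_op as X v \<in> carrier PX"
  using pow_nth by (auto simp: T_op_def pow_space_simps)

lemma linear_T_op: "is_linear PX PX (T_op as X)"
  by (rule linear_powI)
    (simp_all add: T_op_closed T_op_nth add_nth smult_nth pow_nth X.smult_add_right mult.commute)

lemma T_op_K: "v \<in> KX \<Longrightarrow> T_op as X v \<in> KX"
  by (simp add: K_sub_iff T_op_closed T_op_nth pow_nth is_linearD[OF linres])

lemma res_sum_closed: "v \<in> carrier PX \<Longrightarrow> (\<Oplus>\<^bsub>sp X\<^esub>k\<in>{..<n}. res X k (v k)) \<in> carrier (sp X)"
  using pow_nth by (auto simp: is_linearD[OF linres])

lemma B_op_nth: "i < n \<Longrightarrow>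
    B_op as es X j v i = \<ominus>\<^bsub>sp X\<^esub> eigenproj es X j (\<Oplus>\<^bsub>sp X\<^esub>k\<in>{..<n}. res X k (v k))"
  by (simp add: B_op_def)

lemma B_op_closed: "v \<in> carrier PX \<Longrightarrow> j < length es \<Longrightarrow> B_op as es X j v \<in> carrier PX"
  using res_sum_closed by (auto simp: B_op_def pow_space_simps)

lemma linear_B_op:
  assumes j: "j < length es"
  shows "is_linear PX PX (B_op as es X j)"
proof (rule linear_powI)
  note E = is_linearD[OF X.linear_eigenproj[OF j]] and lin = is_linearD[OF linres]
  fix i assume i: "i < n"
  show "B_op as es X j (v \<oplus>\<^bsub>PX\<^esub> w) i = B_op as es X j v i \<oplus>\<^bsub>sp X\<^esub> B_op as es X j w i"
    if v: "v \<in> carrier PX" and w: "w \<in> carrier PX" for v w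
  proof -
    have "(\<Oplus>\<^bsub>sp X\<^esub>k\<in>{..<n}. res X k ((v \<oplus>\<^bsub>PX\<^esub> w) k)) =
        (\<Oplus>\<^bsub>sp X\<^esub>k\<in>{..<n}. res X k (v k) \<oplus>\<^bsub>sp X\<^esub> res X k (w k))"
      using v w by (intro X.finsum_eqI) (auto simp: add_nth pow_nth lin)
    also have "\<dots> = (\<Oplus>\<^bsub>sp X\<^esub>k\<in>{..<n}. res X k (v k)) \<oplus>\<^bsub>sp X\<^esub> (\<Oplus>\<^bsub>sp X\<^esub>k\<in>{..<n}. res X k (w k))"
      using v w by (intro X.finsum_add) (auto simp: pow_nth lin)
    finally show ?thesis
      using i j res_sum_closed[OF v] res_sum_closed[OF w] by (simp add: B_op_nth E X.minus_add)
  qed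
  show "B_op as es X j (c \<odot>\<^bsub>PX\<^esub> v) i = c \<odot>\<^bsub>sp X\<^esub> B_op as es X j v i"
    if v: "v \<in> carrier PX" for c v
  proof -
    have "(\<Oplus>\<^bsub>sp X\<^esub>k\<in>{..<n}. res X k ((c \<odot>\<^bsub>PX\<^esub> v) k)) =
        (\<Oplus>\<^bsub>sp X\<^esub>k\<in>{..<n}. c \<odot>\<^bsub>sp X\<^esub> res X k (v k))"
      using v by (intro X.finsum_eqI) (auto simp: smult_nth pow_nth lin)
    also have "\<dots> = c \<odot>\<^bsub>sp X\<^esub> (\<Oplus>\<^bsub>sp X\<^esub>k\<in>{..<n}. res X k (v k))"
      using v by (intro X.smult_finsum[symmetric]) (auto simp: pow_nth lin)
    finally show ?thesis
      using i j res_sum_closed[OF v] by (simp add: B_op_nth E X.smult_neg)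
  qed
qed (use j B_op_closed in auto)

lemma B_op_K:
  assumes "v \<in> KX" "j < length es"
  shows "B_op as es X j v \<in> KX"
proof -
  have "(\<Oplus>\<^bsub>sp X\<^esub>k\<in>{..<n}. res X k (v k)) = \<zero>\<^bsub>sp X\<^esub>"
    using assms(1) by (intro X.finsum_all_zero) (auto simp: K_sub_iff)
  then show ?thesis
    using assms B_op_closed
    by (simp add: K_sub_iff B_op_nth is_linearD[OF X.linear_eigenproj] is_linearD[OF linres])
qed

text \<open>The map sending the coset of \<open>(v_i)\<close> to \<open>A_i v_i\<close>, by way of
  some representative. Two representatives differ by a tuple with entries in the kernels, so the
  value does not depend on the choice.\<close>

definition laplace_proj :: "nat \<Rightarrow> (nat \<Rightarrow> 'v) set \<Rightarrow> 'v" where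
  "laplace_proj i C = res X i ((SOME v. v \<in> carrier PX \<and> C = KX +>\<^bsub>PX\<^esub> v) i)"

lemma laplace_proj_coset:
  assumes v: "v \<in> carrier PX" and i: "i < n"
  shows "laplace_proj i (KX +>\<^bsub>PX\<^esub> v) = res X i (v i)"
proof -
  define w where "w = (SOME w. w \<in> carrier PX \<and> KX +>\<^bsub>PX\<^esub> v = KX +>\<^bsub>PX\<^esub> w)"
  have w: "w \<in> carrier PX" "KX +>\<^bsub>PX\<^esub> v = KX +>\<^bsub>PX\<^esub> w"
    using someI[of "\<lambda>w. w \<in> carrier PX \<and> KX +>\<^bsub>PX\<^esub> v = KX +>\<^bsub>PX\<^esub> w" v] v by (auto simp: w_def)
  then have "v \<oplus>\<^bsub>PX\<^esub> (- 1) \<odot>\<^bsub>PX\<^esub> w \<in> KX" using quot.coset_eq_iff v by blast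
  then have "res X i ((v \<oplus>\<^bsub>PX\<^esub> (- 1) \<odot>\<^bsub>PX\<^esub> w) i) = \<zero>\<^bsub>sp X\<^esub>" using i by (simp add: K_sub_iff)
  then have "res X i (v i) \<oplus>\<^bsub>sp X\<^esub> (- 1) \<odot>\<^bsub>sp X\<^esub> res X i (w i) = \<zero>\<^bsub>sp X\<^esub>"
    using v w i by (simp add: add_nth smult_nth pow_nth is_linearD[OF linres])
  then have "res X i (v i) = res X i (w i)"
    using X.eq_if_diff_zero v w i pow_nth is_linearD(1)[OF linres] by blast
  then show ?thesis by (simp add: laplace_proj_def w_def)
qed

text \<open>Both transforms at once: the \<open>dx\<close>-term is prescribed only through its
  factor \<open>cs ! i\<close> on entry \<open>i\<close> of a representative, which is where the
  sign enters.\<close>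

lemma realization_laplace:
  assumes sp: "sp Y = laplace_space as X" and cs: "distinct cs" "length cs = n"
    and irr: "\<And>v. v \<in> carrier PX \<Longrightarrow> \<exists>w\<in>carrier PX. irr Y (KX +>\<^bsub>PX\<^esub> v) = KX +>\<^bsub>PX\<^esub> w \<and>
      (\<forall>i<n. w i = (cs ! i) \<odot>\<^bsub>sp X\<^esub> v i)"
    and res: "\<And>j. res Y j = laplace_induced as X (B_op as es X j)"
  shows "realization es X cs Y laplace_proj"
proof (intro realization.intro realization_axioms.intro)
  note Q = laplace_space_def
  have carr: "\<exists>v\<in>carrier PX. y = KX +>\<^bsub>PX\<^esub> v" if "y \<in> carrier (sp Y)" for y
    using that unfolding sp Q quot.carrier_quot by blast
  have coset: "KX +>\<^bsub>PX\<^esub> v \<in> carrier (sp Y)" if "v \<in> carrier PX" for v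
    using that unfolding sp Q quot.carrier_quot by blast
  have res_coset: "res Y j (KX +>\<^bsub>PX\<^esub> v) = KX +>\<^bsub>PX\<^esub> B_op as es X j v"
    if "v \<in> carrier PX" "j < length es" for j v
    unfolding res laplace_induced_def
    using that quot.induced_coset[OF linear_B_op B_op_K] by blast
  show "eigen_system es X" by (rule X.eigen_system_axioms)
  show "distinct cs" by (rule cs)
  show "is_linear (sp X) (sp X) (res X i)" if "i < length cs" for i using linres that cs by simp
  show csY: "cspace (sp Y)" unfolding sp Q by (rule quot.cspace_quot)
  show "is_linear (sp Y) (sp X) (laplace_proj i)" if "i < length cs" for i
  proof (rule is_linearI[OF csY X.cspace_axioms])
    have i: "i < n" using that cs by simp
    fix y assume "y \<in> carrier (sp Y)"
    then obtain v where v: "v \<in> carrier PX" "y = KX +>\<^bsub>PX\<^esub> v" using carr by blast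
    show "laplace_proj i y \<in> carrier (sp X)"
      using v i by (simp add: laplace_proj_coset pow_nth is_linearD[OF linres])
    show "laplace_proj i (c \<odot>\<^bsub>sp Y\<^esub> y) = c \<odot>\<^bsub>sp X\<^esub> laplace_proj i y" for c
    proof -
      have "c \<odot>\<^bsub>sp Y\<^esub> y = KX +>\<^bsub>PX\<^esub> (c \<odot>\<^bsub>PX\<^esub> v)"
        unfolding sp Q v(2) by (rule quot.quot_smult[OF v(1)])
      then show ?thesis
        using v i by (simp add: laplace_proj_coset pow_nth is_linearD[OF linres])
          (simp add: smult_nth pow_nth is_linearD[OF linres])
    qed
    fix z assume "z \<in> carrier (sp Y)"
    then obtain w where w: "w \<in> carrier PX" "z = KX +>\<^bsub>PX\<^esub> w" using carr by blast
    have "y \<oplus>\<^bsub>sp Y\<^esub> z = KX +>\<^bsub>PX\<^esub> (v \<oplus>\<^bsub>PX\<^esub> w)"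
      unfolding sp Q v(2) w(2) by (rule quot.quot_add[OF v(1) w(1)])
    then show "laplace_proj i (y \<oplus>\<^bsub>sp Y\<^esub> z) = laplace_proj i y \<oplus>\<^bsub>sp X\<^esub> laplace_proj i z"
      using v w i by (simp add: laplace_proj_coset) (simp add: add_nth pow_nth is_linearD[OF linres])
  qed
  show "y = \<zero>\<^bsub>sp Y\<^esub>" if y: "y \<in> carrier (sp Y)"
    and ker: "\<And>i. i < length cs \<Longrightarrow> laplace_proj i y = \<zero>\<^bsub>sp X\<^esub>" for y
  proof -
    obtain v where v: "v \<in> carrier PX" "y = KX +>\<^bsub>PX\<^esub> v" using carr y by blast
    have "v \<in> KX" using ker v cs by (simp add: K_sub_iff laplace_proj_coset)
    then have "KX +>\<^bsub>PX\<^esub> v = KX +>\<^bsub>PX\<^esub> \<zero>\<^bsub>PX\<^esub>"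
      using quot.coset_eq_iff[OF v(1) P.zero_closed] v(1) by simp
    then show ?thesis unfolding v(2) sp Q quot.quot_zero by simp
  qed
  show "\<exists>x\<in>carrier (sp X). laplace_proj i y = res X i x" if i: "i < length cs" and y: "y \<in> carrier (sp Y)" for i y
  proof -
    obtain v where "v \<in> carrier PX" "y = KX +>\<^bsub>PX\<^esub> v" using carr y by blast
    then show ?thesis using i cs laplace_proj_coset pow_nth by (intro bexI[of _ "v i"]) simp_all
  qed
  show "\<exists>y\<in>carrier (sp Y). \<forall>i<length cs. laplace_proj i y = res X i (x i)"
    if x: "\<And>i. i < length cs \<Longrightarrow> x i \<in> carrier (sp X)" for x
  proof -
    \<comment> \<open>Elements of the power space are extensional functions, so the values outside
      the index range are cut off first.\<close>
    have "restrict x {..<n} \<in> carrier PX" using x cs by (auto simp: pow_space_simps)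
    then show ?thesis
      using coset[of "restrict x {..<n}"] cs
      by (intro bexI[of _ "KX +>\<^bsub>PX\<^esub> restrict x {..<n}"]) (simp_all add: laplace_proj_coset)
  qed
  fix y assume "y \<in> carrier (sp Y)"
  then obtain v where v: "v \<in> carrier PX" "y = KX +>\<^bsub>PX\<^esub> v" using carr by blast
  obtain w where w: "w \<in> carrier PX" "irr Y y = KX +>\<^bsub>PX\<^esub> w"
    "\<forall>i<n. w i = (cs ! i) \<odot>\<^bsub>sp X\<^esub> v i" using irr[OF v(1)] v(2) by blast
  show "irr Y y \<in> carrier (sp Y)" using coset w by simp
  show "laplace_proj i (irr Y y) = (cs ! i) \<odot>\<^bsub>sp X\<^esub> laplace_proj i y" if "i < length cs" for i
    using that cs v w by (simp add: laplace_proj_coset pow_nth is_linearD[OF linres])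
  fix j assume j: "j < length es"
  show "res Y j y \<in> carrier (sp Y)"
    using coset B_op_closed v j res_coset by simp
  show "laplace_proj i (res Y j y) = \<ominus>\<^bsub>sp X\<^esub> res X i (eigenproj es X j
      (\<Oplus>\<^bsub>sp X\<^esub>k\<in>{..<length cs}. laplace_proj k y))" if "i < length cs" for i
  proof -
    have "(\<Oplus>\<^bsub>sp X\<^esub>k\<in>{..<length cs}. laplace_proj k y) = (\<Oplus>\<^bsub>sp X\<^esub>k\<in>{..<n}. res X k (v k))"
      using v cs by (auto intro!: X.finsum_eqI simp: laplace_proj_coset pow_nth is_linearD[OF linres])
    then show ?thesis
      using that cs v j res_sum_closed[OF v(1)]
      by (simp add: res_coset B_op_closed laplace_proj_coset B_op_nth is_linearD[OF linres])
  qed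
qed

lemma realization_mid_laplace: "\<exists>\<pi>. realization es X (map uminus as) (mid_laplace as es X) \<pi>"
proof -
  have "realization es X (map uminus as) (mid_laplace as es X) laplace_proj"
  proof (rule realization_laplace)
    show "distinct (map uminus as :: complex list)"
      using distinct by (simp add: distinct_map)
    fix v assume v: "v \<in> carrier PX"
    interpret Q: cspace "laplace_space as X"
      unfolding laplace_space_def by (rule quot.cspace_quot)
    have T: "laplace_induced as X (T_op as X) (KX +>\<^bsub>PX\<^esub> v) = KX +>\<^bsub>PX\<^esub> T_op as X v"
      unfolding laplace_induced_def using quot.induced_coset[OF linear_T_op T_op_K v] .
    have "KX +>\<^bsub>PX\<^esub> T_op as X v \<in> carrier (laplace_space as X)"
      unfolding laplace_space_def quot.carrier_quot using T_op_closed[OF v] by blast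
    then have "irr (mid_laplace as es X) (KX +>\<^bsub>PX\<^esub> v) =
        (- 1) \<odot>\<^bsub>laplace_space as X\<^esub> (KX +>\<^bsub>PX\<^esub> T_op as X v)"
      by (simp add: mid_laplace_def T Q.neg_eq)
    also have "\<dots> = KX +>\<^bsub>PX\<^esub> ((- 1) \<odot>\<^bsub>PX\<^esub> T_op as X v)"
      unfolding laplace_space_def by (rule quot.quot_smult[OF T_op_closed[OF v]])
    finally show "\<exists>w\<in>carrier PX. irr (mid_laplace as es X) (KX +>\<^bsub>PX\<^esub> v) = KX +>\<^bsub>PX\<^esub> w \<and>
        (\<forall>i<n. w i = (map uminus as ! i) \<odot>\<^bsub>sp X\<^esub> v i)"
      using T_op_closed[OF v] pow_nth[OF v]
      by (intro bexI[of _ "(- 1) \<odot>\<^bsub>PX\<^esub> T_op as X v"])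
        (auto simp: smult_nth T_op_nth)
  qed (simp_all add: mid_laplace_def)
  then show ?thesis by blast
qed

lemma realization_inv_mid_laplace: "\<exists>\<pi>. realization es X as (inv_mid_laplace as es X) \<pi>"
proof -
  have "realization es X as (inv_mid_laplace as es X) laplace_proj"
  proof (rule realization_laplace)
    show "distinct as" by (rule distinct)
    fix v assume v: "v \<in> carrier PX"
    have "irr (inv_mid_laplace as es X) (KX +>\<^bsub>PX\<^esub> v) = KX +>\<^bsub>PX\<^esub> T_op as X v"
      using quot.induced_coset[OF linear_T_op T_op_K v] by (simp add: inv_mid_laplace_def laplace_induced_def)
    then show "\<exists>w\<in>carrier PX. irr (inv_mid_laplace as es X) (KX +>\<^bsub>PX\<^esub> v) = KX +>\<^bsub>PX\<^esub> w \<and>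
        (\<forall>i<n. w i = (as ! i) \<odot>\<^bsub>sp X\<^esub> v i)"
      using T_op_closed[OF v] T_op_nth by blast
  qed (simp_all add: inv_mid_laplace_def)
  then show ?thesis by blast
qed

end

section \<open>Addition and middle convolution\<close>

lemma addition_simps [simp]:
  "sp (addition c X) = sp X" "irr (addition c X) = irr X"
  "res (addition c X) i v = res X i v \<oplus>\<^bsub>sp X\<^esub> (c $ i) \<odot>\<^bsub>sp X\<^esub> v"
  by (simp_all add: addition_def)

lemma linear_res_addition:
  assumes lin: "is_linear (sp X) (sp X) (res X i)"
  shows "is_linear (sp X) (sp X) (res (addition c X) i)"
proof -
  interpret cspace "sp X" using cspace_if_linear[OF lin] by blast
  show ?thesis
    by (rule is_linearI)
      (auto simp: cspace_axioms is_linearD[OF lin] smult_add_right a_ac mult.commute)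
qed

lemma linear_system_addition: "linear_system q X \<Longrightarrow> linear_system q (addition c X)"
  using linear_res_addition by (auto simp: linear_system_def)

lemma eigen_system_addition: "eigen_system es X \<Longrightarrow> eigen_system es (addition c X)"
  by (simp add: eigen_system_def eigen_family_def)

text \<open>Scalars preserve every subspace, so the invariant subspaces before and after the
  addition are the same.\<close>

lemma irreducible_addition:
  assumes lin: "linear_system q X" and irred: "irreducible_sys q X"
  shows "irreducible_sys q (addition c X)"
proof -
  interpret cspace "sp X" using linear_systemD(1)[OF lin] .
  show ?thesis
    unfolding irreducible_sys_def addition_simps(1,2)
  proof (intro conjI allI impI)
    show "carrier (sp X) \<noteq> {\<zero>\<^bsub>sp X\<^esub>}" using irred by (simp add: irreducible_sys_def)
    fix W assume W: "VectorSpace.subspace CC W (sp X)" and irrW: "irr X ` W \<subseteq> W"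
      and resW: "\<forall>i<q. res (addition c X) i ` W \<subseteq> W"
    note sub = subspaceD[OF W]
    have "res X i w \<in> W" if i: "i < q" and w: "w \<in> W" for i w
    proof -
      have wX: "w \<in> carrier (sp X)" using sub(1) w by blast
      have rX: "res X i w \<in> carrier (sp X)" using linear_closed[OF linear_systemD(3)[OF lin i] wX] .
      have "res (addition c X) i w \<oplus>\<^bsub>sp X\<^esub> (- (c $ i)) \<odot>\<^bsub>sp X\<^esub> w \<in> W"
        using resW i w by (intro sub(3,4)) auto
      also have "res (addition c X) i w \<oplus>\<^bsub>sp X\<^esub> (- (c $ i)) \<odot>\<^bsub>sp X\<^esub> w = res X i w"
        using wX rX by (simp add: a_assoc smult_add_left[symmetric])
      finally show ?thesis .
    qed
    then have "\<forall>i<q. res X i ` W \<subseteq> W" by blast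
    then show "W = {\<zero>\<^bsub>sp X\<^esub>} \<or> W = carrier (sp X)"
      using irred W irrW unfolding irreducible_sys_def by blast
  qed
qed

lemma morphism_addition:
  assumes X: "linear_system q X" and f: "morphism q X Y f"
  shows "morphism q (addition c X) (addition c Y) f"
proof -
  interpret cspace "sp X" using linear_systemD(1)[OF X] .
  show ?thesis
    using morphismD[OF f] is_linearD[OF morphismD(1)[OF f]] linear_closed[OF linear_systemD(3)[OF X]]
    by (simp add: morphism_def)
qed

lemma iso_systems_addition:
  assumes X: "linear_system q X" and iso: "iso_systems q X Y"
  shows "iso_systems q (addition c X) (addition c Y)"
  using iso morphism_addition[OF X] morphism_addition[OF linear_system_iso[OF iso X]]
  unfolding iso_systems_def addition_simps(1) by blast

lemma addition_addition:
  assumes X: "linear_system q X" and e: "\<And>i. i < q \<Longrightarrow> e $ i = c $ i + d $ i"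
  shows "iso_systems q (addition d (addition c X)) (addition e X)"
proof -
  interpret cspace "sp X" using linear_systemD(1)[OF X] .
  show ?thesis
    by (rule iso_systems_cong)
      (use X e linear_closed[OF linear_systemD(3)[OF X]] in
        \<open>auto intro!: linear_system_addition simp: smult_add_left a_assoc\<close>)
qed

lemma addition_zero:
  assumes X: "linear_system q X" and c: "\<And>i. i < q \<Longrightarrow> c $ i = 0"
  shows "iso_systems q (addition c X) X"
proof -
  interpret cspace "sp X" using linear_systemD(1)[OF X] .
  show ?thesis
    by (rule iso_systems_cong)
      (use X c linear_closed[OF linear_systemD(3)[OF X]] in \<open>auto intro!: linear_system_addition\<close>)
qed

section \<open>Middle convolution in terms of realizations\<close>

lemma irreducible_realizationI:
  "irreducible_system es X (length cs) \<Longrightarrow> realization es X cs Y \<pi> \<Longrightarrow>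
     irreducible_realization es X cs Y \<pi>"
  by (simp add: irreducible_realization_def)

text \<open>Irreducibility survives the addition, but in rank one the added scalars can cancel all
  residues; this is what the second assumption excludes.\<close>

lemma irreducible_system_addition:
  assumes "irreducible_system cs Y q" "nontrivial_residue q (addition c Y)"
  shows "irreducible_system cs (addition c Y) q"
proof -
  interpret irreducible_system cs Y q by fact
  show ?thesis
    using eigen_system_addition[OF eigen_system_axioms] irreducible_addition[OF linear_system irreducible]
      linear_res_addition[OF linear_res] assms(2)
    by (intro irreducible_system.intro irreducible_system_axioms.intro) auto
qed

text \<open>Both transforms preserve irreducibility and a nonzero residue by
  \<open>irreducible_system_Y\<close>; \<open>ne\<close> supplies what the addition between them may
  lose.\<close>

lemma convolution_irreducible:
  assumes X: "irreducible_system es X (length cs)" and Y: "realization es X cs Y \<pi>"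
    and ne: "nontrivial_residue (length es) (addition b Y)"
    and Z: "realization cs (addition b Y) es Z \<rho>"
  shows "irreducible_system es Z (length cs)"
proof -
  interpret Y: irreducible_realization es X cs Y \<pi> using X Y by (rule irreducible_realizationI)
  have "irreducible_system cs (addition b Y) (length es)"
    using Y.irreducible_system_Y ne by (rule irreducible_system_addition)
  then show ?thesis
    using irreducible_realization.irreducible_system_Y[OF irreducible_realizationI[OF _ Z]] by blast
qed

text \<open>Adding zero gives a system isomorphic to \<open>Y\<close>, so \<open>Z\<close> also
  realizes \<open>Y\<close> itself and the inversion applies.\<close>

lemma convolution_zero:
  assumes X: "irreducible_system es X (length cs)" and Y: "realization es X cs Y \<pi>"
    and b: "\<And>j. j < length es \<Longrightarrow> b $ j = 0"
    and Z: "realization cs (addition b Y) es Z \<rho>"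
  shows "iso_systems (length cs) Z X"
proof -
  interpret Y: irreducible_realization es X cs Y \<pi> using X Y by (rule irreducible_realizationI)
  have "iso_systems (length es) (addition b Y) Y" using addition_zero[OF Y.linear_system_Y b] .
  then obtain \<rho>' where "realization cs Y es Z \<rho>'"
    using realization.realization_iso_source[OF Z] by blast
  then show ?thesis using Y.realization_realization iso_systems_sym by blast
qed

text \<open>\<open>Y2\<close> is the transform of the inverse transform \<open>Z\<close> of
  \<open>addition b Y\<close>, hence isomorphic to \<open>addition b Y\<close>. The two additions
  then combine, so \<open>Z2\<close> and \<open>Z3\<close> realize isomorphic systems. The
  parameters stand for the negated ones: \<open>d\<close> is
  \<open>- (\<beta> + \<gamma>)\<close>.\<close>

lemma convolution_convolution:
  assumes X: "irreducible_system es X (length cs)" and Y: "realization es X cs Y \<pi>"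
    and ne: "nontrivial_residue (length es) (addition b Y)"
    and Z: "realization cs (addition b Y) es Z \<rho>"
    and Y2: "realization es Z cs Y2 \<pi>2" and Z2: "realization cs (addition c Y2) es Z2 \<rho>2"
    and Y3: "realization es X cs Y3 \<pi>3" and Z3: "realization cs (addition d Y3) es Z3 \<rho>3"
    and d: "\<And>j. j < length es \<Longrightarrow> d $ j = b $ j + c $ j"
  shows "iso_systems (length cs) Z2 Z3"
proof -
  interpret Y: irreducible_realization es X cs Y \<pi> using X Y by (rule irreducible_realizationI)
  have bY: "irreducible_system cs (addition b Y) (length es)"
    using Y.irreducible_system_Y ne by (rule irreducible_system_addition)
  \<comment> \<open>The inversion is used with \<open>es\<close> and \<open>cs\<close> interchanged,
    starting from \<open>addition b Y\<close>. Here the nontriviality of \<open>addition b Y\<close>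
    is essential.\<close>
  have "iso_systems (length es) (addition b Y) Y2"
    using irreducible_realization.realization_realization[OF irreducible_realizationI[OF bY Z] Y2] .
  then have "iso_systems (length es) (addition c Y2) (addition c (addition b Y))"
    using iso_systems_addition linear_system_addition[OF Y.linear_system_Y] iso_systems_sym by blast
  also have "iso_systems (length es) (addition c (addition b Y)) (addition d Y)"
    using addition_addition[OF Y.linear_system_Y d] .
  also have "iso_systems (length es) (addition d Y) (addition d Y3)"
    using iso_systems_addition[OF Y.linear_system_Y Y.realization_unique[OF Y3]] .
  finally obtain \<rho>' where "realization cs (addition d Y3) es Z2 \<rho>'"
    using realization.realization_iso_source[OF Z2] by blast
  then show ?thesis using realization.realization_unique Z3 by blast
qed

section \<open>Middle convolution of objects\<close>

lemma irreducible_system_iff: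
  assumes P: "in_P as es X" and es: "distinct es"
  shows "irreducible_system es X (length as) \<longleftrightarrow>
    irreducible_sys (length as) X \<and> non_exceptional (length as) X"
proof
  note eigen = eigen_system_if_in_P[OF P es] and lin = linear_system_if_in_P[OF P]
  show "irreducible_system es X (length as)"
    if "irreducible_sys (length as) X \<and> non_exceptional (length as) X"
    using that non_exceptional_iff[OF eigen lin] eigen linear_systemD(3)[OF lin]
    by (intro irreducible_system.intro irreducible_system_axioms.intro) auto
  show "irreducible_sys (length as) X \<and> non_exceptional (length as) X"
    if "irreducible_system es X (length as)"
    using that irreducible_system.irreducible irreducible_system.nontrivial
      non_exceptional_iff[OF eigen lin] by blast
qed

lemma pole_system_if_in_P: "in_P as es X \<Longrightarrow> distinct as \<Longrightarrow> distinct es \<Longrightarrow> pole_system es X as"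
  using linear_systemD(3)[OF linear_system_if_in_P] eigen_system_if_in_P
  by (intro pole_system.intro pole_system_axioms.intro)

lemma ex_realization_mid_laplace:
  assumes "in_P as es X" "distinct as" "distinct es"
  shows "\<exists>\<pi>. realization es X (map uminus as) (mid_laplace as es X) \<pi>"
  using pole_system.realization_mid_laplace[OF pole_system_if_in_P[OF assms]] .

lemma in_P_mid_laplace:
  assumes "in_P as es X" "distinct as" "distinct es"
  shows "in_P es (map uminus as) (mid_laplace as es X)"
  using ex_realization_mid_laplace[OF assms] realization.in_P_Y assms(1)
  unfolding in_P_def by blast

lemma in_P_addition:
  assumes P: "in_P as es X" and es: "distinct es"
  shows "in_P as es (addition c X)"
  by (rule eigen_system.in_PI[OF eigen_system_addition[OF eigen_system_if_in_P[OF P es]]])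
    (use P in \<open>auto simp: in_P_def intro!: linear_res_addition\<close>)

lemma ex_realization_inv_mid_laplace:
  assumes "in_P es cs Y" "distinct es" "distinct cs"
  shows "\<exists>\<pi>. realization cs Y es (inv_mid_laplace es cs Y) \<pi>"
  using pole_system.realization_inv_mid_laplace[OF pole_system_if_in_P[OF assms]] .

lemma distinct_uminus: "distinct as \<Longrightarrow> distinct (map uminus as :: complex list)"
  by (simp add: distinct_map)

text \<open>Residue \<open>i\<close> of the convolution belongs to the eigenvalue
  \<open>- a_i\<close> of the middle system, thus to the pole \<open>- (- a_i) = a_i\<close>. The
  order of the residues is the original one.\<close>

lemma ex_realization_mc:
  assumes P: "in_P as es X" and as: "distinct as" and es: "distinct es"
  shows "\<exists>\<rho>. realization (map uminus as) (addition (- b) (mid_laplace as es X)) es (mc as es b X) \<rho>"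
  unfolding mc_def
  using in_P_addition[OF in_P_mid_laplace[OF assms] distinct_uminus[OF as]] es distinct_uminus[OF as]
  by (rule ex_realization_inv_mid_laplace)

lemma in_P_mc:
  assumes P: "in_P as es X" and as: "distinct as" and es: "distinct es"
  shows "in_P as es (mc as es b X)"
proof -
  obtain \<rho> where "realization (map uminus as) (addition (- b) (mid_laplace as es X)) es (mc as es b X) \<rho>"
    using ex_realization_mc[OF assms] by blast
  then show ?thesis
    using realization.in_P_Y in_P_mid_laplace[OF assms] by (fastforce simp: in_P_def)
qed

lemma mc_zero:
  assumes P: "in_P as es X" and as: "distinct as" and es: "distinct es"
    and irred: "irreducible_system es X (length as)"
  shows "isomorphic_P as es (mc as es (0\<^sub>v (length es)) X) X"
proof -
  obtain \<pi> where Y: "realization es X (map uminus as) (mid_laplace as es X) \<pi>"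
    using ex_realization_mid_laplace[OF P as es] by blast
  obtain \<rho> where Z: "realization (map uminus as) (addition (- 0\<^sub>v (length es)) (mid_laplace as es X)) es
      (mc as es (0\<^sub>v (length es)) X) \<rho>" using ex_realization_mc[OF P as es] by blast
  have "iso_systems (length (map uminus as)) (mc as es (0\<^sub>v (length es)) X) X"
    by (rule convolution_zero[OF _ Y _ Z]) (use irred in simp_all)
  then show ?thesis using in_P_mc[OF P as es] P by (simp add: isomorphic_P_iff)
qed

lemma nontrivial_addition_mid_laplace:
  assumes P: "in_P as es X" and as: "distinct as" and es: "distinct es"
    and irred: "irreducible_system es X (length as)"
    and ne: "non_exceptional (length es) (addition c (mid_laplace as es X))"
  shows "nontrivial_residue (length es) (addition c (mid_laplace as es X))"
proof -
  obtain \<pi> where Y: "realization es X (map uminus as) (mid_laplace as es X) \<pi>"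
    using ex_realization_mid_laplace[OF P as es] by blast
  interpret Y: irreducible_realization es X "map uminus as" "mid_laplace as es X" \<pi>
    by (rule irreducible_realizationI[OF _ Y]) (use irred in simp)
  show ?thesis
    using ne non_exceptional_iff[OF eigen_system_addition[OF Y.eigen_system_Y]
        linear_system_addition[OF Y.linear_system_Y]
        irreducible_addition[OF Y.linear_system_Y Y.irreducible_Y]] by blast
qed

lemma mc_irreducible:
  assumes P: "in_P as es X" and as: "distinct as" and es: "distinct es"
    and irred: "irreducible_system es X (length as)"
    and ne: "non_exceptional (length es) (addition (- b) (mid_laplace as es X))"
  shows "irreducible_system es (mc as es b X) (length as)"
proof -
  obtain \<pi> where Y: "realization es X (map uminus as) (mid_laplace as es X) \<pi>"
    using ex_realization_mid_laplace[OF P as es] by blast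
  obtain \<rho> where Z: "realization (map uminus as) (addition (- b) (mid_laplace as es X)) es (mc as es b X) \<rho>"
    using ex_realization_mc[OF P as es] by blast
  show ?thesis
    using convolution_irreducible[OF _ Y nontrivial_addition_mid_laplace[OF P as es irred ne] Z] irred
    by simp
qed

lemma mc_mc:
  assumes P: "in_P as es X" and as: "distinct as" and es: "distinct es"
    and irred: "irreducible_system es X (length as)"
    and ne: "non_exceptional (length es) (addition (- b) (mid_laplace as es X))"
    and b: "b \<in> carrier_vec (length es)" and c: "c \<in> carrier_vec (length es)"
  shows "isomorphic_P as es (mc as es c (mc as es b X)) (mc as es (b + c) X)"
proof -
  let ?cs = "map uminus as"
  note P' = in_P_mc[OF P as es]
  obtain \<pi> where Y: "realization es X ?cs (mid_laplace as es X) \<pi>"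
    using ex_realization_mid_laplace[OF P as es] by blast
  obtain \<rho> where Z: "realization ?cs (addition (- b) (mid_laplace as es X)) es (mc as es b X) \<rho>"
    using ex_realization_mc[OF P as es] by blast
  obtain \<pi>2 where Y2: "realization es (mc as es b X) ?cs (mid_laplace as es (mc as es b X)) \<pi>2"
    using ex_realization_mid_laplace[OF P' as es] by blast
  obtain \<rho>2 where Z2: "realization ?cs (addition (- c) (mid_laplace as es (mc as es b X))) es
      (mc as es c (mc as es b X)) \<rho>2"
    using ex_realization_mc[OF P' as es] by blast
  obtain \<rho>3 where Z3: "realization ?cs (addition (- (b + c)) (mid_laplace as es X)) es
      (mc as es (b + c) X) \<rho>3"
    using ex_realization_mc[OF P as es] by blast
  have "iso_systems (length ?cs) (mc as es c (mc as es b X)) (mc as es (b + c) X)"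
    by (rule convolution_convolution[OF _ Y nontrivial_addition_mid_laplace[OF P as es irred ne] Z Y2 Z2 Y Z3])
      (use irred b c in simp_all)
  then show ?thesis
    using in_P_mc[OF P' as es] P' in_P_mc[OF P as es] by (simp add: isomorphic_P_iff)
qed

section \<open>Systems of differential equations in coordinates\<close>

abbreviation vec_sp :: "nat \<Rightarrow> (complex, complex vec) module" where
  "vec_sp n \<equiv> module_vec TYPE(complex) n"

lemma cspace_vec: "cspace (vec_sp n)"
  by (simp add: cspace_def vec_vs)

lemma linear_mult_mat_vec:
  fixes A :: "complex mat"
  assumes "A \<in> carrier_mat m n"
  shows "is_linear (vec_sp n) (vec_sp m) (\<lambda>v. A *\<^sub>v v)"
  by (rule is_linearI)
    (use assms in \<open>auto simp: cspace_vec module_vec_simps mult_add_distrib_mat_vec mult_mat_vec\<close>)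

lemma linear_eq_on_unit_vecs:
  assumes f: "is_linear (vec_sp n) V f" and g: "is_linear (vec_sp n) V g"
    and eq: "\<And>i. i < n \<Longrightarrow> f (unit_vec n i) = g (unit_vec n i)"
    and v: "v \<in> carrier_vec n"
  shows "f v = g v"
proof -
  interpret cspace "vec_sp n" by (rule cspace_vec)
  interpret V: cspace V using cspace_if_linear[OF f] by blast
  define W where "W = {v \<in> carrier (vec_sp n). f v = g v}"
  have W: "VectorSpace.subspace CC W (vec_sp n)"
    by (rule subspaceI) (auto simp: W_def is_linearD[OF f] is_linearD[OF g])
  have "set (unit_vecs n) \<subseteq> W" using eq by (auto simp: W_def unit_vecs_def module_vec_simps)
  then have "LinearCombinations.module.span CC (vec_sp n) (set (unit_vecs n)) \<subseteq> W"
    using span_subset_subspace[OF W] by blast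
  then show ?thesis using v vec_space.span_unit_vecs_is_carrier[of n] by (auto simp: W_def)
qed

lemma mult_unit_vec:
  fixes A :: "complex mat"
  assumes "A \<in> carrier_mat m n" "j < n"
  shows "A *\<^sub>v unit_vec n j = col A j"
  using assms by (intro eq_vecI) auto

lemma mat_eqI_mult:
  fixes A B :: "complex mat"
  assumes "A \<in> carrier_mat m n" "B \<in> carrier_mat m n"
    and "\<And>v. v \<in> carrier_vec n \<Longrightarrow> A *\<^sub>v v = B *\<^sub>v v"
  shows "A = B"
proof (rule mat_col_eqI)
  fix j assume "j < dim_col B"
  then show "col A j = col B j"
    using assms mult_unit_vec[of A m n j] mult_unit_vec[of B m n j] by simp
qed (use assms in auto)

lemma ex_matrix_of_linear:
  assumes f: "is_linear (vec_sp n) (vec_sp m) f"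
  shows "\<exists>M\<in>carrier_mat m n. \<forall>v\<in>carrier_vec n. f v = M *\<^sub>v v"
proof -
  define M where "M = mat m n (\<lambda>(i, j). f (unit_vec n j) $ i)"
  have M: "M \<in> carrier_mat m n" by (simp add: M_def)
  have "f (unit_vec n j) = M *\<^sub>v unit_vec n j" if "j < n" for j
    using linear_closed[OF f, of "unit_vec n j"] that
    by (intro eq_vecI) (auto simp: mult_unit_vec[OF M] M_def module_vec_simps)
  then show ?thesis
    using linear_eq_on_unit_vecs[OF f linear_mult_mat_vec[OF M]] M by blast
qed

text \<open>The shape conditions of \<open>is_equation\<close>. They hold for every equation read
  off in a basis and make \<open>system_of\<close> linear before diagonalizability is known.\<close>

definition square_equation :: "nat \<Rightarrow> equation \<Rightarrow> bool" where
  "square_equation q E \<longleftrightarrow> eq_S E \<in> carrier_mat (eq_rank E) (eq_rank E) \<and>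
     (\<forall>i<q. eq_A E i \<in> carrier_mat (eq_rank E) (eq_rank E))"

lemma system_of_simps [simp]:
  "sp (system_of E) = vec_sp (eq_rank E)"
  "irr (system_of E) v = eq_S E *\<^sub>v v"
  "res (system_of E) i v = eq_A E i *\<^sub>v v"
  by (simp_all add: system_of_def)

lemma linear_system_of: "square_equation q E \<Longrightarrow> linear_system q (system_of E)"
  using linear_mult_mat_vec[of _ "eq_rank E" "eq_rank E"]
  by (auto simp: square_equation_def linear_system_def system_of_def)

text \<open>Let \<open>Q\<close> and \<open>P\<close> be the matrices of the isomorphism
  \<open>f\<close> and of its inverse \<open>g\<close>. The intertwining relation
  \<open>B f = f A\<close> then reads \<open>A = P * B * Q\<close>, with the same \<open>P\<close>
  and \<open>Q\<close> for all coefficients.\<close>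

lemma gauge_equiv_if_iso:
  assumes E: "square_equation q E" and F: "square_equation q F"
    and iso: "iso_systems q (system_of E) (system_of F)"
  shows "gauge_equiv q E F"
proof -
  define n where "n = eq_rank E"
  obtain f g where fg: "morphism q (system_of E) (system_of F) f"
    "morphism q (system_of F) (system_of E) g"
    "\<And>v. v \<in> carrier_vec n \<Longrightarrow> g (f v) = v" "\<And>w. w \<in> carrier_vec (eq_rank F) \<Longrightarrow> f (g w) = w"
    using iso unfolding iso_systems_def n_def by (auto simp: module_vec_simps)
  have f: "is_linear (vec_sp n) (vec_sp (eq_rank F)) f" and g: "is_linear (vec_sp (eq_rank F)) (vec_sp n) g"
    using morphismD(1)[OF fg(1)] morphismD(1)[OF fg(2)] by (simp_all add: n_def)
  note fc = is_linearD(1)[OF f, unfolded module_vec_simps] and gc = is_linearD(1)[OF g, unfolded module_vec_simps]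
  \<comment> \<open>The ranks are not assumed equal; the isomorphism forces it by comparing
    dimensions.\<close>
  have rank: "eq_rank F = n"
  proof -
    have inj: "inj_on f (carrier (vec_sp n))"
      using fg(3) by (metis inj_onI module_vec_simps(3))
    have surj: "f ` carrier (vec_sp n) = carrier (vec_sp (eq_rank F))"
      using fc gc fg(4) by (force simp: module_vec_simps)
    show ?thesis
      using linear_map.dim_eq[OF f vec_space.fin_dim inj surj] vec_space.dim_is_n by metis
  qed
  obtain Q where Q: "Q \<in> carrier_mat n n" "\<And>v. v \<in> carrier_vec n \<Longrightarrow> f v = Q *\<^sub>v v"
    using ex_matrix_of_linear[OF f] rank by auto
  obtain P where P: "P \<in> carrier_mat n n" "\<And>v. v \<in> carrier_vec n \<Longrightarrow> g v = P *\<^sub>v v"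
    using ex_matrix_of_linear[OF g] rank by auto
  have PQ: "P * Q = 1\<^sub>m n"
    using P Q fg(3) fc rank by (intro mat_eqI_mult[of _ n n]) (auto simp: assoc_mult_mat_vec)
  have QP: "Q * P = 1\<^sub>m n"
    using P Q fg(4) gc rank by (intro mat_eqI_mult[of _ n n]) (auto simp: assoc_mult_mat_vec)
  have sim: "similar_mat_wit A B P Q"
    if A: "A \<in> carrier_mat n n" and B: "B \<in> carrier_mat n n"
      and AB: "\<And>v. v \<in> carrier_vec n \<Longrightarrow> B *\<^sub>v f v = f (A *\<^sub>v v)" for A B
  proof -
    have "A = P * B * Q"
    proof (rule mat_eqI_mult[of _ n n])
      fix v :: "complex vec" assume v: "v \<in> carrier_vec n"
      have "(P * B * Q) *\<^sub>v v = P *\<^sub>v (B *\<^sub>v (Q *\<^sub>v v))"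
        using P(1) B Q(1) v by (simp add: assoc_mult_mat_vec[of _ n n _ n])
      also have "\<dots> = g (f (A *\<^sub>v v))"
        using AB[OF v] Q(2)[OF v] P(2)[of "f (A *\<^sub>v v)"] A v fc[of "A *\<^sub>v v"] rank by simp
      also have "\<dots> = A *\<^sub>v v" using fg(3) A v by simp
      finally show "A *\<^sub>v v = (P * B * Q) *\<^sub>v v" by simp
    qed (use A B P Q in auto)
    then show ?thesis
      using A B P Q PQ QP by (simp add: similar_mat_wit_def)
  qed
  have "similar_mat_wit (eq_S E) (eq_S F) P Q"
    using E F rank morphismD(2)[OF fg(1)] by (intro sim) (auto simp: square_equation_def n_def module_vec_simps)
  moreover have "similar_mat_wit (eq_A E i) (eq_A F i) P Q" if "i < q" for i
    using that E F rank morphismD(3)[OF fg(1)]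
    by (intro sim) (auto simp: square_equation_def n_def module_vec_simps)
  ultimately show ?thesis unfolding gauge_equiv_def by blast
qed

text \<open>Linear combinations over the set of basis vectors become sums over positions in the
  list, the form used by \<open>has_matrix\<close>.\<close>

lemma basis_finsum:
  assumes "cspace V" "distinct b" "set b \<subseteq> carrier V"
  shows "LinearCombinations.module.lincomb V a (set b) = (\<Oplus>\<^bsub>V\<^esub>i\<in>{..<length b}. a (b ! i) \<odot>\<^bsub>V\<^esub> (b ! i))"
proof -
  interpret cspace V by fact
  have "inj_on ((!) b) {..<length b}" using assms(2) by (auto simp: inj_on_def nth_eq_iff_index_eq)
  moreover have "set b = (!) b ` {..<length b}" by (auto simp: set_conv_nth)
  ultimately show ?thesis
    using finsum_reindex[of "\<lambda>v. a v \<odot>\<^bsub>V\<^esub> v" "(!) b" "{..<length b}"] assms(3)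
    by (auto simp: module.lincomb_def[OF module])
qed

lemma basis_coordinates:
  assumes V: "cspace V" and "distinct b" and basis: "vectorspace.basis CC V (set b)"
  shows "v \<in> carrier V \<Longrightarrow> \<exists>c. v = (\<Oplus>\<^bsub>V\<^esub>i\<in>{..<length b}. c i \<odot>\<^bsub>V\<^esub> (b ! i))"
    and "(\<Oplus>\<^bsub>V\<^esub>i\<in>{..<length b}. c i \<odot>\<^bsub>V\<^esub> (b ! i)) = \<zero>\<^bsub>V\<^esub> \<Longrightarrow> i < length b \<Longrightarrow> c i = 0"
proof -
  interpret cspace V by fact
  have b: "set b \<subseteq> carrier V" "LinearCombinations.module.span CC V (set b) = carrier V"
    "LinearCombinations.module.lin_indpt CC V (set b)"
    using basis vectorspace.basis_def[OF vectorspace] by auto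
  note sum = basis_finsum[OF V \<open>distinct b\<close> b(1)]
  show "\<exists>c. v = (\<Oplus>\<^bsub>V\<^esub>i\<in>{..<length b}. c i \<odot>\<^bsub>V\<^esub> (b ! i))" if v: "v \<in> carrier V"
  proof -
    obtain a where "LinearCombinations.module.lincomb V a (set b) = v"
      using module.finite_in_span[OF module finite_set b(1), of v] b(2) v by auto
    then show ?thesis using sum[of a] by (intro exI[of _ "\<lambda>i. a (b ! i)"]) simp
  qed
  show "c i = 0" if c: "(\<Oplus>\<^bsub>V\<^esub>i\<in>{..<length b}. c i \<odot>\<^bsub>V\<^esub> (b ! i)) = \<zero>\<^bsub>V\<^esub>" and i: "i < length b"
  proof -
    \<comment> \<open>Coefficients indexed by positions are turned into coefficients indexed by
      vectors: distinctness makes \<open>a (b ! i) = c i\<close> meaningful.\<close>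
    define a where "a = (\<lambda>v. c (the_inv_into {..<length b} ((!) b) v))"
    have inj: "inj_on ((!) b) {..<length b}"
      using \<open>distinct b\<close> by (auto simp: inj_on_def nth_eq_iff_index_eq)
    have a: "a (b ! i) = c i" if "i < length b" for i
      using the_inv_into_f_f[OF inj, of i] that by (simp add: a_def)
    have "LinearCombinations.module.lincomb V a (set b) = (\<Oplus>\<^bsub>V\<^esub>i\<in>{..<length b}. c i \<odot>\<^bsub>V\<^esub> (b ! i))"
      unfolding sum using b(1) nth_mem[of _ b] by (intro finsum_eqI) (auto simp: a simp del: nth_mem)
    then have "LinearCombinations.module.lincomb V a (set b) = \<zero>\<^bsub>V\<^esub>" using c by simp
    then have "a \<in> set b \<rightarrow> {\<zero>\<^bsub>CC\<^esub>}"
      using vectorspace.not_lindepD[OF vectorspace b(3) finite_set order.refl, of a] by auto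
    then have "a (b ! i) = 0" using i by auto
    then show ?thesis using a i by simp
  qed
qed

lemma equation_of_square: "equation_of q Y F \<Longrightarrow> square_equation q F"
  by (auto simp: equation_of_def has_matrix_def square_equation_def)

text \<open>The coordinate map \<open>x \<mapsto> \<Sum>i. x_i b_i\<close> is the isomorphism.
  Afterwards a chosen basis matters only through the existence of such an isomorphism.\<close>

lemma iso_equation_of:
  assumes F: "equation_of q Y F" and Y: "linear_system q Y"
  shows "iso_systems q (system_of F) Y"
proof -
  interpret cspace "sp Y" using linear_systemD(1)[OF Y] .
  obtain b where b: "distinct b" "vectorspace.basis CC (sp Y) (set b)"
    "has_matrix (sp Y) b (irr Y) (eq_S F)" "\<And>i. i < q \<Longrightarrow> has_matrix (sp Y) b (res Y i) (eq_A F i)"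
    using F by (auto simp: equation_of_def)
  define n where "n = length b"
  have rank: "eq_rank F = n" using b(3) by (auto simp: has_matrix_def n_def)
  have bV: "b ! i \<in> carrier (sp Y)" if "i < n" for i
    using b(2) that vectorspace.basis_def[OF vectorspace] by (auto simp: n_def)
  define \<phi> where "\<phi> x = (\<Oplus>\<^bsub>sp Y\<^esub>i\<in>{..<n}. (x $ i) \<odot>\<^bsub>sp Y\<^esub> (b ! i))" for x
  have \<phi>: "is_linear (vec_sp n) (sp Y) \<phi>"
  proof (rule is_linearI)
    fix x y assume "x \<in> carrier (vec_sp n)" "y \<in> carrier (vec_sp n)"
    then have "\<phi> (x \<oplus>\<^bsub>vec_sp n\<^esub> y) =
        (\<Oplus>\<^bsub>sp Y\<^esub>i\<in>{..<n}. (x $ i) \<odot>\<^bsub>sp Y\<^esub> (b ! i) \<oplus>\<^bsub>sp Y\<^esub> (y $ i) \<odot>\<^bsub>sp Y\<^esub> (b ! i))"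
      unfolding \<phi>_def using bV
      by (intro finsum_eqI) (auto simp: module_vec_simps smult_add_left)
    also have "\<dots> = \<phi> x \<oplus>\<^bsub>sp Y\<^esub> \<phi> y"
      unfolding \<phi>_def using bV by (intro finsum_add) auto
    finally show "\<phi> (x \<oplus>\<^bsub>vec_sp n\<^esub> y) = \<phi> x \<oplus>\<^bsub>sp Y\<^esub> \<phi> y" .
  next
    fix c x assume "x \<in> carrier (vec_sp n)"
    then have "\<phi> (c \<odot>\<^bsub>vec_sp n\<^esub> x) = (\<Oplus>\<^bsub>sp Y\<^esub>i\<in>{..<n}. c \<odot>\<^bsub>sp Y\<^esub> ((x $ i) \<odot>\<^bsub>sp Y\<^esub> (b ! i)))"
      unfolding \<phi>_def using bV by (intro finsum_eqI) (auto simp: module_vec_simps)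
    also have "\<dots> = c \<odot>\<^bsub>sp Y\<^esub> \<phi> x"
      unfolding \<phi>_def using bV by (intro smult_finsum[symmetric]) auto
    finally show "\<phi> (c \<odot>\<^bsub>vec_sp n\<^esub> x) = c \<odot>\<^bsub>sp Y\<^esub> \<phi> x" .
  qed (use bV in \<open>auto simp: \<phi>_def cspace_vec cspace_axioms\<close>)
  have \<phi>_unit: "\<phi> (unit_vec n j) = b ! j" if "j < n" for j
    unfolding \<phi>_def using that bV by (intro finsum_delta[of j]) auto
  \<comment> \<open>Both sides are linear in \<open>x\<close>, so unit vectors suffice; there column
    \<open>j\<close> of \<open>M\<close> consists of the coordinates of
    \<open>h (b ! j)\<close>.\<close>
  have commute: "\<phi> (M *\<^sub>v x) = h (\<phi> x)"
    if M: "has_matrix (sp Y) b h M" and h: "is_linear (sp Y) (sp Y) h" and x: "x \<in> carrier_vec n" for M h x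
  proof -
    have Mn: "M \<in> carrier_mat n n" using M by (simp add: has_matrix_def n_def)
    show ?thesis
    proof (rule linear_eq_on_unit_vecs[OF linear_compose[OF linear_mult_mat_vec[OF Mn] \<phi>]
          linear_compose[OF \<phi> h] _ x])
      fix j assume j: "j < n"
      have "\<phi> (M *\<^sub>v unit_vec n j) = (\<Oplus>\<^bsub>sp Y\<^esub>i\<in>{..<n}. (M $$ (i, j)) \<odot>\<^bsub>sp Y\<^esub> (b ! i))"
        unfolding \<phi>_def mult_unit_vec[OF Mn j] using Mn j bV by (intro finsum_eqI) auto
      also have "\<dots> = h (b ! j)" using M j by (simp add: has_matrix_def n_def)
      finally show "\<phi> (M *\<^sub>v unit_vec n j) = h (\<phi> (unit_vec n j))" using \<phi>_unit[OF j] by simp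
    qed
  qed
  show ?thesis
  proof (rule iso_systems_of_relation[where R = "\<lambda>x y. y = \<phi> x",
        OF linear_system_of[OF equation_of_square[OF F]] Y])
    show "\<exists>y\<in>carrier (sp Y). y = \<phi> x" if "x \<in> carrier (sp (system_of F))" for x
      using that linear_closed[OF \<phi>] rank by simp
    show "\<exists>x\<in>carrier (sp (system_of F)). y = \<phi> x" if y: "y \<in> carrier (sp Y)" for y
    proof -
      obtain c where "y = (\<Oplus>\<^bsub>sp Y\<^esub>i\<in>{..<n}. c i \<odot>\<^bsub>sp Y\<^esub> (b ! i))"
        using basis_coordinates(1)[OF cspace_axioms b(1,2) y] by (auto simp: n_def)
      also have "\<dots> = \<phi> (vec n c)"
        unfolding \<phi>_def using bV by (intro finsum_eqI) auto
      finally show ?thesis using rank by (intro bexI[of _ "vec n c"]) (auto simp: module_vec_simps)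
    qed
    show "y = \<zero>\<^bsub>sp Y\<^esub>" if "y = \<phi> \<zero>\<^bsub>sp (system_of F)\<^esub>" for y
      using that linear_zero[OF \<phi>] rank by simp
    show "x = \<zero>\<^bsub>sp (system_of F)\<^esub>" if "x \<in> carrier (sp (system_of F))" "\<zero>\<^bsub>sp Y\<^esub> = \<phi> x" for x
    proof -
      have "x $ i = 0" if "i < n" for i
        using basis_coordinates(2)[OF cspace_axioms b(1,2), of "\<lambda>i. x $ i" i] \<open>\<zero>\<^bsub>sp Y\<^esub> = \<phi> x\<close> that
        by (simp add: \<phi>_def n_def)
      then show ?thesis
        using that(1) rank by (intro eq_vecI) (auto simp: module_vec_simps)
    qed
    show "irr Y y = \<phi> (irr (system_of F) x)" if "x \<in> carrier (sp (system_of F))" "y = \<phi> x" for x y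
      using that commute[OF b(3) linear_systemD(2)[OF Y]] rank by (simp add: module_vec_simps)
    show "res Y i y = \<phi> (res (system_of F) i x)"
      if "i < q" "x \<in> carrier (sp (system_of F))" "y = \<phi> x" for i x y
      using that commute[OF b(4) linear_systemD(3)[OF Y]] rank by (simp add: module_vec_simps)
  qed (use rank is_linearD[OF \<phi>] in auto)
qed

lemma ex_has_matrix:
  assumes h: "is_linear V V h" and b: "distinct b" "vectorspace.basis CC V (set b)"
  shows "\<exists>M. has_matrix V b h M"
proof -
  interpret cspace V using cspace_if_linear[OF h] by blast
  have bV: "b ! j \<in> carrier V" if "j < length b" for j
    using b(2) that vectorspace.basis_def[OF vectorspace] by auto
  have "\<forall>j. \<exists>c. j < length b \<longrightarrow> h (b ! j) = (\<Oplus>\<^bsub>V\<^esub>i\<in>{..<length b}. c i \<odot>\<^bsub>V\<^esub> (b ! i))"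
    using basis_coordinates(1)[OF cspace_axioms b] linear_closed[OF h] bV by blast
  then obtain c where c: "\<And>j. j < length b \<Longrightarrow>
      h (b ! j) = (\<Oplus>\<^bsub>V\<^esub>i\<in>{..<length b}. c j i \<odot>\<^bsub>V\<^esub> (b ! i))" by metis
  have "has_matrix V b h (mat (length b) (length b) (\<lambda>(i, j). c j i))"
    unfolding has_matrix_def using bV by (auto simp: c intro!: finsum_eqI)
  then show ?thesis by blast
qed

lemma ex_equation_of:
  assumes Y: "linear_system q Y" and fin: "vectorspace.fin_dim CC (sp Y)"
  shows "\<exists>F. equation_of q Y F"
proof -
  interpret cspace "sp Y" using linear_systemD(1)[OF Y] .
  obtain B where "finite B" "vectorspace.basis CC (sp Y) B"
    using vectorspace.finite_basis_exists[OF vectorspace fin] by blast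
  then obtain b where b: "distinct b" "vectorspace.basis CC (sp Y) (set b)"
    using finite_distinct_list by metis
  obtain S where S: "has_matrix (sp Y) b (irr Y) S"
    using ex_has_matrix[OF linear_systemD(2)[OF Y] b] by blast
  have "\<forall>i. \<exists>A. i < q \<longrightarrow> has_matrix (sp Y) b (res Y i) A"
    using ex_has_matrix[OF linear_systemD(3)[OF Y] b] by blast
  then obtain A where "\<forall>i<q. has_matrix (sp Y) b (res Y i) (A i)" by metis
  then have "equation_of q Y \<lparr>eq_S = S, eq_A = A\<rparr>"
    using b S unfolding equation_of_def by auto
  then show ?thesis by blast
qed

lemma eigenvalue_op_system_of:
  "eigenvalue_op (sp (system_of E)) (irr (system_of E)) \<mu> \<longleftrightarrow> eigenvalue (eq_S E) \<mu>"
  by (auto simp: eigenvalue_op_def eigenvalue_def eigenvector_def module_vec_simps)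

text \<open>In a diagonalization \<open>S = P * D * Q\<close> the columns of \<open>P\<close> are
  eigenvectors for the diagonal entries of \<open>D\<close>, and they generate because
  \<open>P\<close> is invertible.\<close>

lemma in_P_system_of:
  assumes E: "is_equation as es E" and es: "distinct es"
  shows "in_P as es (system_of E)"
proof -
  let ?n = "eq_rank E"
  have sq: "square_equation (length as) E" using E by (simp add: is_equation_def square_equation_def)
  note lin = linear_systemD[OF linear_system_of[OF sq]]
  interpret cspace "vec_sp ?n" by (rule cspace_vec)
  have S: "eq_S E \<in> carrier_mat ?n ?n" using E by (simp add: is_equation_def)
  obtain D P Q where D: "diagonal_mat D" "similar_mat_wit (eq_S E) D P Q"
    using E by (auto simp: is_equation_def similar_mat_def)
  have carr: "D \<in> carrier_mat ?n ?n" "P \<in> carrier_mat ?n ?n" "Q \<in> carrier_mat ?n ?n"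
    and inv: "P * Q = 1\<^sub>m ?n" "Q * P = 1\<^sub>m ?n" and SD: "eq_S E = P * D * Q"
    using D(2) unfolding similar_mat_wit_def Let_def by blast+
  define G where "G = (\<lambda>i. P *\<^sub>v unit_vec ?n i) ` {..<?n}"
  have G: "G \<subseteq> carrier (vec_sp ?n)" using carr by (auto simp: G_def module_vec_simps)
  have QP: "Q *\<^sub>v (P *\<^sub>v v) = v" "P *\<^sub>v (Q *\<^sub>v v) = v" if "v \<in> carrier_vec ?n" for v
    using that carr inv
    by (simp_all add: assoc_mult_mat_vec[of _ ?n ?n _ ?n, symmetric])
  have "v \<in> LinearCombinations.module.span CC (vec_sp ?n) G" if v: "v \<in> carrier_vec ?n" for v
  proof -
    \<comment> \<open>The preimage of the span under \<open>P\<close>. It contains the unit vectors,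
      hence also \<open>Q *\<^sub>v v\<close>, which \<open>P\<close> sends back to
      \<open>v\<close>.\<close>
    define W where "W = {x \<in> carrier (vec_sp ?n). P *\<^sub>v x \<in> LinearCombinations.module.span CC (vec_sp ?n) G}"
    note span = subspaceD[OF span_subspace[OF G]] and P = is_linearD[OF linear_mult_mat_vec[OF carr(2)]]
    have W: "VectorSpace.subspace CC W (vec_sp ?n)"
      by (rule subspaceI) (auto simp: W_def P span)
    have "set (unit_vecs ?n) \<subseteq> W"
      using subset_span[OF G] by (auto simp: W_def unit_vecs_def module_vec_simps G_def)
    then have "carrier_vec ?n \<subseteq> W"
      using span_subset_subspace[OF W] vec_space.span_unit_vecs_is_carrier[of ?n] by blast
    then have "Q *\<^sub>v v \<in> W" using v carr(3) mult_mat_vec_carrier by blast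
    then have "P *\<^sub>v (Q *\<^sub>v v) \<in> LinearCombinations.module.span CC (vec_sp ?n) G"
      by (simp add: W_def)
    then show ?thesis using QP(2)[OF v] by simp
  qed
  then have span: "LinearCombinations.module.span CC (vec_sp ?n) G = carrier (vec_sp ?n)"
    using subspaceD(1)[OF span_subspace[OF G]] by (auto simp: module_vec_simps)
  have "eigen_system es (system_of E)"
  proof (rule eigen_system_of_generators[OF es lin(2)])
    show "G \<subseteq> carrier (sp (system_of E))"
      "LinearCombinations.module.span CC (sp (system_of E)) G = carrier (sp (system_of E))"
      using G span by simp_all
    fix g assume "g \<in> G"
    then obtain i where i: "i < ?n" "g = P *\<^sub>v unit_vec ?n i" by (auto simp: G_def)
    have g: "g \<in> carrier_vec ?n" using G \<open>g \<in> G\<close> by (auto simp: module_vec_simps)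
    have "D *\<^sub>v unit_vec ?n i = (D $$ (i, i)) \<cdot>\<^sub>v unit_vec ?n i"
      unfolding mult_unit_vec[OF carr(1) i(1)]
      using D(1) carr(1) i(1) by (intro eq_vecI) (auto simp: diagonal_mat_def)
    moreover have "eq_S E *\<^sub>v g = P *\<^sub>v (D *\<^sub>v (Q *\<^sub>v g))"
      unfolding SD using carr g by (simp add: assoc_mult_mat_vec[of _ ?n ?n _ ?n])
    ultimately have eig: "eq_S E *\<^sub>v g = (D $$ (i, i)) \<cdot>\<^sub>v g"
      using i carr QP(1)[of "unit_vec ?n i"] by (simp add: mult_mat_vec[OF carr(2)])
    have "g \<noteq> 0\<^sub>v ?n"
    proof
      assume "g = 0\<^sub>v ?n"
      then have "Q *\<^sub>v g = 0\<^sub>v ?n" using carr(3) by auto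
      then have "unit_vec ?n i = (0\<^sub>v ?n :: complex vec)" using QP(1)[of "unit_vec ?n i"] i by simp
      then have "unit_vec ?n i $ i = (0 :: complex)" using i(1) by simp
      then show False using i(1) by simp
    qed
    then have "eigenvalue (eq_S E) (D $$ (i, i))"
      using eig g unfolding eigenvalue_def eigenvector_def by blast
    then have "D $$ (i, i) \<in> set es" using E by (simp add: is_equation_def)
    then show "\<exists>k<length es. irr (system_of E) g = (es ! k) \<odot>\<^bsub>sp (system_of E)\<^esub> g"
      using eig by (auto simp: in_set_conv_nth module_vec_simps)
  qed
  then show ?thesis
    using lin(3) vec_space.fin_dim[of ?n] by (intro eigen_system.in_PI) auto
qed

text \<open>In an eigenbasis the \<open>dx\<close>-term has a diagonal matrix \<open>D\<close>. The
  standard basis and the eigenbasis describe isomorphic systems, and the resulting gauge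
  transformation is the required similarity.\<close>

lemma is_equation_if_in_P:
  assumes sq: "square_equation (length as) E" and P: "in_P as es (system_of E)"
  shows "is_equation as es E"
proof -
  let ?n = "eq_rank E"
  note lin = linear_systemD[OF linear_system_of[OF sq]]
  interpret cspace "vec_sp ?n" by (rule cspace_vec)
  obtain B where B: "vectorspace.basis CC (vec_sp ?n) B"
    and eig: "\<And>v. v \<in> B \<Longrightarrow> \<exists>\<mu>. irr (system_of E) v = \<mu> \<odot>\<^bsub>vec_sp ?n\<^esub> v"
    using P by (auto simp: in_P_def diagonalizable_op_def)
  have "finite B"
    using vectorspace.fin_dim_li_fin[OF vectorspace] P B vectorspace.basis_def[OF vectorspace]
    by (auto simp: in_P_def)
  then obtain b where b: "distinct b" "set b = B" using finite_distinct_list by metis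
  have bV: "b ! j \<in> carrier (vec_sp ?n)" if "j < length b" for j
    using that b B vectorspace.basis_def[OF vectorspace] by auto
  have "\<forall>j. \<exists>\<mu>. j < length b \<longrightarrow> irr (system_of E) (b ! j) = \<mu> \<odot>\<^bsub>vec_sp ?n\<^esub> (b ! j)"
    using eig b(2) by auto
  then obtain \<mu> where \<mu>: "\<And>j. j < length b \<Longrightarrow>
      irr (system_of E) (b ! j) = \<mu> j \<odot>\<^bsub>vec_sp ?n\<^esub> (b ! j)" by metis
  define D where "D = mat (length b) (length b) (\<lambda>(i, j). if i = j then \<mu> i else 0)"
  have "has_matrix (vec_sp ?n) b (irr (system_of E)) D"
    unfolding has_matrix_def
  proof (intro conjI allI impI)
    show "D \<in> carrier_mat (length b) (length b)" by (simp add: D_def)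
    fix j assume j: "j < length b"
    have "(\<Oplus>\<^bsub>vec_sp ?n\<^esub>i\<in>{..<length b}. D $$ (i, j) \<odot>\<^bsub>vec_sp ?n\<^esub> (b ! i)) = \<mu> j \<odot>\<^bsub>vec_sp ?n\<^esub> (b ! j)"
      using j bV by (intro finsum_delta[of j]) (auto simp: D_def)
    then show "irr (system_of E) (b ! j) =
        (\<Oplus>\<^bsub>vec_sp ?n\<^esub>i\<in>{..<length b}. D $$ (i, j) \<odot>\<^bsub>vec_sp ?n\<^esub> (b ! i))" using \<mu>[OF j] by simp
  qed
  \<comment> \<open>With no residues to compare, only the \<open>dx\<close>-term matters, and the
    residues of the auxiliary equation may be arbitrary.\<close>
  then have eqn: "equation_of 0 (system_of E) \<lparr>eq_S = D, eq_A = undefined\<rparr>"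
    unfolding equation_of_def using b B by auto
  have sq0: "square_equation 0 E" using sq by (simp add: square_equation_def)
  have "gauge_equiv 0 E \<lparr>eq_S = D, eq_A = undefined\<rparr>"
    using gauge_equiv_if_iso[OF sq0 equation_of_square[OF eqn]]
      iso_equation_of[OF eqn linear_system_of[OF sq0]] iso_systems_sym by blast
  then have "similar_mat (eq_S E) D" by (auto simp: gauge_equiv_def similar_mat_def)
  moreover have "diagonal_mat D" by (auto simp: diagonal_mat_def D_def)
  moreover have "\<forall>\<mu>. eigenvalue (eq_S E) \<mu> \<longrightarrow> \<mu> \<in> set es"
    using P by (simp add: in_P_def eigenvalue_op_system_of[symmetric])
  ultimately show ?thesis
    using sq by (auto simp: is_equation_def square_equation_def)
qed

lemma smult_one_mult_vec:
  fixes v :: "complex vec"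
  assumes "v \<in> carrier_vec n"
  shows "(c \<cdot>\<^sub>m 1\<^sub>m n) *\<^sub>v v = c \<cdot>\<^sub>v v"
proof -
  have "row (c \<cdot>\<^sub>m 1\<^sub>m n) i = c \<cdot>\<^sub>v unit_vec n i" if "i < n" for i
    using that by (intro eq_vecI) auto
  then show ?thesis using assms by (intro eq_vecI) auto
qed

section \<open>Transforms and middle convolution of equations\<close>

lemma iso_system_of_addition_eq:
  assumes F: "square_equation q F"
  shows "iso_systems q (addition c (system_of F)) (system_of (addition_eq c F))"
proof (rule iso_systems_cong)
  show "linear_system q (addition c (system_of F))"
    using linear_system_addition[OF linear_system_of[OF F]] .
  fix i v assume i: "i < q" and v: "v \<in> carrier (sp (addition c (system_of F)))"
  have "eq_A F i \<in> carrier_mat (eq_rank F) (eq_rank F)" using F i by (simp add: square_equation_def)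
  then show "res (system_of (addition_eq c F)) i v = res (addition c (system_of F)) i v"
    using v
    by (simp add: addition_eq_def module_vec_simps add_mult_distrib_mat_vec[of _ "eq_rank F" "eq_rank F"]
        smult_one_mult_vec)
qed (simp_all add: addition_eq_def)

text \<open>Whatever basis produced \<open>F\<close>, its system is isomorphic to the transform of
  the system of \<open>E\<close>, and realizations do not distinguish the two.\<close>

lemma mid_laplace_eq_realization:
  assumes E: "is_equation as es E" and as: "distinct as" and es: "distinct es"
    and F: "mid_laplace_eq as es E F"
  shows "\<exists>\<pi>. realization es (system_of E) (map uminus as) (system_of F) \<pi>"
    and "square_equation (length es) F" and "in_P es (map uminus as) (system_of F)"
proof -
  note P = in_P_system_of[OF E es]
  note eqn = F[unfolded mid_laplace_eq_def]
  note lin = linear_system_if_in_P[OF in_P_mid_laplace[OF P as es]]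
  have iso: "iso_systems (length es) (mid_laplace as es (system_of E)) (system_of F)"
    using iso_systems_sym[OF iso_equation_of[OF eqn lin]] .
  show "\<exists>\<pi>. realization es (system_of E) (map uminus as) (system_of F) \<pi>"
    using ex_realization_mid_laplace[OF P as es] realization.realization_iso_target iso by blast
  show "square_equation (length es) F" by (rule equation_of_square[OF eqn])
  show "in_P es (map uminus as) (system_of F)"
    using in_P_iso[OF iso in_P_mid_laplace[OF P as es] distinct_uminus[OF as]] .
qed

lemma inv_mid_laplace_eq_realization:
  assumes P: "in_P es cs (system_of F)" and sq: "square_equation (length es) F"
    and es: "distinct es" and cs: "distinct cs" and len: "length cs = length as"
    and E: "inv_mid_laplace_eq es cs (addition_eq c F) E"
  shows "\<exists>\<rho>. realization cs (addition c (system_of F)) es (system_of E) \<rho>" and "is_equation as es E"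
proof -
  let ?F = "system_of (addition_eq c F)"
  note iso = iso_system_of_addition_eq[OF sq, of c]
  have P': "in_P es cs ?F" using in_P_iso[OF iso in_P_addition[OF P cs] cs] .
  obtain \<rho> where \<rho>: "realization cs ?F es (inv_mid_laplace es cs ?F) \<rho>"
    using ex_realization_inv_mid_laplace[OF P' es cs] by blast
  have "iso_systems (length cs) (inv_mid_laplace es cs ?F) (system_of E)"
    using iso_systems_sym[OF iso_equation_of[OF E[unfolded inv_mid_laplace_eq_def]
          realization.linear_system_Y[OF \<rho>]]] .
  then obtain \<rho>' where \<rho>': "realization cs ?F es (system_of E) \<rho>'"
    using realization.realization_iso_target[OF \<rho>] by blast
  \<comment> \<open>The source changes from the system of the sum to the sum on the system, the form
    in which the convolution results are stated.\<close>
  then show "\<exists>\<rho>. realization cs (addition c (system_of F)) es (system_of E) \<rho>"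
    using realization.realization_iso_source iso_systems_sym[OF iso] by blast
  have "in_P as es (system_of E)"
    using realization.in_P_Y[OF \<rho>'] P' len by (simp add: in_P_def)
  moreover have "square_equation (length as) E"
    using equation_of_square[OF E[unfolded inv_mid_laplace_eq_def]] len by simp
  ultimately show "is_equation as es E" by (intro is_equation_if_in_P)
qed

lemma mc_eq_realization:
  assumes E: "is_equation as es E" and as: "distinct as" and es: "distinct es"
    and mc: "mc_eq as es b E E'"
  shows "\<exists>F \<pi> \<rho>. mid_laplace_eq as es E F \<and>
      realization es (system_of E) (map uminus as) (system_of F) \<pi> \<and>
      realization (map uminus as) (addition (- b) (system_of F)) es (system_of E') \<rho>"
    and "is_equation as es E'"
proof -
  obtain F where F: "mid_laplace_eq as es E F"
    "inv_mid_laplace_eq es (map uminus as) (addition_eq (- b) F) E'"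
    using mc by (auto simp: mc_eq_def)
  note 1 = mid_laplace_eq_realization[OF E as es F(1)]
  note 2 = inv_mid_laplace_eq_realization[OF 1(3,2) es distinct_uminus[OF as] length_map F(2)]
  show "\<exists>F \<pi> \<rho>. mid_laplace_eq as es E F \<and>
      realization es (system_of E) (map uminus as) (system_of F) \<pi> \<and>
      realization (map uminus as) (addition (- b) (system_of F)) es (system_of E') \<rho>"
    using F(1) 1(1) 2(1) by blast
  show "is_equation as es E'" by (rule 2(2))
qed

text \<open>As \<open>mc_eq\<close> is a relation, this ensures that assertions about all
  convolutions of an equation are not vacuous.\<close>

lemma ex_mc_eq:
  assumes E: "is_equation as es E" and as: "distinct as" and es: "distinct es"
  shows "\<exists>E'. mc_eq as es b E E'"
proof -
  let ?cs = "map uminus as"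
  note P = in_P_mid_laplace[OF in_P_system_of[OF E es] as es]
  obtain F where F: "mid_laplace_eq as es E F"
    using ex_equation_of[OF linear_system_if_in_P[OF P]] P
    by (auto simp: mid_laplace_eq_def in_P_def)
  note 1 = mid_laplace_eq_realization[OF E as es F]
  let ?F = "system_of (addition_eq (- b) F)"
  have P': "in_P es ?cs ?F"
    using in_P_iso[OF iso_system_of_addition_eq[OF 1(2)] in_P_addition[OF 1(3) distinct_uminus[OF as]]
        distinct_uminus[OF as]] .
  obtain \<rho> where \<rho>: "realization ?cs ?F es (inv_mid_laplace es ?cs ?F) \<rho>"
    using ex_realization_inv_mid_laplace[OF P' es distinct_uminus[OF as]] by blast
  have "vectorspace.fin_dim CC (sp (inv_mid_laplace es ?cs ?F))"
    using realization.fin_dim_Y[OF \<rho>] P' by (simp add: in_P_def)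
  then obtain E' where "equation_of (length ?cs) (inv_mid_laplace es ?cs ?F) E'"
    using ex_equation_of[OF realization.linear_system_Y[OF \<rho>]] by blast
  then show ?thesis using F unfolding mc_eq_def inv_mid_laplace_eq_def by blast
qed

lemma square_equation_if_is_equation: "is_equation as es E \<Longrightarrow> square_equation (length as) E"
  by (simp add: is_equation_def square_equation_def)

lemma mc_eq_zero:
  assumes E: "is_equation as es E" and as: "distinct as" and es: "distinct es"
    and irred: "irreducible_system es (system_of E) (length as)"
    and mc: "mc_eq as es (0\<^sub>v (length es)) E E0"
  shows "gauge_equiv (length as) E0 E"
proof -
  obtain F \<pi> \<rho> where Y: "realization es (system_of E) (map uminus as) (system_of F) \<pi>"
    and Z: "realization (map uminus as) (addition (- 0\<^sub>v (length es)) (system_of F)) es (system_of E0) \<rho>"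
    using mc_eq_realization(1)[OF E as es mc] by blast
  have "iso_systems (length (map uminus as)) (system_of E0) (system_of E)"
    by (rule convolution_zero[OF _ Y _ Z]) (use irred in simp_all)
  then show ?thesis
    using gauge_equiv_if_iso[OF mc_eq_realization(2)[OF E as es mc, THEN square_equation_if_is_equation]
        square_equation_if_is_equation[OF E]] by simp
qed

text \<open>
  \<open>mc_eq\<close> and the hypothesis of non-exceptionality may use different equations \<open>F\<close> for the middle
  Laplace transform; these are isomorphic, and any of them can be used in the realizations.
\<close>

lemma mc_eq_realization_with:
  assumes E: "is_equation as es E" and as: "distinct as" and es: "distinct es"
    and mc: "mc_eq as es b E E1" and F: "mid_laplace_eq as es E F"
  shows "\<exists>\<pi> \<rho>. realization es (system_of E) (map uminus as) (system_of F) \<pi> \<and>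
      realization (map uminus as) (addition (- b) (system_of F)) es (system_of E1) \<rho>"
proof -
  obtain F' \<pi>' \<rho>' where Y': "realization es (system_of E) (map uminus as) (system_of F') \<pi>'"
    and Z': "realization (map uminus as) (addition (- b) (system_of F')) es (system_of E1) \<rho>'"
    using mc_eq_realization(1)[OF E as es mc] by blast
  obtain \<pi> where Y: "realization es (system_of E) (map uminus as) (system_of F) \<pi>"
    using mid_laplace_eq_realization(1)[OF E as es F] by blast
  have "iso_systems (length es) (addition (- b) (system_of F')) (addition (- b) (system_of F))"
    using iso_systems_addition[OF realization.linear_system_Y[OF Y'] realization.realization_unique[OF Y' Y]] .
  then obtain \<rho> where "realization (map uminus as) (addition (- b) (system_of F)) es (system_of E1) \<rho>"
    using realization.realization_iso_source[OF Z'] by blast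
  then show ?thesis using Y by blast
qed

text \<open>Non-exceptionality is assumed for the equation \<open>addition_eq c F\<close>, whereas
  realizations use \<open>addition c (system_of F)\<close>. The two are isomorphic, so a nonzero
  residue passes from one to the other.\<close>

lemma nontrivial_addition_eq:
  assumes E: "is_equation as es E" and as: "distinct as" and es: "distinct es"
    and irred: "irreducible_system es (system_of E) (length as)"
    and F: "mid_laplace_eq as es E F" and ne: "non_exceptional_eq (length es) (addition_eq c F)"
  shows "nontrivial_residue (length es) (addition c (system_of F))"
proof -
  note 1 = mid_laplace_eq_realization[OF E as es F]
  obtain \<pi> where Y: "realization es (system_of E) (map uminus as) (system_of F) \<pi>" using 1(1) by blast
  interpret Y: irreducible_realization es "system_of E" "map uminus as" "system_of F" \<pi>
    by (rule irreducible_realizationI[OF _ Y]) (use irred in simp)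
  note iso = iso_system_of_addition_eq[OF 1(2), of c]
  note lin = linear_system_addition[OF Y.linear_system_Y, of c]
  have "nontrivial_residue (length es) (system_of (addition_eq c F))"
    using ne non_exceptional_iff[OF eigen_system_iso[OF iso eigen_system_addition[OF Y.eigen_system_Y] lin]
        linear_system_iso[OF iso lin]
        irreducible_iso[OF iso lin irreducible_addition[OF Y.linear_system_Y Y.irreducible_Y]]] by blast
  then show ?thesis
    using nontrivial_residue_iso[OF iso_systems_sym[OF iso]] linear_system_iso[OF iso lin] by blast
qed

lemma mc_eq_irreducible:
  assumes E: "is_equation as es E" and as: "distinct as" and es: "distinct es"
    and irred: "irreducible_system es (system_of E) (length as)"
    and F: "mid_laplace_eq as es E F" and ne: "non_exceptional_eq (length es) (addition_eq (- b) F)"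
    and mc: "mc_eq as es b E E1"
  shows "irreducible_system es (system_of E1) (length as)"
proof -
  obtain \<pi> \<rho> where Y: "realization es (system_of E) (map uminus as) (system_of F) \<pi>"
    and Z: "realization (map uminus as) (addition (- b) (system_of F)) es (system_of E1) \<rho>"
    using mc_eq_realization_with[OF E as es mc F] by blast
  show ?thesis
    using convolution_irreducible[OF _ Y nontrivial_addition_eq[OF E as es irred F ne] Z] irred by simp
qed

text \<open>\<open>E3\<close> may come from another basis of the middle Laplace transform than
  \<open>F\<close> does. This is why \<open>convolution_convolution\<close> admits a
  \<open>Y3\<close> different from \<open>Y\<close>.\<close>

lemma mc_eq_mc_eq:
  assumes E: "is_equation as es E" and as: "distinct as" and es: "distinct es"
    and irred: "irreducible_system es (system_of E) (length as)"
    and F: "mid_laplace_eq as es E F" and ne: "non_exceptional_eq (length es) (addition_eq (- b) F)"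
    and E1: "mc_eq as es b E E1" and E2: "mc_eq as es c E1 E2" and E3: "mc_eq as es (b + c) E E3"
    and b: "b \<in> carrier_vec (length es)" and c: "c \<in> carrier_vec (length es)"
  shows "gauge_equiv (length as) E2 E3"
proof -
  let ?cs = "map uminus as"
  note eq1 = mc_eq_realization(2)[OF E as es E1]
  obtain \<pi> \<rho> where Y: "realization es (system_of E) ?cs (system_of F) \<pi>"
    and Z: "realization ?cs (addition (- b) (system_of F)) es (system_of E1) \<rho>"
    using mc_eq_realization_with[OF E as es E1 F] by blast
  obtain F2 \<pi>2 \<rho>2 where Y2: "realization es (system_of E1) ?cs (system_of F2) \<pi>2"
    and Z2: "realization ?cs (addition (- c) (system_of F2)) es (system_of E2) \<rho>2"
    using mc_eq_realization(1)[OF eq1 as es E2] by blast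
  obtain F3 \<pi>3 \<rho>3 where Y3: "realization es (system_of E) ?cs (system_of F3) \<pi>3"
    and Z3: "realization ?cs (addition (- (b + c)) (system_of F3)) es (system_of E3) \<rho>3"
    using mc_eq_realization(1)[OF E as es E3] by blast
  have "iso_systems (length ?cs) (system_of E2) (system_of E3)"
    by (rule convolution_convolution[OF _ Y nontrivial_addition_eq[OF E as es irred F ne] Z Y2 Z2 Y3 Z3])
      (use irred b c in simp_all)
  then show ?thesis
    using gauge_equiv_if_iso[OF mc_eq_realization(2)[OF eq1 as es E2, THEN square_equation_if_is_equation]
        mc_eq_realization(2)[OF E as es E3, THEN square_equation_if_is_equation]] by simp
qed

theorem theorem5p3:
  fixes as \<alpha>s :: "complex list"
    and X :: "'v system"
    and E :: equation
  assumes "distinct as" and "distinct \<alpha>s"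
  shows
    "(in_P as \<alpha>s X \<and> irreducible_sys (length as) X \<and> non_exceptional (length as) X \<longrightarrow>
        isomorphic_P as \<alpha>s (mc as \<alpha>s (0\<^sub>v (length \<alpha>s)) X) X \<and>
        (\<forall>\<beta> \<in> carrier_vec (length \<alpha>s).
           non_exceptional (length \<alpha>s) (addition (- \<beta>) (mid_laplace as \<alpha>s X)) \<longrightarrow>
             in_P as \<alpha>s (mc as \<alpha>s \<beta> X) \<and>
             irreducible_sys (length as) (mc as \<alpha>s \<beta> X) \<and>
             non_exceptional (length as) (mc as \<alpha>s \<beta> X) \<and>
             (\<forall>\<gamma> \<in> carrier_vec (length \<alpha>s).
                isomorphic_P as \<alpha>s (mc as \<alpha>s \<gamma> (mc as \<alpha>s \<beta> X)) (mc as \<alpha>s (\<beta> + \<gamma>) X))))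
     \<and>
     (is_equation as \<alpha>s E \<and> irreducible_eq (length as) E \<and> non_exceptional_eq (length as) E \<longrightarrow>
        (\<forall>\<beta> \<in> carrier_vec (length \<alpha>s). \<exists>E'. mc_eq as \<alpha>s \<beta> E E') \<and>
        (\<forall>E0. mc_eq as \<alpha>s (0\<^sub>v (length \<alpha>s)) E E0 \<longrightarrow> gauge_equiv (length as) E0 E) \<and>
        (\<forall>\<beta> \<in> carrier_vec (length \<alpha>s). \<forall>F E1.
           mid_laplace_eq as \<alpha>s E F \<and> non_exceptional_eq (length \<alpha>s) (addition_eq (- \<beta>) F) \<and>
           mc_eq as \<alpha>s \<beta> E E1 \<longrightarrow>
             is_equation as \<alpha>s E1 \<and>
             irreducible_eq (length as) E1 \<and>
             non_exceptional_eq (length as) E1 \<and>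
             (\<forall>\<gamma> \<in> carrier_vec (length \<alpha>s). \<forall>E2 E3.
                mc_eq as \<alpha>s \<gamma> E1 E2 \<and> mc_eq as \<alpha>s (\<beta> + \<gamma>) E E3 \<longrightarrow>
                  gauge_equiv (length as) E2 E3)))"
proof (intro conjI impI)
  assume "in_P as \<alpha>s X \<and> irreducible_sys (length as) X \<and> non_exceptional (length as) X"
  then have P: "in_P as \<alpha>s X" and irred: "irreducible_system \<alpha>s X (length as)"
    using irreducible_system_iff[of as \<alpha>s X] assms(2) by blast+
  show "isomorphic_P as \<alpha>s (mc as \<alpha>s (0\<^sub>v (length \<alpha>s)) X) X"
    using mc_zero[OF P assms irred] .
  show "\<forall>\<beta> \<in> carrier_vec (length \<alpha>s).
      non_exceptional (length \<alpha>s) (addition (- \<beta>) (mid_laplace as \<alpha>s X)) \<longrightarrow>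
        in_P as \<alpha>s (mc as \<alpha>s \<beta> X) \<and> irreducible_sys (length as) (mc as \<alpha>s \<beta> X) \<and>
        non_exceptional (length as) (mc as \<alpha>s \<beta> X) \<and>
        (\<forall>\<gamma> \<in> carrier_vec (length \<alpha>s).
          isomorphic_P as \<alpha>s (mc as \<alpha>s \<gamma> (mc as \<alpha>s \<beta> X)) (mc as \<alpha>s (\<beta> + \<gamma>) X))"
  proof (intro ballI impI)
    fix \<beta> :: "complex vec"
    assume \<beta>: "\<beta> \<in> carrier_vec (length \<alpha>s)"
      and ne: "non_exceptional (length \<alpha>s) (addition (- \<beta>) (mid_laplace as \<alpha>s X))"
    note P' = in_P_mc[OF P assms, of \<beta>]
    show "in_P as \<alpha>s (mc as \<alpha>s \<beta> X) \<and> irreducible_sys (length as) (mc as \<alpha>s \<beta> X) \<and>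
        non_exceptional (length as) (mc as \<alpha>s \<beta> X) \<and>
        (\<forall>\<gamma> \<in> carrier_vec (length \<alpha>s).
          isomorphic_P as \<alpha>s (mc as \<alpha>s \<gamma> (mc as \<alpha>s \<beta> X)) (mc as \<alpha>s (\<beta> + \<gamma>) X))"
      using P' mc_irreducible[OF P assms irred ne] irreducible_system_iff[OF P' assms(2)]
        mc_mc[OF P assms irred ne \<beta>] by blast
  qed
next
  assume "is_equation as \<alpha>s E \<and> irreducible_eq (length as) E \<and> non_exceptional_eq (length as) E"
  then have E: "is_equation as \<alpha>s E" and irred: "irreducible_system \<alpha>s (system_of E) (length as)"
    using irreducible_system_iff[OF in_P_system_of assms(2)] assms(2) by blast+
  show "\<forall>\<beta> \<in> carrier_vec (length \<alpha>s). \<exists>E'. mc_eq as \<alpha>s \<beta> E E'"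
    using ex_mc_eq[OF E assms] by blast
  show "\<forall>E0. mc_eq as \<alpha>s (0\<^sub>v (length \<alpha>s)) E E0 \<longrightarrow> gauge_equiv (length as) E0 E"
    using mc_eq_zero[OF E assms irred] by blast
  show "\<forall>\<beta> \<in> carrier_vec (length \<alpha>s). \<forall>F E1.
      mid_laplace_eq as \<alpha>s E F \<and> non_exceptional_eq (length \<alpha>s) (addition_eq (- \<beta>) F) \<and>
      mc_eq as \<alpha>s \<beta> E E1 \<longrightarrow>
        is_equation as \<alpha>s E1 \<and> irreducible_eq (length as) E1 \<and> non_exceptional_eq (length as) E1 \<and>
        (\<forall>\<gamma> \<in> carrier_vec (length \<alpha>s). \<forall>E2 E3.
          mc_eq as \<alpha>s \<gamma> E1 E2 \<and> mc_eq as \<alpha>s (\<beta> + \<gamma>) E E3 \<longrightarrow> gauge_equiv (length as) E2 E3)"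
  proof (intro ballI allI impI, elim conjE)
    fix \<beta> :: "complex vec" and F E1
    assume \<beta>: "\<beta> \<in> carrier_vec (length \<alpha>s)" and F: "mid_laplace_eq as \<alpha>s E F"
      and ne: "non_exceptional_eq (length \<alpha>s) (addition_eq (- \<beta>) F)" and E1: "mc_eq as \<alpha>s \<beta> E E1"
    note eq1 = mc_eq_realization(2)[OF E assms E1]
    show "is_equation as \<alpha>s E1 \<and> irreducible_eq (length as) E1 \<and> non_exceptional_eq (length as) E1 \<and>
        (\<forall>\<gamma> \<in> carrier_vec (length \<alpha>s). \<forall>E2 E3.
          mc_eq as \<alpha>s \<gamma> E1 E2 \<and> mc_eq as \<alpha>s (\<beta> + \<gamma>) E E3 \<longrightarrow> gauge_equiv (length as) E2 E3)"
      using eq1 mc_eq_irreducible[OF E assms irred F ne E1]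
        irreducible_system_iff[OF in_P_system_of[OF eq1 assms(2)] assms(2)]
        mc_eq_mc_eq[OF E assms irred F ne E1 _ _ \<beta>] by blast
  qed
qed

end
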